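(* Let $\mathbb X=\mathbb R^d$ and let $F:\mathcal P_2(\mathbb R^d)\to\mathbb R$ satisfy the following: $F(\mu)=\int V\,d\mu+F_1(\mu)$ for some $V\in\mathcal C^2(\mathbb R^d)$ and $F_1:\mathcal P_2(\mathbb R^d)\to\mathbb R$, with $\nabla V(0)=0$, and there exist $M,\lambda,r,K,L,c_0,c_1,R_0,R_1>0$ such that for all $\mu\in\mathcal P_2(\mathbb R^d)$, $y\in\mathbb R^d$, \[ |DF_1(\mu,y)|\leqslant M\sqrt d+\lambda|y|+\lambda\int_{\mathbb R^d}|x|\mu(dx), \] \[ |\nabla^2V(y)|\leqslant L,\qquad -y\cdot\nabla V(y)\leqslant-r|y|^2+Kd,\qquad dR_1+c_1|y|^2\geqslant V(y)\geqslant dR_0+c_0|y|^2. \] Let $\gamma>0$ and set \[ \alpha=\min\Big(\frac\gamma2\Big(\frac{2\gamma^2}{r}+\frac{19}{12}\Big)^{-1},\sqrt{\frac{c_0}2}\Big),\qquad \theta=\frac12\min\Big(\frac{\alpha r}{5c_1},\gamma\Big), \] \[ \lambda_0=\min\Big(\frac r3,\ \frac{2\alpha}3,\ \frac{r\alpha c_0^2}{176(1+\alpha)^3},\ \frac{2\theta}{1+\alpha}\Big(\frac{16}{c_0^3N}+2\Big)^{-1}\Big). \] For $\mathbf z=(z_i)_{i=1}^N\in\mathbb R^{2dN}$, $z_i=(x_i,v_i)$, let \[ \varphi(z_i)=V(x_i)+\frac12|v_i|^2+\alpha\,x_i\cdot v_i,\qquad \mathbf V(\mathbf z)=\sum_{i=1}^N\varphi^3(z_i).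 \] Then there exist $h_0,C>0$ depending only on $\mathfrak p=(M,L,c_0,R_0,R_1,r,K,\gamma)$ (in particular not on $N$, $d$, $h$) such that, if $h\leqslant h_0$ (and $0<h<\gamma^{-1}$) and $\lambda\leqslant\lambda_0$, then, for all $N\in\mathbb N$ and $\mathbf z\in\mathbb R^{2dN}$, \[ \mathcal P(\mathbf V)(\mathbf z)\leqslant(1-\theta h)\mathbf V(\mathbf z)+CNhd^3, \] where $\mathcal P$ is the transition operator of the $N$-particle chain with parameters $h,\gamma$ defined in the context.
   Context: $\mathcal P_2(\mathbb R^d)$ is the set of probability measures on $\mathbb R^d$ with finite second moment. The linear derivative of a functional $F$ is the function $\frac{\delta F}{\delta m}$ with $F(\mu)-F(\nu)=\int_0^1\int\frac{\delta F}{\delta m}((1-t)\nu+t\mu,x)(\mu-\nu)(dx)dt$, and the intrinsic derivative is $DF(\mu,x)=\nabla_x\frac{\delta F}{\delta m}(\mu,x)$ (assumed to exist). For $\mathbf x\in\mathbb R^{dN}$, $\pi_{\mathbf x}=\frac1N\sum_{i=1}^N\delta_{x_i}$ and $U_N(\mathbf x)=NF(\pi_{\mathbf x})$, for which $\nabla_{x_i}U_N(\mathbf x)=DF(\pi_{\mathbf x},x_i)=\nabla V(x_i)+DF_1(\pi_{\mathbf x},x_i)$. Chain: with $\eta=1-\gamma h$, the Verlet map is $\Phi(\mathbf x,\mathbf v)=(\bar{\mathbf x},\bar{\mathbf v})$ with $\bar{\mathbf x}=\mathbf x+h\mathbf v-\frac{h^2}2\nabla U_N(\mathbf x)$, $\bar{\mathbf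 v}=\mathbf v-\frac h2(\nabla U_N(\mathbf x)+\nabla U_N(\bar{\mathbf x}))$; $\mathcal Df(\mathbf x,\mathbf v)=\mathbb E[f(\mathbf x,\eta\mathbf v+\sqrt{1-\eta^2}\,\mathbf G)]$ with $\mathbf G\sim\mathcal N(0,I_{dN})$; the transition operator is $\mathcal Pf=\mathcal D(f\circ\Phi)$. The quantity $\lambda_0$ depends on $N$; the inequality is asserted for those $N$ for which $\lambda\leqslant\lambda_0$. *)

theory Defs
  imports "HOL-Probability.Probability"
begin

text \<open>
  The constants of the drift inequality must not depend on the dimension, so the dimension is a
  natural number quantified inside the statement. All the spaces \<open>\<real>\<^sup>d\<close> are realised as the subspaces
  \<open>Rd d\<close> of one real inner product space, the finitely supported real sequences with the
  Euclidean inner product. A function on \<open>\<real>\<^sup>d\<close> is a function on this type of which only the values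
  on \<open>Rd d\<close> are used; derivatives are taken within \<open>Rd d\<close>.
\<close>

typedef fseq = "{f :: nat \<Rightarrow> real. finite {i. f i \<noteq> 0}}"
  morphisms coord Abs_fseq
  by (rule exI[of _ "\<lambda>_. 0"]) simp

setup_lifting type_definition_fseq

lemma finite_coord: "finite {i. coord x i \<noteq> 0}"
  using coord[of x] by simp

instantiation fseq :: real_vector
begin

lift_definition zero_fseq :: fseq is "\<lambda>_. 0" by simp

lift_definition plus_fseq :: "fseq \<Rightarrow> fseq \<Rightarrow> fseq" is "\<lambda>f g i. f i + g i"
  subgoal for f g
    by (rule finite_subset[of _ "{i. f i \<noteq> 0} \<union> {i. g i \<noteq> 0}"]) auto
  done

lift_definition minus_fseq :: "fseq \<Rightarrow> fseq \<Rightarrow> fseq" is "\<lambda>f g i. f i - g i"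
  subgoal for f g
    by (rule finite_subset[of _ "{i. f i \<noteq> 0} \<union> {i. g i \<noteq> 0}"]) auto
  done

lift_definition uminus_fseq :: "fseq \<Rightarrow> fseq" is "\<lambda>f i. - f i" by simp

lift_definition scaleR_fseq :: "real \<Rightarrow> fseq \<Rightarrow> fseq" is "\<lambda>a f i. a * f i"
  by simp

instance
  by standard (transfer, auto simp: algebra_simps fun_eq_iff)+

end

lemma coord_simps [simp]:
  "coord 0 i = 0"
  "coord (x + y) i = coord x i + coord y i"
  "coord (x - y) i = coord x i - coord y i"
  "coord (- x) i = - coord x i"
  "coord (a *\<^sub>R x) i = a * coord x i"
  by (transfer, simp)+

lemma fseq_eqI: "(\<And>i. coord x i = coord y i) \<Longrightarrow> x = y"
  by transfer auto

instantiation fseq :: real_inner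
begin

definition inner_fseq :: "fseq \<Rightarrow> fseq \<Rightarrow> real"
  where "inner_fseq x y = (\<Sum>i | coord x i \<noteq> 0. coord x i * coord y i)"

definition norm_fseq :: "fseq \<Rightarrow> real"
  where "norm_fseq x = sqrt (inner x x)"

definition sgn_fseq :: "fseq \<Rightarrow> fseq"
  where "sgn_fseq x = x /\<^sub>R norm x"

definition dist_fseq :: "fseq \<Rightarrow> fseq \<Rightarrow> real"
  where "dist_fseq x y = norm (x - y)"

definition uniformity_fseq :: "(fseq \<times> fseq) filter"
  where "uniformity_fseq = (INF e\<in>{0<..}. principal {(x, y). dist x y < e})"

definition open_fseq :: "fseq set \<Rightarrow> bool"
  where "open_fseq S \<longleftrightarrow> (\<forall>x\<in>S. \<forall>\<^sub>F (x', y) in uniformity. x' = x \<longrightarrow> y \<in> S)"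

lemma inner_fseq_superset:
  assumes "finite A" "{i. coord x i \<noteq> 0} \<subseteq> A"
  shows "inner x y = (\<Sum>i\<in>A. coord x i * coord y i)"
  unfolding inner_fseq_def by (rule sum.mono_neutral_left) (use assms in auto)

instance
proof
  fix x y z :: fseq and a :: real
  let ?A = "{i. coord x i \<noteq> 0} \<union> {i. coord y i \<noteq> 0}"
  have A: "finite ?A"
    by (simp add: finite_coord)
  have "inner x y = (\<Sum>i\<in>?A. coord x i * coord y i)"
    by (rule inner_fseq_superset) (use A in auto)
  moreover have "inner y x = (\<Sum>i\<in>?A. coord y i * coord x i)"
    by (rule inner_fseq_superset) (use A in auto)
  ultimately show "inner x y = inner y x"
    by (simp add: mult.commute)
  have "inner (x + y) z = (\<Sum>i\<in>?A. coord (x + y) i * coord z i)"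
    by (rule inner_fseq_superset) (use A in auto)
  moreover have "inner x z = (\<Sum>i\<in>?A. coord x i * coord z i)"
    by (rule inner_fseq_superset) (use A in auto)
  moreover have "inner y z = (\<Sum>i\<in>?A. coord y i * coord z i)"
    by (rule inner_fseq_superset) (use A in auto)
  ultimately show "inner (x + y) z = inner x z + inner y z"
    by (simp add: algebra_simps sum.distrib)
  have "inner (a *\<^sub>R x) y = (\<Sum>i | coord x i \<noteq> 0. coord (a *\<^sub>R x) i * coord y i)"
    by (rule inner_fseq_superset) (auto simp: finite_coord)
  then show "inner (a *\<^sub>R x) y = a * inner x y"
    by (simp add: inner_fseq_def sum_distrib_left mult.assoc)
  show "0 \<le> inner x x"
    by (simp add: inner_fseq_def sum_nonneg)
  show "inner x x = 0 \<longleftrightarrow> x = 0"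
  proof
    assume "inner x x = 0"
    then have "\<forall>i\<in>{i. coord x i \<noteq> 0}. coord x i * coord x i = 0"
      unfolding inner_fseq_def by (subst (asm) sum_nonneg_eq_0_iff) (auto simp: finite_coord)
    then show "x = 0"
      by (intro fseq_eqI) auto
  qed (simp add: inner_fseq_def)
qed (simp_all add: norm_fseq_def sgn_fseq_def dist_fseq_def uniformity_fseq_def open_fseq_def)

end

definition Rd :: "nat \<Rightarrow> fseq set"
  where "Rd d = {x. \<forall>i\<ge>d. coord x i = 0}"

lift_definition vec_of :: "nat \<Rightarrow> (nat \<Rightarrow> real) \<Rightarrow> fseq" is "\<lambda>d w i. if i < d then w i else 0"
  by (rule finite_subset[of _ "{..<_}"]) auto


subsection \<open>Differential calculus on \<open>\<real>\<^sup>d\<close>\<close>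

definition has_grad :: "nat \<Rightarrow> (fseq \<Rightarrow> real) \<Rightarrow> fseq \<Rightarrow> fseq \<Rightarrow> bool"
  where "has_grad d f g x \<longleftrightarrow>
    g \<in> Rd d \<and> (f has_derivative (\<lambda>u. g \<bullet> u)) (at x within Rd d)"

text \<open>\<open>f\<close> is of class \<open>C\<^sup>2\<close> on \<open>\<real>\<^sup>d\<close>, with gradient \<open>g\<close> and Hessian \<open>H\<close> (as a linear map).\<close>

definition C2_on :: "nat \<Rightarrow> (fseq \<Rightarrow> real) \<Rightarrow> (fseq \<Rightarrow> fseq) \<Rightarrow> (fseq \<Rightarrow> fseq \<Rightarrow> fseq) \<Rightarrow> bool"
  where "C2_on d f g H \<longleftrightarrow>
    (\<forall>x\<in>Rd d. has_grad d f (g x) x \<and> (g has_derivative H x) (at x within Rd d)) \<and>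
    (\<forall>u\<in>Rd d. continuous_on (Rd d) (\<lambda>x. H x u))"

text \<open>The operator norm on \<open>\<real>\<^sup>d\<close>, i.e. \<^const>\<open>onorm\<close> restricted to the subspace.\<close>

definition opnorm :: "nat \<Rightarrow> (fseq \<Rightarrow> fseq) \<Rightarrow> real"
  where "opnorm d A = (SUP u\<in>Rd d. norm (A u) / norm u)"


subsection \<open>Functionals of probability measures\<close>

definition borel_Rd :: "nat \<Rightarrow> fseq measure"
  where "borel_Rd d = restrict_space borel (Rd d)"

definition P2 :: "nat \<Rightarrow> fseq measure set"
  where "P2 d = {\<mu>. prob_space \<mu> \<and> sets \<mu> = sets (borel_Rd d) \<and> integrable \<mu> (\<lambda>x. (norm x)\<^sup>2)}"

text \<open>The mixture \<open>(1 - t) \<nu> + t \<mu>\<close>.\<close>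

definition mixture :: "real \<Rightarrow> fseq measure \<Rightarrow> fseq measure \<Rightarrow> fseq measure"
  where "mixture t \<nu> \<mu> = measure_of (space \<nu>) (sets \<nu>)
    (\<lambda>A. ennreal (1 - t) * emeasure \<nu> A + ennreal t * emeasure \<mu> A)"

text \<open>A predicate, since the linear derivative is only determined up to an additive constant
  depending on the measure.\<close>

definition linear_derivative ::
    "nat \<Rightarrow> (fseq measure \<Rightarrow> real) \<Rightarrow> (fseq measure \<Rightarrow> fseq \<Rightarrow> real) \<Rightarrow> bool"
  where "linear_derivative d F \<delta> \<longleftrightarrow> (\<forall>\<mu>\<in>P2 d. \<forall>\<nu>\<in>P2 d.
    (\<forall>t\<in>{0..1}. integrable \<mu> (\<delta> (mixture t \<nu> \<mu>)) \<and> integrable \<nu> (\<delta> (mixture t \<nu> \<mu>))) \<and>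
    ((\<lambda>t. (\<integral>x. \<delta> (mixture t \<nu> \<mu>) x \<partial>\<mu>) - (\<integral>x. \<delta> (mixture t \<nu> \<mu>) x \<partial>\<nu>))
      has_integral (F \<mu> - F \<nu>)) {0..1})"

text \<open>\<open>D\<close> is the intrinsic derivative \<open>\<nabla>\<^sub>x \<delta>F/\<delta>m\<close> of \<open>F\<close> (for some version of the linear derivative).\<close>

definition intrinsic_derivative ::
    "nat \<Rightarrow> (fseq measure \<Rightarrow> real) \<Rightarrow> (fseq measure \<Rightarrow> fseq \<Rightarrow> fseq) \<Rightarrow> bool"
  where "intrinsic_derivative d F D \<longleftrightarrow> (\<exists>\<delta>. linear_derivative d F \<delta> \<and>
    (\<forall>\<mu>\<in>P2 d. \<forall>x\<in>Rd d. has_grad d (\<delta> \<mu>) (D \<mu> x) x))"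


subsection \<open>The particle system\<close>

text \<open>Configurations in \<open>(\<real>\<^sup>d)\<^sup>N\<close> are functions of the particle index, used only at indices below \<open>N\<close>.\<close>

definition emp :: "nat \<Rightarrow> nat \<Rightarrow> (nat \<Rightarrow> fseq) \<Rightarrow> fseq measure"
  where "emp d N x = distr (uniform_count_measure {..<N}) (borel_Rd d) x"

definition potN :: "nat \<Rightarrow> (fseq measure \<Rightarrow> real) \<Rightarrow> nat \<Rightarrow> (nat \<Rightarrow> fseq) \<Rightarrow> real"
  where "potN d F N x = real N * F (emp d N x)"

text \<open>\<open>G x i\<close> is the gradient of \<open>N F(\<pi>\<^sub>x)\<close> with respect to the position of particle \<open>i\<close>.\<close>

definition is_grad_potN ::
    "nat \<Rightarrow> (fseq measure \<Rightarrow> real) \<Rightarrow> nat \<Rightarrow> ((nat \<Rightarrow> fseq) \<Rightarrow> nat \<Rightarrow> fseq) \<Rightarrow> bool"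
  where "is_grad_potN d F N G \<longleftrightarrow> (\<forall>x. (\<forall>i<N. x i \<in> Rd d) \<longrightarrow>
    (\<forall>i<N. has_grad d (\<lambda>y. potN d F N (x(i := y))) (G x i) (x i)))"

type_synonym state = "(nat \<Rightarrow> fseq) \<times> (nat \<Rightarrow> fseq)"

text \<open>One step of the Verlet scheme for the force field \<open>- G\<close>.\<close>

definition verlet :: "real \<Rightarrow> ((nat \<Rightarrow> fseq) \<Rightarrow> nat \<Rightarrow> fseq) \<Rightarrow> state \<Rightarrow> state"
  where "verlet h G = (\<lambda>(x, v).
    let x' = (\<lambda>i. x i + h *\<^sub>R v i - (h\<^sup>2 / 2) *\<^sub>R G x i)
    in (x', \<lambda>i. v i - (h / 2) *\<^sub>R (G x i + G x' i)))"

text \<open>The standard Gaussian on \<open>\<real>\<^sup>d\<^sup>N\<close>; coordinate \<open>(i, k)\<close> is the \<open>k\<close>-th coordinate of particle \<open>i\<close>.\<close>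

definition gauss :: "nat \<Rightarrow> nat \<Rightarrow> (nat \<times> nat \<Rightarrow> real) measure"
  where "gauss d N = PiM ({..<N} \<times> {..<d}) (\<lambda>_. density lborel (\<lambda>s. ennreal (std_normal_density s)))"

definition refresh :: "nat \<Rightarrow> real \<Rightarrow> state \<Rightarrow> (nat \<times> nat \<Rightarrow> real) \<Rightarrow> state"
  where "refresh d \<eta> = (\<lambda>(x, v) \<omega>.
    (x, \<lambda>i. \<eta> *\<^sub>R v i + sqrt (1 - \<eta>\<^sup>2) *\<^sub>R vec_of d (\<lambda>k. \<omega> (i, k))))"

definition damping :: "nat \<Rightarrow> nat \<Rightarrow> real \<Rightarrow> (state \<Rightarrow> real) \<Rightarrow> state \<Rightarrow> real"
  where "damping d N \<eta> f z = (\<integral>\<omega>. f (refresh d \<eta> z \<omega>) \<partial>gauss d N)"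

definition transition ::
    "nat \<Rightarrow> nat \<Rightarrow> real \<Rightarrow> real \<Rightarrow> ((nat \<Rightarrow> fseq) \<Rightarrow> nat \<Rightarrow> fseq) \<Rightarrow> (state \<Rightarrow> real) \<Rightarrow> state \<Rightarrow> real"
  where "transition d N \<gamma> h G f = damping d N (1 - \<gamma> * h) (f \<circ> verlet h G)"


subsection \<open>The Lyapunov function and its constants\<close>

definition lyap1 :: "(fseq \<Rightarrow> real) \<Rightarrow> real \<Rightarrow> fseq \<Rightarrow> fseq \<Rightarrow> real"
  where "lyap1 V \<alpha> x v = V x + (norm v)\<^sup>2 / 2 + \<alpha> * (x \<bullet> v)"

definition lyap :: "nat \<Rightarrow> (fseq \<Rightarrow> real) \<Rightarrow> real \<Rightarrow> state \<Rightarrow> real"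
  where "lyap N V \<alpha> = (\<lambda>(x, v). \<Sum>i<N. (lyap1 V \<alpha> (x i) (v i)) ^ 3)"

definition alpha_const :: "real \<Rightarrow> real \<Rightarrow> real \<Rightarrow> real"
  where "alpha_const \<gamma> r c0 = min (\<gamma> / 2 * inverse (2 * \<gamma>\<^sup>2 / r + 19 / 12)) (sqrt (c0 / 2))"

definition theta_const :: "real \<Rightarrow> real \<Rightarrow> real \<Rightarrow> real \<Rightarrow> real"
  where "theta_const \<gamma> r c0 c1 = 1 / 2 * min (alpha_const \<gamma> r c0 * r / (5 * c1)) \<gamma>"

definition lambda0 :: "real \<Rightarrow> real \<Rightarrow> real \<Rightarrow> real \<Rightarrow> nat \<Rightarrow> real"
  where "lambda0 \<gamma> r c0 c1 N =
    (let \<alpha> = alpha_const \<gamma> r c0; \<theta> = theta_const \<gamma> r c0 c1 in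
     Min {r / 3, 2 * \<alpha> / 3, r * \<alpha> * c0\<^sup>2 / (176 * (1 + \<alpha>) ^ 3),
          2 * \<theta> / (1 + \<alpha>) * inverse (16 / (c0 ^ 3 * real N) + 2)})"

end

theory Submission
  imports Defs
begin

text \<open>
  The energy \<open>\<phi>(x, v) = V(x) + |v|\<^sup>2/2 + \<alpha> x\<cdot>v\<close> of one particle is comparable to \<open>d + |x|\<^sup>2 + |v|\<^sup>2\<close>.
  One step of the chain raises it by at most \<open>\<ell>\<cdot>\<xi> + h D + O(h\<^sup>2) + O(|\<xi>|\<^sup>2)\<close>, with \<open>\<xi>\<close> the Gaussian noise,
  \<open>\<ell>\<close> linear in the state, and \<open>D \<le> - (3/2) \<theta> \<phi> - (2/5) \<alpha> r |x|\<^sup>2 + (9/4) \<lambda> m \<phi>\<^sup>1\<^sup>/\<^sup>2 + O(d)\<close>, \<open>m\<close> being the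
  mean of the \<open>|x\<^sub>j|\<close>. In the expectation of the cube the linear term in \<open>\<xi>\<close> vanishes to first order.
  After multiplication with \<open>3 \<phi>\<^sup>2\<close> and summation over the particles, Young's inequality splits the
  mean field term \<open>\<lambda> m \<phi>\<^sup>5\<^sup>/\<^sup>2\<close> into a multiple of \<open>\<lambda> \<phi>\<^sup>3\<close>, absorbed because \<open>\<lambda> \<le> \<theta>\<close>, and a multiple of
  \<open>\<lambda> |x|\<^sup>6\<close>, absorbed by \<open>\<alpha> r |x|\<^sup>2 \<phi>\<^sup>2\<close> because of the bound on \<open>\<lambda>\<close> by \<open>r \<alpha> c\<^sub>0\<^sup>2\<close>. Terms of lower order
  in \<open>\<phi>\<close> cost \<open>O(h d\<^sup>3)\<close>.

  The interaction force is only known to be bounded, not continuous, so the gradient of the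
  potential is not identified with \<open>\<nabla>V + DF\<^sub>1\<close>; the bound on \<open>DF\<^sub>1\<close> gives a Lipschitz estimate for
  \<open>F\<^sub>1\<close> along empirical measures, hence the same bound for the gradient whenever it exists.

  The constants must not depend on \<open>c\<^sub>1\<close>. Since \<open>|\<nabla>\<^sup>2V| \<le> L\<close>, the upper bound on \<open>V\<close> also holds with
  \<open>min c\<^sub>1 L\<close> in place of \<open>c\<^sub>1\<close>, for which \<open>\<theta>\<close> is bounded below.
\<close>

subsection \<open>Calculus on the coordinate subspaces\<close>

lemma Rd_zero [simp]: "0 \<in> Rd d"
  and Rd_add [simp]: "x \<in> Rd d \<Longrightarrow> y \<in> Rd d \<Longrightarrow> x + y \<in> Rd d"
  and Rd_diff [simp]: "x \<in> Rd d \<Longrightarrow> y \<in> Rd d \<Longrightarrow> x - y \<in> Rd d"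
  and Rd_scale [simp]: "x \<in> Rd d \<Longrightarrow> a *\<^sub>R x \<in> Rd d"
  by (simp_all add: Rd_def)

lemma coord_vec_of [simp]: "coord (vec_of d w) k = (if k < d then w k else 0)"
  by transfer simp

lemma vec_of_Rd [simp]: "vec_of d w \<in> Rd d"
  by (simp add: Rd_def)

lemma inner_Rd: "x \<in> Rd d \<Longrightarrow> x \<bullet> y = (\<Sum>k<d. coord x k * coord y k)"
  by (rule inner_fseq_superset) (auto simp: Rd_def not_le[symmetric])

lemma norm_Rd: "x \<in> Rd d \<Longrightarrow> (norm x)\<^sup>2 = (\<Sum>k<d. (coord x k)\<^sup>2)"
  unfolding power2_norm_eq_inner by (simp add: inner_Rd power2_eq_square)

definition unit_vec :: "nat \<Rightarrow> fseq"
  where "unit_vec k = vec_of (Suc k) (\<lambda>j. if j = k then 1 else 0)"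

lemma coord_unit_vec [simp]: "coord (unit_vec k) j = (if j = k then 1 else 0)"
  by (simp add: unit_vec_def)

lemma unit_vec_Rd: "k < d \<Longrightarrow> unit_vec k \<in> Rd d"
  by (simp add: Rd_def)

lemma inner_unit_vec: "x \<in> Rd d \<Longrightarrow> k < d \<Longrightarrow> x \<bullet> unit_vec k = coord x k"
  by (simp add: inner_Rd if_distrib cong: if_cong)

lemma coord_sum: "coord (sum f A) k = (\<Sum>i\<in>A. coord (f i) k)"
  by (induction A rule: infinite_finite_induct) simp_all

lemma vec_of_eq_sum: "vec_of d w = (\<Sum>k<d. w k *\<^sub>R unit_vec k)"
  by (rule fseq_eqI) (simp add: coord_sum if_distrib cong: if_cong)

text \<open>A derivative within \<open>Rd d\<close> is only determined, and hence only controlled, on \<open>Rd d\<close>;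
  restricting to the segment makes the standard mean value inequality applicable.\<close>

lemma mean_value_Rd:
  fixes f :: "fseq \<Rightarrow> 'b::real_normed_vector"
  assumes x: "x \<in> Rd d" and y: "y \<in> Rd d"
    and f: "\<And>z. z \<in> Rd d \<Longrightarrow> (f has_derivative f' z) (at z within Rd d)"
    and B: "\<And>t. t \<in> {0..1} \<Longrightarrow> norm (f' (x + t *\<^sub>R (y - x)) (y - x)) \<le> B"
  shows "norm (f y - f x) \<le> B"
proof -
  let ?p = "\<lambda>t::real. x + t *\<^sub>R (y - x)"
  have der: "((\<lambda>t. f (?p t)) has_derivative (\<lambda>s. f' (?p t) (s *\<^sub>R (y - x)))) (at t within {0..1})"
    for t
  proof -
    have "(?p has_derivative (\<lambda>s. s *\<^sub>R (y - x))) (at t within {0..1})"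
      by (auto intro!: derivative_eq_intros)
    moreover have "(f has_derivative f' (?p t)) (at (?p t) within ?p ` {0..1})"
      by (rule has_derivative_subset[OF f]) (use x y in auto)
    ultimately show ?thesis
      using diff_chain_within[of ?p _ t "{0..1}" f "f' (?p t)"] by (simp add: o_def)
  qed
  have "norm (f (?p 1) - f (?p 0)) \<le> B * norm (1 - 0 :: real)"
  proof (rule differentiable_bound[OF _ der])
    fix t :: real assume t: "t \<in> {0..1}"
    have lin: "linear (f' (?p t))"
      using f[of "?p t"] x y by (auto intro: has_derivative_linear)
    show "onorm (\<lambda>s. f' (?p t) (s *\<^sub>R (y - x))) \<le> B"
    proof (rule onorm_le)
      fix s :: real
      show "norm (f' (?p t) (s *\<^sub>R (y - x))) \<le> B * norm s"
        using mult_right_mono[OF B[OF t], of "\<bar>s\<bar>"]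
        by (simp add: linear_scale[OF lin] mult.commute)
    qed
  qed auto
  then show ?thesis by simp
qed

lemma norm_segment_le:
  fixes x y :: "'a::real_normed_vector"
  assumes "t \<in> {0..1}"
  shows "norm (x + t *\<^sub>R (y - x)) \<le> norm x + norm (y - x)"
proof -
  have "norm (t *\<^sub>R (y - x)) \<le> 1 * norm (y - x)"
    unfolding norm_scaleR by (rule mult_right_mono) (use assms in auto)
  then show ?thesis
    using norm_triangle_ineq[of x "t *\<^sub>R (y - x)"] by linarith
qed

lemma norm_le_opnorm:
  assumes "bounded_linear A" "u \<in> Rd d"
  shows "norm (A u) \<le> opnorm d A * norm u"
proof (cases "u = 0")
  case True
  then show ?thesis using assms(1) by (simp add: linear_simps(3))
next
  case False
  have "norm (A u) / norm u \<le> opnorm d A"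
    unfolding opnorm_def
  proof (rule cSUP_upper[OF assms(2)])
    \<comment> \<open>The real supremum in \<open>opnorm\<close> is only meaningful for a bounded
      set; the operator norm of \<open>A\<close> on the whole space supplies the bound. At
      \<open>u = 0\<close> the quotient is 0.\<close>
    show "bdd_above ((\<lambda>u. norm (A u) / norm u) ` Rd d)"
      by (rule bdd_aboveI2[of _ _ "onorm A"]) (rule le_onorm[OF assms(1)])
  qed
  then show ?thesis using False by (simp add: divide_simps)
qed

text \<open>The derivative of \<open>f\<close> in the direction \<open>g\<close> itself is |g|^2,
  while the bound on the increments limits it to |g| \<open>b\<close>. The factor
  \<open>\<beta>\<close> only has to tend to \<open>b\<close>, because a Lipschitz coefficient of
  \<open>F1\<close> along empirical measures varies with the size of the displacement.\<close>

lemma norm_grad_le: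
  assumes g: "has_grad d f g x" and x: "x \<in> Rd d"
    and bound: "\<And>y. y \<in> Rd d \<Longrightarrow> \<bar>f y - f x\<bar> \<le> norm (y - x) * \<beta> (norm (y - x))"
    and \<beta>: "(\<beta> \<longlongrightarrow> b) (at 0)" and b: "0 \<le> b"
  shows "norm g \<le> b"
proof -
  have gR: "g \<in> Rd d" and der: "(f has_derivative (\<lambda>u. g \<bullet> u)) (at x within Rd d)"
    using g by (auto simp: has_grad_def)
  show ?thesis
  proof (cases "g = 0")
    case True
    with b show ?thesis by simp
  next
    case False
    let ?p = "\<lambda>s::real. x + s *\<^sub>R g"
    have "(?p has_derivative (\<lambda>s. s *\<^sub>R g)) (at 0)"
      by (auto intro!: derivative_eq_intros)
    moreover have "(f has_derivative (\<lambda>u. g \<bullet> u)) (at (?p 0) within range ?p)"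
      by (rule has_derivative_subset[of _ _ _ "Rd d"]) (use der gR x in auto)
    ultimately have "((\<lambda>s. f (?p s)) has_derivative (\<lambda>s. s * (norm g)\<^sup>2)) (at 0)"
      using diff_chain_within[of ?p "\<lambda>s. s *\<^sub>R g" 0 UNIV f "\<lambda>u. g \<bullet> u"]
      by (simp add: o_def power2_norm_eq_inner)
    then have "((\<lambda>s. f (?p s)) has_field_derivative (norm g)\<^sup>2) (at 0)"
      by (simp add: has_field_derivative_def mult.commute[of _ "(norm g)\<^sup>2"])
    \<comment> \<open>The limit is taken from the right: for \<open>s > 0\<close> the division keeps
      the inequality and |s g| = s |g|.\<close>
    then have "((\<lambda>s. (f (?p s) - f x) / s) \<longlongrightarrow> (norm g)\<^sup>2) (at_right 0)"
      by (auto simp: has_field_derivative_iff intro: tendsto_within_subset)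
    moreover have "((\<lambda>s. norm g * \<beta> (norm (s *\<^sub>R g))) \<longlongrightarrow> norm g * b) (at_right 0)"
    proof (intro tendsto_intros filterlim_compose[OF \<beta>])
      show "LIM s at_right 0. norm (s *\<^sub>R g) :> at 0"
        unfolding filterlim_at
      proof
        show "\<forall>\<^sub>F s in at_right 0. norm (s *\<^sub>R g) \<in> UNIV \<and> norm (s *\<^sub>R g) \<noteq> 0"
          using eventually_at_right_less[of 0] by eventually_elim (use False in auto)
        have "((\<lambda>s. norm (s *\<^sub>R g)) \<longlongrightarrow> norm (0 *\<^sub>R g)) (at_right 0)"
          by (intro tendsto_intros)
        then show "((\<lambda>s. norm (s *\<^sub>R g)) \<longlongrightarrow> 0) (at_right 0)" by simp
      qed
    qed
    moreover have "\<forall>\<^sub>F s in at_right 0. (f (?p s) - f x) / s \<le> norm g * \<beta> (norm (s *\<^sub>R g))"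
      using eventually_at_right_less[of 0]
    proof eventually_elim
      case (elim s)
      have "f (?p s) - f x \<le> s * (norm g * \<beta> (norm (s *\<^sub>R g)))"
        using bound[of "?p s"] x gR elim by (simp add: mult.assoc)
      then show ?case using elim by (simp add: divide_simps mult.commute)
    qed
    ultimately have "(norm g)\<^sup>2 \<le> norm g * b"
      by (intro tendsto_le[OF trivial_limit_at_right_real])
    then show ?thesis
      using False by (simp add: power2_eq_square)
  qed
qed

subsection \<open>Functionals of empirical measures\<close>

lemma space_borel_Rd [simp]: "space (borel_Rd d) = Rd d"
  by (simp add: borel_Rd_def space_restrict_space)

lemma borel_measurable_Rd: "continuous_on (Rd d) f \<Longrightarrow> f \<in> borel_measurable (borel_Rd d)"
  unfolding borel_Rd_def by (rule borel_measurable_continuous_on_restrict)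

text \<open>Uniform empirical measures are not closed under mixing, finitely supported measures with
  weights are. The index type is arbitrary so that a mixture can be indexed by a disjoint
  sum.\<close>

definition weighted_emp :: "nat \<Rightarrow> 'i set \<Rightarrow> ('i \<Rightarrow> real) \<Rightarrow> ('i \<Rightarrow> fseq) \<Rightarrow> fseq measure"
  where "weighted_emp d I w z = distr (point_measure I (\<lambda>i. ennreal (w i))) (borel_Rd d) z"

lemma sets_weighted_emp [simp]: "sets (weighted_emp d I w z) = sets (borel_Rd d)"
  and space_weighted_emp [simp]: "space (weighted_emp d I w z) = Rd d"
  by (simp_all add: weighted_emp_def)

lemma emp_eq_weighted_emp: "emp d N = weighted_emp d {..<N} (\<lambda>_. 1 / real N)"
  by (simp add: emp_def weighted_emp_def uniform_count_measure_def fun_eq_iff)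

context
  fixes d :: nat and I :: "'i set" and w :: "'i \<Rightarrow> real" and z :: "'i \<Rightarrow> fseq"
  assumes I: "finite I" and w: "\<And>i. i \<in> I \<Longrightarrow> 0 \<le> w i" and z: "\<And>i. i \<in> I \<Longrightarrow> z i \<in> Rd d"
begin

lemma measurable_positions: "z \<in> measurable (point_measure I (\<lambda>i. ennreal (w i))) (borel_Rd d)"
  using z by simp

lemma emeasure_weighted_emp:
  assumes "A \<in> sets (borel_Rd d)"
  shows "emeasure (weighted_emp d I w z) A = (\<Sum>i\<in>I. ennreal (w i) * indicator A (z i))"
proof -
  have "emeasure (weighted_emp d I w z) A = (\<integral>\<^sup>+ y. indicator A y \<partial>weighted_emp d I w z)"
    using assms by simp
  also have "\<dots> = (\<Sum>i\<in>I. ennreal (w i) * indicator A (z i))"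
    unfolding weighted_emp_def
    by (subst nn_integral_distr[OF measurable_positions])
      (use assms I in \<open>simp_all add: nn_integral_point_measure_finite\<close>)
  finally show ?thesis .
qed

lemma
  fixes f :: "fseq \<Rightarrow> real"
  assumes f: "f \<in> borel_measurable (borel_Rd d)"
  shows integrable_weighted_emp: "integrable (weighted_emp d I w z) f"
    and integral_weighted_emp: "(\<integral>y. f y \<partial>weighted_emp d I w z) = (\<Sum>i\<in>I. w i * f (z i))"
  unfolding weighted_emp_def
  using integrable_distr_eq[OF measurable_positions f] integral_distr[OF measurable_positions f]
  by (simp_all add: integrable_point_measure_finite lebesgue_integral_point_measure_finite I w)

lemma weighted_emp_in_P2:
  assumes "sum w I = 1"
  shows "weighted_emp d I w z \<in> P2 d"
proof -
  have "Rd d \<in> sets (borel_Rd d)"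
    using sets.top[of "borel_Rd d"] by simp
  then have "emeasure (weighted_emp d I w z) (Rd d) = (\<Sum>i\<in>I. ennreal (w i))"
    by (subst emeasure_weighted_emp) (use z in \<open>auto intro!: sum.cong\<close>)
  also have "\<dots> = 1"
    by (subst sum_ennreal) (use w assms in auto)
  finally have "prob_space (weighted_emp d I w z)"
    by (intro prob_spaceI) simp
  moreover have "integrable (weighted_emp d I w z) (\<lambda>y. (norm y)\<^sup>2)"
    by (intro integrable_weighted_emp borel_measurable_Rd continuous_intros)
  ultimately show ?thesis
    by (simp add: P2_def)
qed

end

text \<open>A mixture keeps the atoms of both measures and rescales their weights. Indexing by two
  copies of \<open>I\<close> avoids any discussion of coinciding atoms.\<close>

lemma mixture_weighted_emp:
  assumes I: "finite I" and w: "\<And>i. i \<in> I \<Longrightarrow> 0 \<le> w i"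
    and z: "\<And>i. i \<in> I \<Longrightarrow> z i \<in> Rd d" and z': "\<And>i. i \<in> I \<Longrightarrow> z' i \<in> Rd d"
    and t: "t \<in> {0..1}"
  shows "mixture t (weighted_emp d I w z) (weighted_emp d I w z') =
    weighted_emp d (I <+> I) (case_sum (\<lambda>i. (1 - t) * w i) (\<lambda>i. t * w i)) (case_sum z z')"
    (is "_ = ?m")
proof -
  have eq: "ennreal (1 - t) * emeasure (weighted_emp d I w z) A
      + ennreal t * emeasure (weighted_emp d I w z') A = emeasure ?m A"
    if "A \<in> sets (borel_Rd d)" for A
  proof -
    have "emeasure ?m A = (\<Sum>i\<in>I <+> I. ennreal (case i of Inl i \<Rightarrow> (1 - t) * w i | Inr i \<Rightarrow> t * w i)
        * indicator A (case i of Inl i \<Rightarrow> z i | Inr i \<Rightarrow> z' i))"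
      by (rule emeasure_weighted_emp) (use that I w z z' t in auto)
    also have "\<dots> = (\<Sum>i\<in>I. ennreal ((1 - t) * w i) * indicator A (z i))
        + (\<Sum>i\<in>I. ennreal (t * w i) * indicator A (z' i))"
      by (simp only: sum.Plus[OF I I] o_def sum.case)
    finally have "emeasure ?m A = \<dots>" .
    then show ?thesis
      using that t w
      by (simp add: emeasure_weighted_emp I w z z' sum_distrib_left ennreal_mult mult.assoc)
  qed
  \<comment> \<open>\<open>measure_of\<close> falls back to the null measure unless its set function
    is a measure; rewriting that function as \<open>emeasure ?m\<close> excludes this case.\<close>
  have "mixture t (weighted_emp d I w z) (weighted_emp d I w z')
      = measure_of (space ?m) (sets ?m) (emeasure ?m)"
    unfolding mixture_def
    by (simp add: , rule measure_of_eq)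
      (use eq sets.space_closed[of "borel_Rd d"] sets.sigma_sets_eq[of "borel_Rd d"] in auto)
  then show ?thesis
    by (simp only: measure_of_of_measure)
qed

lemma emp_in_P2:
  assumes "N \<ge> 1" "\<And>i. i < N \<Longrightarrow> x i \<in> Rd d"
  shows "emp d N x \<in> P2 d"
  unfolding emp_eq_weighted_emp by (rule weighted_emp_in_P2) (use assms in auto)

lemma
  fixes f :: "fseq \<Rightarrow> real"
  assumes "\<And>i. i < N \<Longrightarrow> x i \<in> Rd d" "f \<in> borel_measurable (borel_Rd d)"
  shows integral_emp: "(\<integral>y. f y \<partial>emp d N x) = (\<Sum>i<N. f (x i)) / N"
  unfolding emp_eq_weighted_emp
  by (subst integral_weighted_emp) (use assms in \<open>auto simp: sum_divide_distrib\<close>)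

text \<open>The linear derivative is evaluated at these mixtures, so they have to lie in
  \<open>P2 d\<close>, with first moments bounded uniformly in \<open>t\<close>. Expressing the
  bound by \<open>x\<close> and the displacements makes it tend to the mean at \<open>x\<close> as
  \<open>y\<close> tends to \<open>x\<close>.\<close>

lemma
  assumes N: "N \<ge> 1" and x: "\<And>i. i < N \<Longrightarrow> x i \<in> Rd d" and y: "\<And>i. i < N \<Longrightarrow> y i \<in> Rd d"
    and t: "t \<in> {0..1}"
  shows mixture_emp_in_P2: "mixture t (emp d N x) (emp d N y) \<in> P2 d" (is ?P2)
    and integral_norm_mixture_emp:
      "(\<integral>z. norm z \<partial>mixture t (emp d N x) (emp d N y)) \<le>
        (\<Sum>i<N. norm (x i)) / N + (\<Sum>i<N. norm (y i - x i)) / N" (is ?le)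
proof -
  have mix: "mixture t (emp d N x) (emp d N y) = weighted_emp d ({..<N} <+> {..<N})
      (case_sum (\<lambda>_. (1 - t) * (1 / N)) (\<lambda>_. t * (1 / N))) (case_sum x y)"
    unfolding emp_eq_weighted_emp by (rule mixture_weighted_emp) (use x y t in auto)
  show ?P2
    unfolding mix by (rule weighted_emp_in_P2) (use x y t N in \<open>auto simp: sum.Plus field_simps\<close>)
  have "norm (y i) \<le> norm (x i) + norm (y i - x i)" for i
    using norm_triangle_ineq[of "x i" "y i - x i"] by simp
  then have "t * norm (y i) \<le> t * (norm (x i) + norm (y i - x i))" for i
    using t by (intro mult_left_mono) auto
  moreover have "t * norm (y i - x i) \<le> norm (y i - x i)" for i
    using t by (simp add: mult_left_le_one_le)
  ultimately have "(1 - t) * norm (x i) + t * norm (y i) \<le> norm (x i) + norm (y i - x i)" for i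
    by (simp add: algebra_simps) (smt (verit))
  then have "(\<Sum>i<N. (1 - t) * norm (x i) + t * norm (y i)) \<le> (\<Sum>i<N. norm (x i) + norm (y i - x i))"
    by (intro sum_mono)
  then have "(\<Sum>i<N. (1 - t) * norm (x i) + t * norm (y i)) / N \<le>
      (\<Sum>i<N. norm (x i) + norm (y i - x i)) / N"
    by (intro divide_right_mono) auto
  moreover have "(\<integral>z. norm z \<partial>mixture t (emp d N x) (emp d N y))
      = (\<Sum>i<N. (1 - t) * norm (x i) + t * norm (y i)) / N"
    unfolding mix
    by (subst integral_weighted_emp)
      (use x y t in \<open>auto simp: sum.Plus sum_divide_distrib sum.distrib add_divide_distrib
        sum_distrib_left intro!: borel_measurable_Rd continuous_intros\<close>)
  ultimately show ?le
    by (simp add: sum.distrib add_divide_distrib)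
qed

text \<open>Each summand is the displacement of one particle times a bound for the intrinsic
  derivative that holds on the whole segment from \<open>x i\<close> to \<open>y i\<close> and at
  all mixtures of the two empirical measures.\<close>

definition emp_modulus :: "real \<Rightarrow> real \<Rightarrow> nat \<Rightarrow> (nat \<Rightarrow> fseq) \<Rightarrow> (nat \<Rightarrow> fseq) \<Rightarrow> real"
  where "emp_modulus a l N x y =
    (\<Sum>i<N. norm (y i - x i) * (a + l * (norm (x i) + norm (y i - x i))
      + l * ((\<Sum>j<N. norm (x j)) / N + (\<Sum>j<N. norm (y j - x j)) / N))) / N"

text \<open>The linear derivative is integrated along the mixtures of the two empirical measures.
  Pairing atoms of equal index turns the difference of the two integrals into an average of
  increments from \<open>x i\<close> to \<open>y i\<close>, and the mean value inequality bounds
  each by the intrinsic derivative.\<close>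

lemma functional_emp_lipschitz:
  fixes F :: "fseq measure \<Rightarrow> real"
  assumes D: "intrinsic_derivative d F D"
    and bound: "\<And>\<mu> y. \<mu> \<in> P2 d \<Longrightarrow> y \<in> Rd d \<Longrightarrow>
      norm (D \<mu> y) \<le> a + l * norm y + l * (\<integral>x. norm x \<partial>\<mu>)"
    and l: "l \<ge> 0" and N: "N \<ge> 1"
    and x: "\<And>i. i < N \<Longrightarrow> x i \<in> Rd d" and y: "\<And>i. i < N \<Longrightarrow> y i \<in> Rd d"
  shows "\<bar>F (emp d N y) - F (emp d N x)\<bar> \<le>
    emp_modulus a l N x y" (is "_ \<le> ?B")
proof -
  obtain \<delta> where lin: "linear_derivative d F \<delta>"
    and grad: "\<And>\<mu> x. \<mu> \<in> P2 d \<Longrightarrow> x \<in> Rd d \<Longrightarrow> has_grad d (\<delta> \<mu>) (D \<mu> x) x"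
    using D by (auto simp: intrinsic_derivative_def)
  define m where "m t = mixture t (emp d N x) (emp d N y)" for t
  let ?s = "(\<Sum>j<N. norm (x j)) / N + (\<Sum>j<N. norm (y j - x j)) / N"
  let ?I = "\<lambda>t. (\<integral>z. \<delta> (m t) z \<partial>emp d N y) - (\<integral>z. \<delta> (m t) z \<partial>emp d N x)"
  have mP2: "m t \<in> P2 d" and mnorm: "(\<integral>z. norm z \<partial>m t) \<le> ?s" if "t \<in> {0..1}" for t
    unfolding m_def using mixture_emp_in_P2 integral_norm_mixture_emp N x y that by blast+
  have emp: "emp d N x \<in> P2 d" "emp d N y \<in> P2 d"
    by (auto intro!: emp_in_P2 N x y)
  have intg: "(?I has_integral (F (emp d N y) - F (emp d N x))) {0..1}"
    using lin emp by (auto simp: linear_derivative_def m_def)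
  have meas: "\<delta> (m t) \<in> borel_measurable (borel_Rd d)" if "t \<in> {0..1}" for t
  proof -
    have "continuous_on (Rd d) (\<delta> (m t))"
      using grad[OF mP2[OF that]]
      by (intro has_derivative_continuous_on) (auto simp: has_grad_def)
    then show ?thesis by (rule borel_measurable_Rd)
  qed
  have inc: "\<bar>\<delta> (m t) (y i) - \<delta> (m t) (x i)\<bar> \<le>
      norm (y i - x i) * (a + l * (norm (x i) + norm (y i - x i)) + l * ?s)"
    if t: "t \<in> {0..1}" and i: "i < N" for t i
  proof -
    have "norm (\<delta> (m t) (y i) - \<delta> (m t) (x i)) \<le>
        norm (y i - x i) * (a + l * (norm (x i) + norm (y i - x i)) + l * ?s)"
    proof (rule mean_value_Rd[OF x[OF i] y[OF i]])
      fix z assume z: "z \<in> Rd d"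
      show "(\<delta> (m t) has_derivative (\<bullet>) (D (m t) z)) (at z within Rd d)"
        using grad[OF mP2[OF t] z] by (simp add: has_grad_def)
    next
      fix s :: real assume s: "s \<in> {0..1}"
      let ?z = "x i + s *\<^sub>R (y i - x i)"
      have "norm (D (m t) ?z) \<le> a + l * norm ?z + l * (\<integral>x. norm x \<partial>m t)"
        by (rule bound[OF mP2[OF t]]) (use x y i in auto)
      also have "\<dots> \<le> a + l * (norm (x i) + norm (y i - x i)) + l * ?s"
        using norm_segment_le[OF s, of "x i" "y i"] mnorm[OF t] l
        by (intro add_mono mult_left_mono) auto
      finally have *: "norm (D (m t) ?z) \<le> a + l * (norm (x i) + norm (y i - x i)) + l * ?s" .
      have "norm (D (m t) ?z \<bullet> (y i - x i)) \<le> norm (D (m t) ?z) * norm (y i - x i)"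
        by (simp add: Cauchy_Schwarz_ineq2)
      also have "\<dots> \<le> (a + l * (norm (x i) + norm (y i - x i)) + l * ?s) * norm (y i - x i)"
        by (rule mult_right_mono[OF *]) simp
      finally show "norm (D (m t) ?z \<bullet> (y i - x i)) \<le>
          norm (y i - x i) * (a + l * (norm (x i) + norm (y i - x i)) + l * ?s)"
        by (simp add: mult.commute)
    qed
    then show ?thesis by simp
  qed
  have I_le: "norm (?I t) \<le> ?B" if t: "t \<in> {0..1}" for t
  proof -
    have "?I t = (\<Sum>i<N. \<delta> (m t) (y i) - \<delta> (m t) (x i)) / N"
      using x y meas[OF t] by (simp add: integral_emp sum_subtractf diff_divide_distrib)
    also have "\<bar>\<dots>\<bar> \<le> (\<Sum>i<N. \<bar>\<delta> (m t) (y i) - \<delta> (m t) (x i)\<bar>) / N"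
      by (simp add: divide_right_mono)
    also have "\<dots> \<le> ?B"
      unfolding emp_modulus_def by (intro divide_right_mono sum_mono inc[OF t]) auto
    finally show ?thesis by simp
  qed
  have "0 \<le> ?B"
    using order_trans[OF norm_ge_zero I_le[of 0]] by simp
  from has_integral_bound[OF this, of ?I "F (emp d N y) - F (emp d N x)" 0 1] intg I_le
  show ?thesis by simp
qed

section \<open>The potential of the particle system and its gradient\<close>

locale mean_field_potential =
  fixes d :: nat and a l :: real
    and V :: "fseq \<Rightarrow> real" and gV :: "fseq \<Rightarrow> fseq"
    and F F1 :: "fseq measure \<Rightarrow> real" and DF1 :: "fseq measure \<Rightarrow> fseq \<Rightarrow> fseq"
  assumes F: "\<And>\<mu>. \<mu> \<in> P2 d \<Longrightarrow> F \<mu> = (\<integral>x. V x \<partial>\<mu>) + F1 \<mu>"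
    and gV: "\<And>x. x \<in> Rd d \<Longrightarrow> has_grad d V (gV x) x"
    and DF1: "intrinsic_derivative d F1 DF1"
    and DF1_bound: "\<And>\<mu> y. \<mu> \<in> P2 d \<Longrightarrow> y \<in> Rd d \<Longrightarrow>
      norm (DF1 \<mu> y) \<le> a + l * norm y + l * (\<integral>x. norm x \<partial>\<mu>)"
    and a: "a \<ge> 0" and l: "l \<ge> 0"
begin

lemma continuous_on_V: "continuous_on (Rd d) V"
  using gV by (intro has_derivative_continuous_on) (auto simp: has_grad_def)

lemma potN_eq:
  assumes "N \<ge> 1" "\<And>i. i < N \<Longrightarrow> x i \<in> Rd d"
  shows "potN d F N x = (\<Sum>i<N. V (x i)) + N * F1 (emp d N x)"
  using assms
  by (simp add: potN_def F emp_in_P2 integral_emp borel_measurable_Rd[OF continuous_on_V] distrib_left)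

lemma F1_emp_lipschitz:
  assumes "N \<ge> 1" "\<And>i. i < N \<Longrightarrow> x i \<in> Rd d" "\<And>i. i < N \<Longrightarrow> y i \<in> Rd d"
  shows "\<bar>F1 (emp d N y) - F1 (emp d N x)\<bar> \<le> emp_modulus a l N x y"
  by (rule functional_emp_lipschitz[OF DF1 DF1_bound l]) (use assms in auto)

text \<open>When particle \<open>i\<close> alone moves, the potential minus \<open>V\<close> at that
  particle changes by \<open>N\<close> times an increment of \<open>F1\<close>. This increment is at
  most \<open>emp_modulus\<close>, so \<open>norm_grad_le\<close> bounds the gradient of the
  difference, which is the interaction force.\<close>

lemma force_bound:
  assumes N: "N \<ge> 1" and x: "\<And>j. j < N \<Longrightarrow> x j \<in> Rd d" and i: "i < N"
    and G: "is_grad_potN d F N G"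
  shows "norm (G x i - gV (x i)) \<le> a + l * norm (x i) + l * ((\<Sum>j<N. norm (x j)) / N)"
proof -
  let ?m = "(\<Sum>j<N. norm (x j)) / N"
  let ?\<beta> = "\<lambda>s. a + l * (norm (x i) + s) + l * (?m + s / N)"
  let ?f = "\<lambda>y. potN d F N (x(i := y)) - V y"
  have "has_grad d (\<lambda>y. potN d F N (x(i := y))) (G x i) (x i)"
    using G x i by (auto simp: is_grad_potN_def)
  then have "has_grad d ?f (G x i - gV (x i)) (x i)"
    using gV[OF x[OF i]]
    by (auto simp: has_grad_def inner_diff_left intro!: derivative_intros)
  then show ?thesis
  proof (rule norm_grad_le[where \<beta> = ?\<beta>])
    fix y assume y: "y \<in> Rd d"
    let ?s = "norm (y - x i)"
    have sum_eq: "(\<Sum>j<N. g j (if j = i then y else x j)) - g i y = (\<Sum>j<N. g j (x j)) - g i (x i)"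
      for g :: "nat \<Rightarrow> fseq \<Rightarrow> real"
      using i by (simp add: sum.remove[of "{..<N}" i] cong: if_cong)
    have "?f y - ?f (x i) = N * (F1 (emp d N (x(i := y))) - F1 (emp d N x))"
      using sum_eq[of "\<lambda>_. V"] x y N by (simp add: potN_eq fun_upd_def if_distrib algebra_simps cong: if_cong)
    then have "\<bar>?f y - ?f (x i)\<bar> = N * \<bar>F1 (emp d N (x(i := y))) - F1 (emp d N x)\<bar>"
      by (simp add: abs_mult)
    also have "\<dots> \<le> N * emp_modulus a l N x (x(i := y))"
      by (intro mult_left_mono F1_emp_lipschitz N) (use x y in auto)
    also have "\<dots> = ?s * ?\<beta> ?s"
    proof -
      \<comment> \<open>Only particle \<open>i\<close> is displaced, so a single term survives: the
        outer factor 1/N cancels against \<open>N\<close>, and the mean displacement leaves the s/N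
        in \<open>?\<beta>\<close>.\<close>
      have single: "(\<Sum>j<N. norm ((x(i := y)) j - x j) * c j) = ?s * c i" for c :: "nat \<Rightarrow> real"
        using i by (subst sum.mono_neutral_right[of _ "{i}"]) auto
      show ?thesis
        using N single[of "\<lambda>_. 1"] by (simp add: emp_modulus_def single del: fun_upd_apply) simp
    qed
    finally show "\<bar>?f y - ?f (x i)\<bar> \<le> ?s * ?\<beta> ?s" .
  next
    have "(?\<beta> \<longlongrightarrow> ?\<beta> 0) (at 0)" by (intro tendsto_intros) (use N in auto)
    then show "(?\<beta> \<longlongrightarrow> a + l * norm (x i) + l * ?m) (at 0)" by simp
    show "0 \<le> a + l * norm (x i) + l * ?m"
      using a l by (intro add_nonneg_nonneg mult_nonneg_nonneg divide_nonneg_nonneg sum_nonneg) auto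
  qed (use x i in auto)
qed

text \<open>\<open>emp_modulus\<close> depends continuously on the second configuration and vanishes
  when the two configurations agree, so the increments of \<open>F1\<close> tend to 0. This
  continuity is the source of the measurability of the force.\<close>

lemma continuous_potN:
  fixes Z :: "'b::topological_space \<Rightarrow> nat \<Rightarrow> fseq"
  assumes N: "N \<ge> 1" and Z: "\<And>w i. i < N \<Longrightarrow> Z w i \<in> Rd d"
    and cont: "\<And>i. i < N \<Longrightarrow> continuous_on UNIV (\<lambda>w. Z w i)"
  shows "continuous_on UNIV (\<lambda>w. potN d F N (Z w))"
proof -
  have "continuous_on UNIV (\<lambda>w. F1 (emp d N (Z w)))"
    unfolding continuous_on_def
  proof
    fix w
    define b where "b w' = emp_modulus a l N (Z w) (Z w')" for w'
    have "continuous_on UNIV b"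
      unfolding b_def emp_modulus_def by (intro continuous_intros cont) (use N in auto)
    then have "(b \<longlongrightarrow> b w) (at w)"
      by (simp add: continuous_on_def)
    then have "(b \<longlongrightarrow> 0) (at w)"
      by (simp add: b_def emp_modulus_def)
    then have "((\<lambda>w'. F1 (emp d N (Z w')) - F1 (emp d N (Z w))) \<longlongrightarrow> 0) (at w)"
      by (rule Lim_null_comparison[rotated])
        (use F1_emp_lipschitz[OF N, of "Z w" "Z _"] Z in \<open>auto simp: b_def intro!: always_eventually\<close>)
    then show "((\<lambda>w. F1 (emp d N (Z w))) \<longlongrightarrow> F1 (emp d N (Z w))) (at w within UNIV)"
      by (simp add: LIM_zero_iff)
  qed
  moreover have "continuous_on UNIV (\<lambda>w. V (Z w i))" if "i < N" for i
    by (rule continuous_on_compose2[OF continuous_on_V cont[OF that]]) (use Z that in auto)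
  ultimately show ?thesis
    using Z N by (simp add: potN_eq) (intro continuous_intros; simp)
qed

end

subsection \<open>Gaussian noise\<close>

lemma power_mean_le:
  fixes f :: "'a \<Rightarrow> real"
  assumes "finite I" "I \<noteq> {}" and f: "\<And>i. i \<in> I \<Longrightarrow> 0 \<le> f i"
  shows "((\<Sum>i\<in>I. f i) / card I) ^ n \<le> (\<Sum>i\<in>I. f i ^ n) / card I"
proof -
  have "convex_on {0::real..} (\<lambda>x. x ^ n)"
    by (cases "even n") (auto intro: convex_power_odd convex_on_subset[OF convex_power_even])
  from convex_on_sum[OF assms(1,2) this, of "\<lambda>_. 1 / card I" f] assms
  show ?thesis by (simp add: sum_divide_distrib)
qed

lemma power_sum_le:
  fixes f :: "'a \<Rightarrow> real"
  assumes "finite I" and f: "\<And>i. i \<in> I \<Longrightarrow> 0 \<le> f i"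
  shows "(\<Sum>i\<in>I. f i) ^ Suc n \<le> real (card I) ^ n * (\<Sum>i\<in>I. f i ^ Suc n)"
proof (cases "I = {}")
  case False
  then have "card I > 0" using assms by (simp add: card_gt_0_iff)
  with power_mean_le[OF assms(1) False f, where n = "Suc n"] show ?thesis
    by (simp add: power_divide divide_simps ac_simps)
qed simp

abbreviation std_normal :: "real measure"
  where "std_normal \<equiv> density lborel (\<lambda>s. ennreal (std_normal_density s))"

definition gauss_vec :: "nat \<Rightarrow> (nat \<times> nat \<Rightarrow> real) \<Rightarrow> nat \<Rightarrow> fseq"
  where "gauss_vec d \<omega> i = vec_of d (\<lambda>k. \<omega> (i, k))"

lemma gauss_vec_Rd [simp]: "gauss_vec d \<omega> i \<in> Rd d"
  by (simp add: gauss_vec_def)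

lemma coord_gauss_vec: "k < d \<Longrightarrow> coord (gauss_vec d \<omega> i) k = \<omega> (i, k)"
  by (simp add: gauss_vec_def)

lemma continuous_gauss_vec [continuous_intros]: "continuous_on UNIV (\<lambda>\<omega>. gauss_vec d \<omega> i)"
  unfolding gauss_vec_def vec_of_eq_sum
  by (intro continuous_intros continuous_on_product_coordinates)

lemma prob_space_gauss: "prob_space (gauss d N)"
  unfolding gauss_def by (intro prob_space_PiM prob_space_normal_density) simp

text \<open>\<open>gauss\<close> lives on the extensional functions of a finite product, while
  continuity refers to the product topology on all functions. Coordinates outside the index set are
  constant on the space, so the identity is measurable into the full product, whose sigma-algebra is
  the Borel one as there are countably many coordinates.\<close>

lemma borel_measurable_gauss:
  fixes f :: "(nat \<times> nat \<Rightarrow> real) \<Rightarrow> 'b::topological_space"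
  assumes "continuous_on UNIV f"
  shows "f \<in> borel_measurable (gauss d N)"
proof -
  let ?I = "{..<N} \<times> {..<d}"
  have "(\<lambda>\<omega>. \<omega> p) \<in> borel_measurable (gauss d N)" for p
  proof (cases "p \<in> ?I")
    case True
    then show ?thesis
      unfolding gauss_def using measurable_component_singleton[of p ?I "\<lambda>_. std_normal"]
      by (simp add: measurable_cong_sets[OF refl sets_density])
  next
    case False
    then have "(\<lambda>\<omega>. \<omega> p) \<in> borel_measurable (gauss d N) \<longleftrightarrow>
        (\<lambda>\<omega>. undefined :: real) \<in> borel_measurable (gauss d N)"
      by (intro measurable_cong, cases p) (use False in \<open>auto simp: gauss_def space_PiM PiE_def extensional_def\<close>)
    then show ?thesis by simp
  qed
  then have "(\<lambda>\<omega>. \<omega>) \<in> measurable (gauss d N) (PiM UNIV (\<lambda>_. borel))"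
    by (intro measurable_PiM_single') auto
  then have "(\<lambda>\<omega>. \<omega>) \<in> borel_measurable (gauss d N)"
    using measurable_cong_sets[OF refl sets_PiM_equal_borel] by blast
  from measurable_compose[OF this borel_measurable_continuous_onI[OF assms]]
  show ?thesis .
qed

lemma
  assumes "i < N" "k < d"
  shows integrable_gauss_power: "integrable (gauss d N) (\<lambda>\<omega>. \<omega> (i, k) ^ n)" (is ?int)
    and integral_gauss_1: "(\<integral>\<omega>. \<omega> (i, k) \<partial>gauss d N) = 0" (is ?one)
    and integral_gauss_2: "(\<integral>\<omega>. \<omega> (i, k) ^ 2 \<partial>gauss d N) = 1" (is ?two)
    and integral_gauss_6: "(\<integral>\<omega>. \<omega> (i, k) ^ 6 \<partial>gauss d N) = 15" (is ?six)
proof -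
  let ?I = "{..<N} \<times> {..<d}"
  have p: "(i, k) \<in> ?I" using assms by simp
  have meas: "(\<lambda>\<omega>. \<omega> (i, k)) \<in> measurable (PiM ?I (\<lambda>_. std_normal)) std_normal"
    by (rule measurable_component_singleton[OF p])
  have distr: "distr (PiM ?I (\<lambda>_. std_normal)) std_normal (\<lambda>\<omega>. \<omega> (i, k)) = std_normal"
    by (rule distr_PiM_component[OF prob_space_normal_density p]) simp
  have int: "integrable std_normal (\<lambda>s. s ^ m)" for m
    by (subst integrable_density) (simp_all add: integrable_std_normal_moment)
  show ?int
    using integrable_distr[OF meas, of "\<lambda>s. s ^ n"] int by (simp add: distr gauss_def)
  have eq: "(\<integral>\<omega>. \<omega> (i, k) ^ m \<partial>gauss d N) = (\<integral>s. std_normal_density s * s ^ m \<partial>lborel)" for m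
  proof -
    have "(\<integral>\<omega>. \<omega> (i, k) ^ m \<partial>gauss d N) = (\<integral>s. s ^ m \<partial>std_normal)"
      using integral_distr[OF meas, of "\<lambda>s. s ^ m"] by (simp add: distr gauss_def)
    also have "\<dots> = (\<integral>s. std_normal_density s * s ^ m \<partial>lborel)"
      by (subst integral_density) simp_all
    finally show ?thesis .
  qed
  \<comment> \<open>The moment of order 2k is (2k)! / (2^k k!), that is 1 for k = 1 and 15 for k =
    3.\<close>
  show ?one ?two ?six
    using eq[of 1] integral_std_normal_moment_odd[of 0] eq[of 2] integral_std_normal_moment_even[of 1]
      eq[of 6] integral_std_normal_moment_even[of 3]
    by (simp_all add: fact_numeral)
qed

lemma
  assumes i: "i < N"
  shows integrable_gauss_vec_2: "integrable (gauss d N) (\<lambda>\<omega>. (norm (gauss_vec d \<omega> i))\<^sup>2)"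
    and integral_gauss_vec_2: "(\<integral>\<omega>. (norm (gauss_vec d \<omega> i))\<^sup>2 \<partial>gauss d N) = d"
    and integrable_gauss_vec_inner: "integrable (gauss d N) (\<lambda>\<omega>. u \<bullet> gauss_vec d \<omega> i)"
    and integral_gauss_vec_inner: "(\<integral>\<omega>. u \<bullet> gauss_vec d \<omega> i \<partial>gauss d N) = 0"
proof -
  have sq: "(norm (gauss_vec d \<omega> i))\<^sup>2 = (\<Sum>k<d. \<omega> (i, k) ^ 2)" for \<omega>
    by (simp add: norm_Rd[OF gauss_vec_Rd] coord_gauss_vec)
  have lin: "u \<bullet> gauss_vec d \<omega> i = (\<Sum>k<d. \<omega> (i, k) * coord u k)" for \<omega>
    by (subst inner_commute) (simp add: inner_Rd[OF gauss_vec_Rd] coord_gauss_vec)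
  show "integrable (gauss d N) (\<lambda>\<omega>. (norm (gauss_vec d \<omega> i))\<^sup>2)"
    and "(\<integral>\<omega>. (norm (gauss_vec d \<omega> i))\<^sup>2 \<partial>gauss d N) = d"
    unfolding sq using i by (auto simp: integrable_gauss_power integral_gauss_2
      intro!: Bochner_Integration.integrable_sum)
  have "integrable (gauss d N) (\<lambda>\<omega>. \<omega> (i, k))" if "k < d" for k
    using integrable_gauss_power[OF i that, of 1] by simp
  then show "integrable (gauss d N) (\<lambda>\<omega>. u \<bullet> gauss_vec d \<omega> i)"
    and "(\<integral>\<omega>. u \<bullet> gauss_vec d \<omega> i \<partial>gauss d N) = 0"
    unfolding lin using i by (auto simp: integral_gauss_1 intro!: Bochner_Integration.integrable_sum)
qed

lemma
  assumes i: "i < N"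
  shows integrable_gauss_vec_6: "integrable (gauss d N) (\<lambda>\<omega>. norm (gauss_vec d \<omega> i) ^ 6)"
    and integral_gauss_vec_6: "(\<integral>\<omega>. norm (gauss_vec d \<omega> i) ^ 6 \<partial>gauss d N) \<le> 15 * real d ^ 3"
proof -
  let ?g = "\<lambda>\<omega>. real d ^ 2 * (\<Sum>k<d. \<omega> (i, k) ^ 6)"
  have le: "norm (gauss_vec d \<omega> i) ^ 6 \<le> ?g \<omega>" for \<omega>
  proof -
    have "norm (gauss_vec d \<omega> i) ^ 6 = ((norm (gauss_vec d \<omega> i))\<^sup>2) ^ 3"
      by (simp flip: power_mult)
    also have "\<dots> = (\<Sum>k<d. \<omega> (i, k) ^ 2) ^ 3"
      by (simp add: norm_Rd[OF gauss_vec_Rd] coord_gauss_vec)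
    also have "\<dots> \<le> real d ^ 2 * (\<Sum>k<d. (\<omega> (i, k) ^ 2) ^ 3)"
      using power_sum_le[of "{..<d}" "\<lambda>k. \<omega> (i, k) ^ 2" 2] by (simp add: eval_nat_numeral)
    finally show ?thesis by (simp flip: power_mult)
  qed
  have int: "integrable (gauss d N) ?g"
    using i by (auto intro!: integrable_gauss_power)
  have meas: "(\<lambda>\<omega>. norm (gauss_vec d \<omega> i) ^ 6) \<in> borel_measurable (gauss d N)"
    by (intro borel_measurable_gauss continuous_intros)
  show *: "integrable (gauss d N) (\<lambda>\<omega>. norm (gauss_vec d \<omega> i) ^ 6)"
    by (rule Bochner_Integration.integrable_bound[OF int meas]) (simp add: order_trans[OF le abs_ge_self])
  have "(\<integral>\<omega>. norm (gauss_vec d \<omega> i) ^ 6 \<partial>gauss d N) \<le> (\<integral>\<omega>. ?g \<omega> \<partial>gauss d N)"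
    by (rule integral_mono[OF * int le])
  also have "\<dots> = 15 * real d ^ 3"
    using i by (simp add: integrable_gauss_power integral_gauss_6 power3_eq_cube power2_eq_square)
  finally show "(\<integral>\<omega>. norm (gauss_vec d \<omega> i) ^ 6 \<partial>gauss d N) \<le> 15 * real d ^ 3" .
qed

section \<open>Measurability of the force and of the Lyapunov function after one step\<close>

context mean_field_potential
begin

text \<open>\<open>G\<close> is given only as a gradient at each configuration. Each of its
  coordinates is the pointwise limit of difference quotients of the potential with steps 1/(n+1),
  and these are continuous in the noise.\<close>

lemma force_measurable:
  fixes Z :: "(nat \<times> nat \<Rightarrow> real) \<Rightarrow> nat \<Rightarrow> fseq"
  assumes N: "N \<ge> 1" and G: "is_grad_potN d F N G"
    and Z: "\<And>\<omega> i. i < N \<Longrightarrow> Z \<omega> i \<in> Rd d"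
    and cont: "\<And>i. i < N \<Longrightarrow> continuous_on UNIV (\<lambda>\<omega>. Z \<omega> i)"
    and i: "i < N" and k: "k < d"
  shows "(\<lambda>\<omega>. coord (G (Z \<omega>) i) k) \<in> borel_measurable (gauss d N')"
proof -
  let ?U = "\<lambda>s \<omega>. potN d F N ((Z \<omega>)(i := Z \<omega> i + s *\<^sub>R unit_vec k))"
  let ?q = "\<lambda>n \<omega>. (?U (1 / Suc n) \<omega> - ?U 0 \<omega>) / (1 / Suc n)"
  have U: "continuous_on UNIV (?U s)" for s
  proof (rule continuous_potN[OF N])
    fix j assume "j < N"
    then show "continuous_on UNIV (\<lambda>\<omega>. ((Z \<omega>)(i := Z \<omega> i + s *\<^sub>R unit_vec k)) j)"
      by (cases "j = i") (use cont in \<open>auto intro!: continuous_intros\<close>)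
  qed (use Z i unit_vec_Rd[OF k] in auto)
  have "?q n \<in> borel_measurable (gauss d N')" for n
    by (intro borel_measurable_gauss continuous_on_divide continuous_on_diff continuous_on_const U) simp
  moreover have "(\<lambda>n. ?q n \<omega>) \<longlonglongrightarrow> coord (G (Z \<omega>) i) k" for \<omega>
  proof -
    let ?g = "G (Z \<omega>) i" and ?p = "\<lambda>s::real. Z \<omega> i + s *\<^sub>R unit_vec k"
    have grad: "?g \<in> Rd d"
      and der: "((\<lambda>y. potN d F N ((Z \<omega>)(i := y))) has_derivative (\<bullet>) ?g) (at (Z \<omega> i) within Rd d)"
      using G Z i by (auto simp: is_grad_potN_def has_grad_def)
    have "(?p has_derivative (\<lambda>s. s *\<^sub>R unit_vec k)) (at 0)"
      by (auto intro!: derivative_eq_intros)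
    moreover have "((\<lambda>y. potN d F N ((Z \<omega>)(i := y))) has_derivative (\<bullet>) ?g) (at (?p 0) within range ?p)"
      by (rule has_derivative_subset[of _ _ _ "Rd d"]) (use der Z i unit_vec_Rd[OF k] in auto)
    ultimately have "((\<lambda>s. ?U s \<omega>) has_derivative (\<lambda>s. s * coord ?g k)) (at 0)"
      using diff_chain_within[of ?p "\<lambda>s. s *\<^sub>R unit_vec k" 0 UNIV
          "\<lambda>y. potN d F N ((Z \<omega>)(i := y))" "(\<bullet>) ?g"]
      by (simp add: o_def inner_unit_vec[OF grad k])
    then have "((\<lambda>s. ?U s \<omega>) has_field_derivative coord ?g k) (at 0)"
      by (simp add: has_field_derivative_def mult.commute[of _ "coord ?g k"])
    then have "((\<lambda>s. (?U s \<omega> - ?U 0 \<omega>) / s) \<longlongrightarrow> coord ?g k) (at 0)"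
      by (simp add: has_field_derivative_iff)
    moreover have "filterlim (\<lambda>n. 1 / real (Suc n)) (at 0) sequentially"
      unfolding filterlim_at using LIMSEQ_inverse_real_of_nat by (simp add: inverse_eq_divide)
    ultimately show ?thesis
      by (rule filterlim_compose)
  qed
  ultimately show ?thesis
    by (rule borel_measurable_LIMSEQ_real[rotated])
qed

end

lemma verlet_refresh:
  fixes d h \<eta> x v \<omega> G
  defines "w \<equiv> \<lambda>i. \<eta> *\<^sub>R v i + sqrt (1 - \<eta>\<^sup>2) *\<^sub>R gauss_vec d \<omega> i"
  defines "y \<equiv> \<lambda>i. x i + h *\<^sub>R w i - (h\<^sup>2 / 2) *\<^sub>R G x i"
  shows "verlet h G (refresh d \<eta> (x, v) \<omega>) = (y, \<lambda>i. w i - (h / 2) *\<^sub>R (G x i + G y i))"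
  by (simp add: verlet_def refresh_def Let_def w_def y_def gauss_vec_def)

text \<open>The new velocity contains the force at the random new positions, which is measurable
  coordinate by coordinate; norm and inner product are therefore expanded in coordinates. The
  positions are continuous in the noise, since the force enters them only at the old
  configuration.\<close>

lemma (in mean_field_potential) lyap_measurable:
  assumes N: "N \<ge> 1" and G: "is_grad_potN d F N G"
    and x: "\<And>i. i < N \<Longrightarrow> x i \<in> Rd d" and v: "\<And>i. i < N \<Longrightarrow> v i \<in> Rd d"
  shows "(\<lambda>\<omega>. lyap N V \<alpha> (verlet h G (refresh d \<eta> (x, v) \<omega>))) \<in> borel_measurable (gauss d N')"
proof -
  define w where "w \<omega> i = \<eta> *\<^sub>R v i + sqrt (1 - \<eta>\<^sup>2) *\<^sub>R gauss_vec d \<omega> i" for \<omega> i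
  define y where "y \<omega> i = x i + h *\<^sub>R w \<omega> i - (h\<^sup>2 / 2) *\<^sub>R G x i" for \<omega> i
  define u where "u \<omega> i = w \<omega> i - (h / 2) *\<^sub>R (G x i + G (y \<omega>) i)" for \<omega> i
  have GR: "G z i \<in> Rd d" if "\<And>i. i < N \<Longrightarrow> z i \<in> Rd d" "i < N" for z i
    using G that by (auto simp: is_grad_potN_def has_grad_def)
  have wR: "w \<omega> i \<in> Rd d" if "i < N" for \<omega> i
    using that v by (simp add: w_def)
  have yR: "y \<omega> i \<in> Rd d" if "i < N" for \<omega> i
    using that x wR by (simp add: y_def GR)
  have uR: "u \<omega> i \<in> Rd d" if "i < N" for \<omega> i
    using that x wR yR by (simp add: u_def GR)
  have wc: "continuous_on UNIV (\<lambda>\<omega>. w \<omega> i)" and yc: "continuous_on UNIV (\<lambda>\<omega>. y \<omega> i)" for i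
    unfolding y_def w_def by (intro continuous_intros)+
  have wm: "(\<lambda>\<omega>. coord (w \<omega> i) k) \<in> borel_measurable (gauss d N')" if "i < N" "k < d" for i k
    unfolding inner_unit_vec[OF wR[OF that(1)] that(2), symmetric]
    by (intro borel_measurable_gauss continuous_intros wc)
  have ym: "(\<lambda>\<omega>. coord (y \<omega> i) k) \<in> borel_measurable (gauss d N')" if "i < N" "k < d" for i k
    unfolding inner_unit_vec[OF yR[OF that(1)] that(2), symmetric]
    by (intro borel_measurable_gauss continuous_intros yc)
  have um: "(\<lambda>\<omega>. coord (u \<omega> i) k) \<in> borel_measurable (gauss d N')" if "i < N" "k < d" for i k
    unfolding u_def using force_measurable[OF N G yR yc that, where N' = N'] wm[OF that] by simp
  have Vm: "(\<lambda>\<omega>. V (y \<omega> i)) \<in> borel_measurable (gauss d N')" if "i < N" for i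
    by (rule borel_measurable_gauss, rule continuous_on_compose2[OF continuous_on_V yc])
      (use yR that in auto)
  have "lyap N V \<alpha> (verlet h G (refresh d \<eta> (x, v) \<omega>)) =
      (\<Sum>i<N. (V (y \<omega> i) + (\<Sum>k<d. (coord (u \<omega> i) k)\<^sup>2) / 2
        + \<alpha> * (\<Sum>k<d. coord (y \<omega> i) k * coord (u \<omega> i) k)) ^ 3)" for \<omega>
  proof -
    have "verlet h G (refresh d \<eta> (x, v) \<omega>) = (y \<omega>, u \<omega>)"
      unfolding verlet_refresh by (simp add: u_def[abs_def] y_def[abs_def] w_def[abs_def])
    then show ?thesis
      by (auto simp: lyap_def lyap1_def norm_Rd[OF uR] inner_Rd[OF yR] intro!: sum.cong)
  qed
  then show ?thesis
    using um ym Vm by simp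
qed

subsection \<open>Energy balance of one Verlet step\<close>

lemma abs_inner_le:
  fixes a b :: "'a::real_inner"
  assumes "norm a \<le> r" "norm b \<le> t"
  shows "\<bar>a \<bullet> b\<bar> \<le> r * t"
proof -
  have "norm a * norm b \<le> r * t"
    using assms order_trans[OF norm_ge_zero assms(1)] by (intro mult_mono) auto
  then show ?thesis
    using Cauchy_Schwarz_ineq2[of a b] by linarith
qed

text \<open>\<open>p\<close>, \<open>p'\<close> are the confining forces and \<open>b\<close>, \<open>b'\<close> the interaction forces before and after the
  step, \<open>\<xi>\<close> is the noise, and \<open>s\<close>, \<open>e\<close> bound the sizes of the state and of the noise. No regularity
  of the interaction is available, so \<open>b'\<close> is compared with the bound \<open>\<beta>\<close> and not with \<open>b\<close>.\<close>

lemma verlet_energy: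
  fixes x v \<xi> p p' b b' :: "'a::real_inner"
    and B h \<gamma> \<alpha> L \<beta> s e Va Vb :: real
  defines "w \<equiv> (1 - \<gamma> * h) *\<^sub>R v + \<xi>"
  defines "y \<equiv> x + h *\<^sub>R w - (h\<^sup>2 / 2) *\<^sub>R (p + b)"
  defines "u \<equiv> w - (h / 2) *\<^sub>R (p + b + (p' + b'))"
  assumes h: "0 < h" "h \<le> 1" and B: "1 \<le> B"
    and \<gamma>: "0 < \<gamma>" "\<gamma> \<le> B" "\<gamma> * h \<le> 1" and \<alpha>: "0 < \<alpha>" "\<alpha> \<le> B" and L: "0 \<le> L" "L \<le> B"
    and Vb: "Vb \<le> Va + p \<bullet> (y - x) + L * (norm (y - x))\<^sup>2"
    and p: "norm p \<le> L * norm x" and p': "norm (p' - p) \<le> L * norm (y - x)"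
    and b: "norm b \<le> \<beta>" and \<beta>: "\<beta> \<le> B * s" and b': "norm b' \<le> \<beta> + 5 * B\<^sup>2 * h * (s + e)"
    and x: "norm x \<le> s" and v: "norm v \<le> s" and \<xi>: "norm \<xi> \<le> e"
  shows "Vb + (norm u)\<^sup>2 / 2 + \<alpha> * (y \<bullet> u) \<le>
    Va + (norm v)\<^sup>2 / 2 + \<alpha> * (x \<bullet> v)
    + ((1 - \<gamma> * h) * (1 + 2 * \<alpha> * h)) * (v \<bullet> \<xi>) + \<alpha> * (x \<bullet> \<xi>)
    + h * (- (\<gamma> - \<alpha>) * (norm v)\<^sup>2 - \<alpha> * \<gamma> * (x \<bullet> v) - \<alpha> * (x \<bullet> p) + (norm v + \<alpha> * norm x) * \<beta>)
    + 100 * B ^ 4 * (h\<^sup>2 * s\<^sup>2 + e\<^sup>2)"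
proof -
  define \<Delta> where "\<Delta> = y - x"
  define q where "q = p' - p"
  define g where "g = p + b"
  define S where "S = p + b + (p' + b')"
  \<comment> \<open>\<open>T\<close> bounds the refreshed velocity \<open>w\<close>, and also |x|,
    |v| and the noise, so every second-order error is a multiple of \<open>h^2 T^2\<close>.\<close>
  define T where "T = s + e"
  define \<eta> where "\<eta> = 1 - \<gamma> * h"
  have s0: "0 \<le> s" and e0: "0 \<le> e" and T0: "0 \<le> T"
    using order_trans[OF norm_ge_zero x] order_trans[OF norm_ge_zero \<xi>]
    by (auto simp: T_def)
  have \<eta>: "0 \<le> \<eta>" "\<eta> \<le> 1"
    using \<gamma> h by (auto simp: \<eta>_def)
  have sT: "s \<le> T" "e \<le> T"
    using s0 e0 by (auto simp: T_def)
  have Bk: "B \<le> B ^ 4" "B\<^sup>2 \<le> B ^ 4" "B ^ 3 \<le> B ^ 4" "1 \<le> B ^ 4" "B \<le> B\<^sup>2"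
    using B power_increasing[of 1 4 B] power_increasing[of 2 4 B] power_increasing[of 3 4 B]
      power_increasing[of 0 4 B] power_increasing[of 1 2 B] by auto
  have np: "norm p \<le> B * s"
    using p mult_mono[OF L(2) x] B by auto
  have ng: "norm g \<le> 2 * B * s"
    unfolding g_def using norm_triangle_ineq[of p b] np b \<beta> by linarith
  have nw: "norm w \<le> norm v + e"
  proof -
    have "norm (\<eta> *\<^sub>R v) \<le> norm v"
      using \<eta> mult_right_mono[of \<eta> 1 "norm v"] by simp
    then show ?thesis
      unfolding w_def \<eta>_def[symmetric] using norm_triangle_ineq[of "\<eta> *\<^sub>R v" \<xi>] \<xi> by linarith
  qed
  then have wT: "norm w \<le> T"
    using v by (simp add: T_def)
  have \<Delta>_eq: "\<Delta> = h *\<^sub>R w - (h\<^sup>2 / 2) *\<^sub>R g"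
    by (simp add: \<Delta>_def y_def g_def)
  have hh: "h\<^sup>2 \<le> h" "h * h \<le> h"
    using h by (auto simp: power2_eq_square intro: mult_left_le_one_le)
  have BT: "T \<le> B * T" "B * s \<le> B * T"
    using mult_right_mono[OF B T0] mult_left_mono[OF sT(1), of B] B by auto
  have n\<Delta>: "norm \<Delta> \<le> 2 * B * h * T"
  proof -
    have "norm \<Delta> \<le> h * norm w + h\<^sup>2 / 2 * norm g"
      unfolding \<Delta>_eq using norm_triangle_ineq4[of "h *\<^sub>R w" "(h\<^sup>2 / 2) *\<^sub>R g"] h by simp
    also have "h * norm w \<le> h * (B * T)"
      using wT BT h by (intro mult_left_mono) auto
    also have "h\<^sup>2 / 2 * norm g \<le> h / 2 * (2 * B * T)"
      using hh ng BT h by (intro mult_mono) auto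
    finally show ?thesis by (simp add: algebra_simps)
  qed
  have nq: "norm q \<le> 2 * B\<^sup>2 * h * T"
  proof -
    have "norm q \<le> B * norm \<Delta>"
      using p' mult_right_mono[OF L(2), of "norm \<Delta>"] by (simp add: q_def \<Delta>_def)
    also have "\<dots> \<le> B * (2 * B * h * T)"
      using n\<Delta> B by (intro mult_left_mono) auto
    finally show ?thesis by (simp add: power2_eq_square algebra_simps)
  qed
  have hT: "B\<^sup>2 * h * T \<le> B\<^sup>2 * T" "B * T \<le> B\<^sup>2 * T"
    using h T0 Bk B by (auto intro!: mult_right_mono simp: mult_left_le_one_le)
  have nS: "norm S \<le> 11 * B\<^sup>2 * T"
  proof -
    have S: "S = g + (p + (q + b'))"
      by (simp add: S_def g_def q_def algebra_simps)
    have "norm S \<le> norm g + (norm p + (norm q + norm b'))"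
      unfolding S by (intro order_trans[OF norm_triangle_ineq] add_mono order_refl)
    also have "\<dots> \<le> 2 * B * T + (B * T + (2 * B\<^sup>2 * T + (B * T + 5 * B\<^sup>2 * T)))"
      using ng np nq b'[folded T_def] \<beta> BT hT by linarith
    also have "\<dots> \<le> 11 * B\<^sup>2 * T"
      using hT by linarith
    finally show ?thesis .
  qed
  have nc: "norm (b + b') \<le> 2 * \<beta> + 5 * B\<^sup>2 * h * T"
    using norm_triangle_ineq[of b b'] b b' by (simp add: T_def)
  \<comment> \<open>Common unit for the errors \<open>e1\<close> to \<open>e8\<close>; the
    coefficients are 4, 1, 1, 16, 1, 1, 11 and 5, with sum 40.\<close>
  let ?Q = "B ^ 4 * (h\<^sup>2 * T\<^sup>2)"
  have Q0: "0 \<le> h\<^sup>2 * T\<^sup>2" by simp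
  have Q: "B * (h\<^sup>2 * T\<^sup>2) \<le> ?Q" "B\<^sup>2 * (h\<^sup>2 * T\<^sup>2) \<le> ?Q" "B ^ 3 * (h\<^sup>2 * T\<^sup>2) \<le> ?Q"
    using mult_right_mono[OF Bk(1) Q0] mult_right_mono[OF Bk(2) Q0] mult_right_mono[OF Bk(3) Q0]
    by auto
  have e1: "L * (norm \<Delta>)\<^sup>2 \<le> 4 * ?Q"
  proof -
    have "L * (norm \<Delta>)\<^sup>2 \<le> B * (2 * B * h * T)\<^sup>2"
      using L B n\<Delta> by (intro mult_mono power_mono) auto
    also have "\<dots> = 4 * (B ^ 3 * (h\<^sup>2 * T\<^sup>2))"
      by (simp add: power2_eq_square power3_eq_cube algebra_simps)
    finally show ?thesis using Q by linarith
  qed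
  have e2: "\<bar>h\<^sup>2 / 2 * (p \<bullet> g)\<bar> \<le> ?Q"
  proof -
    have "\<bar>p \<bullet> g\<bar> \<le> (B * T) * (2 * B * T)"
      by (rule abs_inner_le) (use np ng BT in auto)
    then have "h\<^sup>2 / 2 * \<bar>p \<bullet> g\<bar> \<le> h\<^sup>2 / 2 * ((B * T) * (2 * B * T))"
      by (intro mult_left_mono) auto
    also have "h\<^sup>2 / 2 * ((B * T) * (2 * B * T)) = B\<^sup>2 * (h\<^sup>2 * T\<^sup>2)"
      by (simp add: power2_eq_square power3_eq_cube algebra_simps)
    finally have "h\<^sup>2 / 2 * \<bar>p \<bullet> g\<bar> \<le> ?Q"
      using Q by linarith
    then show ?thesis
      using h \<alpha> by (simp only: abs_mult abs_divide abs_power2 abs_numeral abs_of_pos)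
  qed
  have e3: "\<bar>h / 2 * (w \<bullet> q)\<bar> \<le> ?Q"
  proof -
    have "\<bar>w \<bullet> q\<bar> \<le> T * (2 * B\<^sup>2 * h * T)"
      by (rule abs_inner_le) (use wT nq in auto)
    then have "h / 2 * \<bar>w \<bullet> q\<bar> \<le> h / 2 * (T * (2 * B\<^sup>2 * h * T))"
      using h by (intro mult_left_mono) auto
    also have "h / 2 * (T * (2 * B\<^sup>2 * h * T)) = B\<^sup>2 * (h\<^sup>2 * T\<^sup>2)"
      by (simp add: power2_eq_square power3_eq_cube algebra_simps)
    finally have "h / 2 * \<bar>w \<bullet> q\<bar> \<le> ?Q"
      using Q by linarith
    then show ?thesis
      using h \<alpha> by (simp only: abs_mult abs_divide abs_power2 abs_numeral abs_of_pos)
  qed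
  have e4: "h\<^sup>2 / 8 * (norm S)\<^sup>2 \<le> 16 * ?Q"
  proof -
    have "h\<^sup>2 / 8 * (norm S)\<^sup>2 \<le> h\<^sup>2 / 8 * (11 * B\<^sup>2 * T)\<^sup>2"
      using nS by (intro mult_left_mono power_mono) auto
    also have "\<dots> = 121 / 8 * ?Q"
      by (simp add: power2_eq_square power4_eq_xxxx algebra_simps)
    finally have "h\<^sup>2 / 8 * (norm S)\<^sup>2 \<le> 121 / 8 * ?Q" .
    moreover have "0 \<le> ?Q" by simp
    ultimately show ?thesis by linarith
  qed
  have e5: "\<bar>\<alpha> * h\<^sup>2 / 2 * (g \<bullet> w)\<bar> \<le> ?Q"
  proof -
    have "\<bar>g \<bullet> w\<bar> \<le> (2 * B * T) * T"
      by (rule abs_inner_le) (use wT ng BT in auto)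
    then have "\<alpha> * h\<^sup>2 / 2 * \<bar>g \<bullet> w\<bar> \<le> B * h\<^sup>2 / 2 * ((2 * B * T) * T)"
      using \<alpha> B T0 by (intro mult_mono divide_right_mono) auto
    also have "B * h\<^sup>2 / 2 * ((2 * B * T) * T) = B\<^sup>2 * (h\<^sup>2 * T\<^sup>2)"
      by (simp add: power2_eq_square power3_eq_cube algebra_simps)
    finally have "\<alpha> * h\<^sup>2 / 2 * \<bar>g \<bullet> w\<bar> \<le> ?Q"
      using Q by linarith
    then show ?thesis
      using h \<alpha> by (simp only: abs_mult abs_divide abs_power2 abs_numeral abs_of_pos)
  qed
  have e6: "\<bar>\<alpha> * h / 2 * (x \<bullet> q)\<bar> \<le> ?Q"
  proof -
    have "\<bar>x \<bullet> q\<bar> \<le> T * (2 * B\<^sup>2 * h * T)"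
      by (rule abs_inner_le) (use x sT nq in auto)
    then have "\<alpha> * h / 2 * \<bar>x \<bullet> q\<bar> \<le> B * h / 2 * (T * (2 * B\<^sup>2 * h * T))"
      using \<alpha> B T0 h by (intro mult_mono divide_right_mono) auto
    also have "B * h / 2 * (T * (2 * B\<^sup>2 * h * T)) = B ^ 3 * (h\<^sup>2 * T\<^sup>2)"
      by (simp add: power2_eq_square power3_eq_cube algebra_simps)
    finally have "\<alpha> * h / 2 * \<bar>x \<bullet> q\<bar> \<le> ?Q"
      using Q by linarith
    then show ?thesis
      using h \<alpha> by (simp only: abs_mult abs_divide abs_power2 abs_numeral abs_of_pos)
  qed
  have e7: "\<bar>\<alpha> * h / 2 * (\<Delta> \<bullet> S)\<bar> \<le> 11 * ?Q"
  proof -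
    have "\<bar>\<Delta> \<bullet> S\<bar> \<le> (2 * B * h * T) * (11 * B\<^sup>2 * T)"
      by (rule abs_inner_le) (use n\<Delta> nS in auto)
    then have "\<alpha> * h / 2 * \<bar>\<Delta> \<bullet> S\<bar> \<le> B * h / 2 * ((2 * B * h * T) * (11 * B\<^sup>2 * T))"
      using \<alpha> B T0 h by (intro mult_mono divide_right_mono) auto
    also have "B * h / 2 * ((2 * B * h * T) * (11 * B\<^sup>2 * T)) = 11 * ?Q"
      by (simp add: power2_eq_square power4_eq_xxxx algebra_simps)
    finally have "\<alpha> * h / 2 * \<bar>\<Delta> \<bullet> S\<bar> \<le> 11 * ?Q"
      using Q by linarith
    then show ?thesis
      using h \<alpha> by (simp only: abs_mult abs_divide abs_power2 abs_numeral abs_of_pos)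
  qed
  \<comment> \<open>The interaction contributes at order \<open>h\<close>: \<open>b\<close> and
    \<open>b'\<close> are both within \<beta> up to O(h), so half a step times
    \<open>2 * \<beta>\<close> gives exactly the \<beta>-term of the drift. The product of noise and
    interaction is left to \<open>e9\<close>.\<close>
  have e8: "\<bar>h / 2 * (w \<bullet> (b + b'))\<bar> + \<bar>\<alpha> * h / 2 * (x \<bullet> (b + b'))\<bar> \<le>
      h * ((norm v + \<alpha> * norm x) * \<beta>) + h * e * (B * s) + 5 * ?Q"
  proof -
    have "\<bar>w \<bullet> (b + b')\<bar> \<le> (norm v + e) * (2 * \<beta> + 5 * B\<^sup>2 * h * T)"
      and "\<bar>x \<bullet> (b + b')\<bar> \<le> norm x * (2 * \<beta> + 5 * B\<^sup>2 * h * T)"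
      by (rule abs_inner_le; use nw nc in simp)+
    then have "h / 2 * \<bar>w \<bullet> (b + b')\<bar> + \<alpha> * h / 2 * \<bar>x \<bullet> (b + b')\<bar> \<le>
        h / 2 * ((norm v + e) * (2 * \<beta> + 5 * B\<^sup>2 * h * T))
        + \<alpha> * h / 2 * (norm x * (2 * \<beta> + 5 * B\<^sup>2 * h * T))"
      using h \<alpha> by (intro add_mono mult_left_mono) auto
    also have "\<dots> = h * ((norm v + \<alpha> * norm x) * \<beta>) + h * e * \<beta>
        + 5 / 2 * (B\<^sup>2 * h\<^sup>2 * T) * ((norm v + e) + \<alpha> * norm x)"
      by (simp add: power2_eq_square algebra_simps)
    also have "h * e * \<beta> \<le> h * e * (B * s)"
      using h e0 \<beta> by (intro mult_left_mono) auto
    also have "5 / 2 * (B\<^sup>2 * h\<^sup>2 * T) * ((norm v + e) + \<alpha> * norm x) \<le>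
        5 / 2 * (B\<^sup>2 * h\<^sup>2 * T) * (B * T + B * T)"
    proof (intro mult_left_mono add_mono mult_mono)
      show "norm v + e \<le> B * T" using v BT by (simp add: T_def)
    qed (use \<alpha> x sT B T0 in auto)
    also have "\<dots> = 5 * (B ^ 3 * (h\<^sup>2 * T\<^sup>2))"
      by (simp add: power2_eq_square power3_eq_cube algebra_simps)
    finally have "h / 2 * \<bar>w \<bullet> (b + b')\<bar> + \<alpha> * h / 2 * \<bar>x \<bullet> (b + b')\<bar> \<le>
        h * ((norm v + \<alpha> * norm x) * \<beta>) + h * e * (B * s) + 5 * ?Q"
      using Q by linarith
    then show ?thesis
      using h \<alpha> by (simp only: abs_mult abs_divide abs_numeral abs_of_pos)
  qed
  have e9: "h * e * (B * s) \<le> B / 2 * (h\<^sup>2 * s\<^sup>2 + e\<^sup>2)"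
  proof -
    have "0 \<le> B / 2 * (h * s - e)\<^sup>2" using B by simp
    then show ?thesis by (simp add: power2_eq_square algebra_simps)
  qed
  have e10: "\<gamma>\<^sup>2 * h\<^sup>2 / 2 * (norm v)\<^sup>2 \<le> ?Q / 2"
  proof -
    have "\<gamma>\<^sup>2 * (h\<^sup>2 * (norm v)\<^sup>2) \<le> B\<^sup>2 * (h\<^sup>2 * T\<^sup>2)"
      using \<gamma> v sT h by (intro mult_mono power_mono) auto
    then show ?thesis using Q by simp
  qed
  have e11: "(1 / 2 + \<alpha> * h) * (norm \<xi>)\<^sup>2 \<le> 3 / 2 * B * e\<^sup>2"
  proof (intro mult_mono power_mono)
    show "1 / 2 + \<alpha> * h \<le> 3 / 2 * B"
      using mult_mono[of \<alpha> B h 1] \<alpha> h B by auto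
  qed (use \<xi> B in auto)
  \<comment> \<open>Discarding the damping factor here leaves \<alpha> h |v|^2, which combines with
    the friction to -(\<gamma> - \<alpha>) h |v|^2.\<close>
  have e12: "\<alpha> * h * \<eta>\<^sup>2 * (norm v)\<^sup>2 \<le> \<alpha> * h * (norm v)\<^sup>2"
    using \<eta> \<alpha> h by (intro mult_right_mono) (auto simp: mult_left_le power_le_one)
  have TT: "?Q \<le> 2 * B ^ 4 * (h\<^sup>2 * s\<^sup>2 + e\<^sup>2)"
  proof -
    have "T\<^sup>2 \<le> 2 * (s\<^sup>2 + e\<^sup>2)"
      using sum_squares_bound[of s e] by (simp add: T_def power2_eq_square algebra_simps)
    then have "h\<^sup>2 * T\<^sup>2 \<le> h\<^sup>2 * (2 * (s\<^sup>2 + e\<^sup>2))"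
      by (intro mult_left_mono) auto
    also have "\<dots> \<le> 2 * (h\<^sup>2 * s\<^sup>2 + e\<^sup>2)"
      using mult_right_mono[of "h\<^sup>2" 1 "e\<^sup>2"] h by (simp add: algebra_simps power_le_one)
    finally have "B ^ 4 * (h\<^sup>2 * T\<^sup>2) \<le> B ^ 4 * (2 * (h\<^sup>2 * s\<^sup>2 + e\<^sup>2))"
      by (intro mult_left_mono) auto
    then show ?thesis by (simp only: mult.assoc mult.left_commute)
  qed
  have BR: "2 * B * (h\<^sup>2 * s\<^sup>2 + e\<^sup>2) \<le> 2 * B ^ 4 * (h\<^sup>2 * s\<^sup>2 + e\<^sup>2)"
    using Bk by (intro mult_right_mono) auto
  have u: "u = w - (h / 2) *\<^sub>R S" and y: "y = x + \<Delta>"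
    by (simp_all add: u_def S_def \<Delta>_def)
  have nu: "(norm u)\<^sup>2 / 2 = (norm w)\<^sup>2 / 2 - h / 2 * (w \<bullet> S) + h\<^sup>2 / 8 * (norm S)\<^sup>2"
    unfolding u power2_norm_eq_inner
    by (simp add: inner_diff_left inner_diff_right inner_commute power2_eq_square field_simps)
  have yu: "y \<bullet> u = x \<bullet> w + \<Delta> \<bullet> w - h / 2 * (x \<bullet> S) - h / 2 * (\<Delta> \<bullet> S)"
    unfolding u y by (simp add: inner_diff_right inner_add_left algebra_simps)
  have S2: "S = 2 *\<^sub>R p + q + (b + b')"
    by (simp add: S_def q_def algebra_simps scaleR_2)
  have wS: "w \<bullet> S = 2 * (p \<bullet> w) + w \<bullet> q + w \<bullet> (b + b')"
    and xS: "x \<bullet> S = 2 * (x \<bullet> p) + x \<bullet> q + x \<bullet> (b + b')"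
    unfolding S2 by (simp_all add: inner_add_right inner_commute)
  have p\<Delta>: "p \<bullet> \<Delta> = h * (p \<bullet> w) - h\<^sup>2 / 2 * (p \<bullet> g)"
    and \<Delta>w: "\<Delta> \<bullet> w = h * (norm w)\<^sup>2 - h\<^sup>2 / 2 * (g \<bullet> w)"
    unfolding \<Delta>_eq by (simp_all add: inner_diff_right inner_diff_left power2_norm_eq_inner)
  have ww: "(norm w)\<^sup>2 = \<eta>\<^sup>2 * (norm v)\<^sup>2 + 2 * \<eta> * (v \<bullet> \<xi>) + (norm \<xi>)\<^sup>2"
    unfolding w_def \<eta>_def[symmetric] power2_norm_eq_inner
    by (simp add: inner_add_left inner_add_right inner_commute power2_eq_square algebra_simps)
  have xw: "x \<bullet> w = \<eta> * (x \<bullet> v) + x \<bullet> \<xi>"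
    unfolding w_def \<eta>_def[symmetric] by (simp add: inner_add_right)
  \<comment> \<open>The work h (p \<bullet> w) gained by the potential cancels against the kinetic
    energy, where \<open>p\<close> occurs twice in \<open>S\<close>, each time with weight h/2. From
    \<alpha> (y \<bullet> u) remain the confining term -\<alpha> h (x \<bullet> p) and the extra
    \<alpha> h |w|^2.\<close>
  have "Vb + (norm u)\<^sup>2 / 2 + \<alpha> * (y \<bullet> u) \<le>
      Va + (1 / 2 + \<alpha> * h) * (norm w)\<^sup>2 + \<alpha> * (x \<bullet> w) - \<alpha> * h * (x \<bullet> p)
      + (L * (norm \<Delta>)\<^sup>2 - h\<^sup>2 / 2 * (p \<bullet> g) - h / 2 * (w \<bullet> q) + h\<^sup>2 / 8 * (norm S)\<^sup>2
        - \<alpha> * h\<^sup>2 / 2 * (g \<bullet> w) - \<alpha> * h / 2 * (x \<bullet> q) - \<alpha> * h / 2 * (\<Delta> \<bullet> S)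
        - h / 2 * (w \<bullet> (b + b')) - \<alpha> * h / 2 * (x \<bullet> (b + b')))"
    using Vb unfolding nu yu wS xS \<Delta>w \<Delta>_def[symmetric] p\<Delta>
    by (simp add: algebra_simps add_divide_distrib)
  also have "\<dots> \<le> Va + (1 / 2 + \<alpha> * h) * (norm w)\<^sup>2 + \<alpha> * (x \<bullet> w) - \<alpha> * h * (x \<bullet> p)
      + (h * ((norm v + \<alpha> * norm x) * \<beta>) + B / 2 * (h\<^sup>2 * s\<^sup>2 + e\<^sup>2) + 40 * ?Q)"
    using e1 e2 e3 e4 e5 e6 e7 e8 e9 by (simp only: abs_le_iff) linarith
  also have "(1 / 2 + \<alpha> * h) * (norm w)\<^sup>2 \<le> (norm v)\<^sup>2 / 2 - (\<gamma> - \<alpha>) * h * (norm v)\<^sup>2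
      + (\<eta> * (1 + 2 * \<alpha> * h)) * (v \<bullet> \<xi>) + 3 / 2 * B * e\<^sup>2 + ?Q / 2"
  proof -
    have "(1 / 2 + \<alpha> * h) * (norm w)\<^sup>2 = (norm v)\<^sup>2 / 2 - \<gamma> * h * (norm v)\<^sup>2
        + \<gamma>\<^sup>2 * h\<^sup>2 / 2 * (norm v)\<^sup>2 + \<alpha> * h * \<eta>\<^sup>2 * (norm v)\<^sup>2
        + (\<eta> * (1 + 2 * \<alpha> * h)) * (v \<bullet> \<xi>) + (1 / 2 + \<alpha> * h) * (norm \<xi>)\<^sup>2"
    proof -
      have eta_sq: "\<eta>\<^sup>2 = 1 - 2 * \<gamma> * h + \<gamma>\<^sup>2 * h\<^sup>2"
        by (simp add: \<eta>_def power2_eq_square algebra_simps)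
      have "\<eta>\<^sup>2 * (norm v)\<^sup>2 / 2 =
          (norm v)\<^sup>2 / 2 - \<gamma> * h * (norm v)\<^sup>2 + \<gamma>\<^sup>2 * h\<^sup>2 / 2 * (norm v)\<^sup>2"
        unfolding eta_sq by (simp add: field_simps)
      then show ?thesis
        unfolding ww by (simp add: algebra_simps)
    qed
    then show ?thesis
      using e10 e11 e12 by (simp add: algebra_simps)
  qed
  also have "\<alpha> * (x \<bullet> w) = \<alpha> * (x \<bullet> v) - h * (\<alpha> * \<gamma> * (x \<bullet> v)) + \<alpha> * (x \<bullet> \<xi>)"
    unfolding xw by (simp add: \<eta>_def algebra_simps)
  also have "Va + ((norm v)\<^sup>2 / 2 - (\<gamma> - \<alpha>) * h * (norm v)\<^sup>2
      + (\<eta> * (1 + 2 * \<alpha> * h)) * (v \<bullet> \<xi>) + 3 / 2 * B * e\<^sup>2 + ?Q / 2)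
      + (\<alpha> * (x \<bullet> v) - h * (\<alpha> * \<gamma> * (x \<bullet> v)) + \<alpha> * (x \<bullet> \<xi>)) - \<alpha> * h * (x \<bullet> p)
      + (h * ((norm v + \<alpha> * norm x) * \<beta>) + B / 2 * (h\<^sup>2 * s\<^sup>2 + e\<^sup>2) + 40 * ?Q)
    \<le> Va + (norm v)\<^sup>2 / 2 + \<alpha> * (x \<bullet> v)
    + ((1 - \<gamma> * h) * (1 + 2 * \<alpha> * h)) * (v \<bullet> \<xi>) + \<alpha> * (x \<bullet> \<xi>)
    + h * (- (\<gamma> - \<alpha>) * (norm v)\<^sup>2 - \<alpha> * \<gamma> * (x \<bullet> v) - \<alpha> * (x \<bullet> p) + (norm v + \<alpha> * norm x) * \<beta>)
    + 100 * B ^ 4 * (h\<^sup>2 * s\<^sup>2 + e\<^sup>2)"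
  proof -
    let ?R = "h\<^sup>2 * s\<^sup>2 + e\<^sup>2"
    have "3 / 2 * B * e\<^sup>2 \<le> 3 / 2 * B * ?R"
      using B by (intro mult_left_mono) auto
    moreover have "0 \<le> B ^ 4 * ?R"
      using B by simp
    \<comment> \<open>By \<open>TT\<close> the 40 + 1/2 units of \<open>?Q\<close> cost at most 81
      B^4 \<open>?R\<close>, and by \<open>BR\<close> the remaining terms at most 2 B^4
      \<open>?R\<close>; 100 leaves room.\<close>
    ultimately have "3 / 2 * B * e\<^sup>2 + ?Q / 2 + B / 2 * ?R + 40 * ?Q \<le> 100 * B ^ 4 * ?R"
      using TT BR by linarith
    then show ?thesis
      by (simp add: \<eta>_def algebra_simps)
  qed
  finally show ?thesis by simp
qed

subsection \<open>Scalar inequalities\<close>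

text \<open>Cubes the energy bound of one step, with \<open>f^2\<close> the old and \<open>y\<close>
  the new energy, \<open>t\<close> the term linear in the noise and \<open>e\<close> the noise size.
  The coefficient \<open>P^2\<close> of \<open>t\<close> is free of noise, so this term will vanish
  in expectation; \<open>3 * f ^ 4 * (h * D)\<close> is kept exactly, and everything else is
  collected in three monomials.\<close>

lemma cube_le:
  fixes A h f u e D t y :: real
  defines "P \<equiv> f\<^sup>2 + h * D + A * h\<^sup>2 * u\<^sup>2"
  assumes A: "1 \<le> A" and h: "0 < h" "h \<le> 1" and f: "0 \<le> f" "f \<le> u" and e: "0 \<le> e"
    and D: "\<bar>D\<bar> \<le> A * u\<^sup>2" and t: "\<bar>t\<bar> \<le> A * u * e"
    and y: "0 \<le> y" "y \<le> f\<^sup>2 + t + h * D + A * (h\<^sup>2 * u\<^sup>2 + e\<^sup>2)"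
  shows "y ^ 3 \<le> f ^ 6 + 3 * f ^ 4 * (h * D) + 3 * P\<^sup>2 * t
    + 60 * A ^ 3 * (h\<^sup>2 * u ^ 6 + u ^ 4 * e\<^sup>2 + e ^ 6)"
proof -
  define Q where "Q = h * D + A * h\<^sup>2 * u\<^sup>2"
  define w where "w = t + A * e\<^sup>2"
  have u: "0 \<le> u" using f by linarith
  have hh: "h\<^sup>2 \<le> h" "h ^ 3 \<le> h\<^sup>2"
    using h power_decreasing[of 1 2 h] power_decreasing[of 2 3 h] by auto
  have A3: "A \<le> A ^ 3" "A\<^sup>2 \<le> A ^ 3"
    using A power_increasing[of 1 3 A] power_increasing[of 2 3 A] by auto
  have Q: "\<bar>Q\<bar> \<le> 2 * A * h * u\<^sup>2"
  proof -
    have "\<bar>h * D\<bar> \<le> h * (A * u\<^sup>2)"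
      using D h by (simp add: abs_mult)
    moreover have "A * u\<^sup>2 * h\<^sup>2 \<le> A * u\<^sup>2 * h"
      using hh A by (intro mult_left_mono) auto
    moreover have "0 \<le> A * h\<^sup>2 * u\<^sup>2" using A by simp
    ultimately show ?thesis
      unfolding Q_def abs_le_iff by (simp add: algebra_simps)
  qed
  have P: "P = f\<^sup>2 + Q" by (simp add: P_def Q_def)
  have nP: "\<bar>P\<bar> \<le> 3 * A * u\<^sup>2"
  proof -
    have "f\<^sup>2 \<le> A * u\<^sup>2"
      using mult_mono[OF A power_mono[OF f(2,1), of 2]] A by simp
    moreover have "2 * A * h * u\<^sup>2 \<le> 2 * A * 1 * u\<^sup>2"
      using h A by (intro mult_right_mono mult_left_mono) auto
    moreover have "0 \<le> f\<^sup>2" "0 \<le> A * u\<^sup>2" using A by simp_all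
    ultimately show ?thesis
      using Q unfolding P by linarith
  qed
  have nw: "\<bar>w\<bar> \<le> A * (u * e + e\<^sup>2)"
  proof -
    have "0 \<le> A * e\<^sup>2" using A by simp
    then have "\<bar>w\<bar> \<le> A * u * e + A * e\<^sup>2"
      using t unfolding w_def by linarith
    then show ?thesis by (simp add: distrib_left mult.assoc)
  qed
  have y3: "y ^ 3 \<le> (P + w) ^ 3"
    using y by (intro power_mono) (auto simp: P_def w_def algebra_simps)
  have Pw: "(P + w) ^ 3 = P ^ 3 + 3 * P\<^sup>2 * t + 3 * A * (P\<^sup>2 * e\<^sup>2) + 3 * (P * w\<^sup>2) + w ^ 3"
    by (simp add: w_def power2_eq_square power3_eq_cube algebra_simps)
  \<comment> \<open>The constant is 23 = 3 + 3 * 4 + 8, from the three terms beyond the first-order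
    expansion of \<open>P ^ 3\<close>.\<close>
  have b1: "P ^ 3 \<le> f ^ 6 + 3 * f ^ 4 * (h * D) + 23 * A ^ 3 * (h\<^sup>2 * u ^ 6)"
  proof -
    have "P ^ 3 = f ^ 6 + 3 * f ^ 4 * (h * D) + 3 * A * (f ^ 4 * (h\<^sup>2 * u\<^sup>2)) + 3 * (f\<^sup>2 * Q\<^sup>2) + Q ^ 3"
      unfolding P Q_def by (simp add: eval_nat_numeral algebra_simps)
    moreover have "A * (f ^ 4 * (h\<^sup>2 * u\<^sup>2)) \<le> A ^ 3 * (h\<^sup>2 * u ^ 6)"
    proof -
      have "A * (f ^ 4 * (h\<^sup>2 * u\<^sup>2)) \<le> A ^ 3 * (u ^ 4 * (h\<^sup>2 * u\<^sup>2))"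
        using A A3 f by (intro mult_mono power_mono mult_right_mono) auto
      then show ?thesis by (simp add: eval_nat_numeral algebra_simps)
    qed
    moreover have "f\<^sup>2 * Q\<^sup>2 \<le> 4 * A ^ 3 * (h\<^sup>2 * u ^ 6)"
    proof -
      have "f\<^sup>2 * \<bar>Q\<bar>\<^sup>2 \<le> u\<^sup>2 * (2 * A * h * u\<^sup>2)\<^sup>2"
        using f Q by (intro mult_mono power_mono) auto
      also have "\<dots> = A\<^sup>2 * (4 * h\<^sup>2 * u ^ 6)"
        by (simp add: eval_nat_numeral algebra_simps)
      also have "\<dots> \<le> A ^ 3 * (4 * h\<^sup>2 * u ^ 6)"
        using A3 by (intro mult_right_mono) auto
      finally show ?thesis by simp
    qed
    moreover have "Q ^ 3 \<le> 8 * A ^ 3 * (h\<^sup>2 * u ^ 6)"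
    proof -
      have "Q ^ 3 \<le> \<bar>Q\<bar> ^ 3" by (simp flip: power_abs)
      also have "\<dots> \<le> (2 * A * h * u\<^sup>2) ^ 3"
        using Q by (intro power_mono) auto
      also have "\<dots> = 8 * A ^ 3 * u ^ 6 * h ^ 3"
        by (simp add: eval_nat_numeral algebra_simps)
      also have "\<dots> \<le> 8 * A ^ 3 * u ^ 6 * h\<^sup>2"
        using hh A by (intro mult_left_mono) auto
      finally show ?thesis by (simp add: algebra_simps)
    qed
    ultimately show ?thesis by linarith
  qed
  have b2: "A * (P\<^sup>2 * e\<^sup>2) \<le> 9 * A ^ 3 * (u ^ 4 * e\<^sup>2)"
  proof -
    have "A * (\<bar>P\<bar>\<^sup>2 * e\<^sup>2) \<le> A * ((3 * A * u\<^sup>2)\<^sup>2 * e\<^sup>2)"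
      using nP A by (intro mult_left_mono mult_right_mono power_mono) auto
    then show ?thesis by (simp add: eval_nat_numeral algebra_simps)
  qed
  have b3: "P * w\<^sup>2 \<le> 6 * A ^ 3 * (u ^ 4 * e\<^sup>2 + u\<^sup>2 * e ^ 4)"
  proof -
    have "P * w\<^sup>2 \<le> \<bar>P\<bar> * \<bar>w\<bar>\<^sup>2" by (simp add: mult_right_mono)
    also have "\<dots> \<le> (3 * A * u\<^sup>2) * (A * (u * e + e\<^sup>2))\<^sup>2"
      using nP nw by (intro mult_mono power_mono) auto
    also have "\<dots> = (3 * A ^ 3 * u\<^sup>2) * (u * e + e\<^sup>2)\<^sup>2"
      by (simp add: eval_nat_numeral algebra_simps)
    also have "\<dots> \<le> (3 * A ^ 3 * u\<^sup>2) * (2 * ((u * e)\<^sup>2 + (e\<^sup>2)\<^sup>2))"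
    proof (rule mult_left_mono)
      show "(u * e + e\<^sup>2)\<^sup>2 \<le> 2 * ((u * e)\<^sup>2 + (e\<^sup>2)\<^sup>2)"
        using sum_squares_bound[of "u * e" "e\<^sup>2"] by (simp add: power2_sum)
    qed (use A in auto)
    finally show ?thesis by (simp add: eval_nat_numeral algebra_simps)
  qed
  have b4: "w ^ 3 \<le> 4 * A ^ 3 * ((u ^ 4 * e\<^sup>2 + u\<^sup>2 * e ^ 4) / 2 + e ^ 6)"
  proof -
    have "w ^ 3 \<le> \<bar>w\<bar> ^ 3" by (simp flip: power_abs)
    also have "\<dots> \<le> (A * (u * e + e\<^sup>2)) ^ 3"
      using nw by (intro power_mono) auto
    also have "\<dots> = A ^ 3 * (u * e + e\<^sup>2) ^ 3"
      by (simp add: power_mult_distrib)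
    also have "\<dots> \<le> A ^ 3 * (4 * ((u ^ 4 * e\<^sup>2 + u\<^sup>2 * e ^ 4) / 2 + e ^ 6))"
    proof (rule mult_left_mono)
      \<comment> \<open>For a = u e and b = e^2 this is 4 (a^3 + b^3) - (a + b)^3 = 3 (a + b) (a -
        b)^2.\<close>
      have "0 \<le> 3 * ((u * e + e\<^sup>2) * (u * e - e\<^sup>2)\<^sup>2)"
        using u e by simp
      then have "(u * e + e\<^sup>2) ^ 3 \<le> 4 * ((u * e) ^ 3 + (e\<^sup>2) ^ 3)"
        by (simp add: power2_eq_square power3_eq_cube algebra_simps)
      moreover have "0 \<le> (u\<^sup>2 * e - u * e\<^sup>2)\<^sup>2" by simp
      then have "(u * e) ^ 3 + (e\<^sup>2) ^ 3 \<le> (u ^ 4 * e\<^sup>2 + u\<^sup>2 * e ^ 4) / 2 + e ^ 6"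
        by (simp add: eval_nat_numeral algebra_simps)
      ultimately show "(u * e + e\<^sup>2) ^ 3 \<le> 4 * ((u ^ 4 * e\<^sup>2 + u\<^sup>2 * e ^ 4) / 2 + e ^ 6)"
        by (smt (verit))
    qed (use A in auto)
    finally show ?thesis by (simp only: mult.assoc mult.left_commute)
  qed
  \<comment> \<open>The mixed monomial has accumulated the coefficient 20 A^3 and is split evenly.
    The totals for h^2 u^6, u^4 e^2 and e^6 are then 23, 57 and 14 times A^3, all below 60.\<close>
  have "u\<^sup>2 * e ^ 4 \<le> (u ^ 4 * e\<^sup>2 + e ^ 6) / 2"
  proof -
    have "0 \<le> (u\<^sup>2 * e - e ^ 3)\<^sup>2" by simp
    then show ?thesis by (simp add: eval_nat_numeral algebra_simps)
  qed
  then have "A ^ 3 * (u\<^sup>2 * e ^ 4) \<le> A ^ 3 * ((u ^ 4 * e\<^sup>2 + e ^ 6) / 2)"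
    using A by (intro mult_left_mono) auto
  moreover have "0 \<le> A ^ 3 * (h\<^sup>2 * u ^ 6)" "0 \<le> A ^ 3 * (u ^ 4 * e\<^sup>2)" "0 \<le> A ^ 3 * e ^ 6"
    using A by auto
  ultimately show ?thesis
    using y3 b1 b2 b3 b4 unfolding Pw distrib_left add_divide_distrib times_divide_eq_right mult.assoc
    by linarith
qed

text \<open>Young's inequality with exponents 6/5 and 6 for \<open>a\<close> and
  \<open>2 * b\<close>. The weight 2 balances the two coefficients so that the first can be absorbed
  by \<theta> and the second by \<alpha> r c0^2 under the bounds on \<open>lam\<close>.\<close>

lemma pow5_mult_le:
  fixes a b :: real
  assumes "0 \<le> a" "0 \<le> b"
  shows "a ^ 5 * b \<le> 5 / 12 * a ^ 6 + 16 / 3 * b ^ 6"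
proof -
  \<comment> \<open>With c = 2 b this is the factorization of 5 a^6 - 6 a^5 c + c^6, which has a
    double root at a = c.\<close>
  have "0 \<le> (a - 2 * b)\<^sup>2 * (5 * a ^ 4 + 4 * a ^ 3 * (2 * b) + 3 * a\<^sup>2 * (2 * b)\<^sup>2
      + 2 * a * (2 * b) ^ 3 + (2 * b) ^ 4)"
    using assms by (intro mult_nonneg_nonneg add_nonneg_nonneg) auto
  also have "\<dots> = 5 * a ^ 6 + (2 * b) ^ 6 - 6 * a ^ 5 * (2 * b)"
    by (simp add: eval_nat_numeral algebra_simps)
  finally show ?thesis by (simp add: power_mult_distrib)
qed

text \<open>The mean is expanded and Young's inequality applied to every pair of particles; the sum
  over pairs contributes a factor \<open>N\<close> that cancels the division, so the constants are
  free of \<open>N\<close>.\<close>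

lemma sum_pow5_mean_le:
  fixes f X :: "nat \<Rightarrow> real"
  assumes N: "N \<ge> 1" and f: "\<And>i. i < N \<Longrightarrow> 0 \<le> f i" and X: "\<And>i. i < N \<Longrightarrow> 0 \<le> X i"
  shows "(\<Sum>i<N. f i ^ 5 * ((\<Sum>j<N. X j) / N)) \<le>
    5 / 12 * (\<Sum>i<N. f i ^ 6) + 16 / 3 * (\<Sum>i<N. X i ^ 6)"
proof -
  have "(\<Sum>i<N. f i ^ 5 * ((\<Sum>j<N. X j) / N)) = (\<Sum>i<N. \<Sum>j<N. f i ^ 5 * X j) / N"
    by (simp add: sum_divide_distrib sum_distrib_left)
  also have "\<dots> \<le> (\<Sum>i<N. \<Sum>j<N. 5 / 12 * f i ^ 6 + 16 / 3 * X j ^ 6) / N"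
    using f X by (intro divide_right_mono sum_mono pow5_mult_le) auto
  also have "(\<Sum>i<N. \<Sum>j<N. 5 / 12 * f i ^ 6 + 16 / 3 * X j ^ 6) =
      N * (5 / 12 * (\<Sum>i<N. f i ^ 6) + 16 / 3 * (\<Sum>i<N. X i ^ 6))"
    by (simp add: sum.distrib sum_distrib_left distrib_left)
  also have "\<dots> / N = 5 / 12 * (\<Sum>i<N. f i ^ 6) + 16 / 3 * (\<Sum>i<N. X i ^ 6)"
    using N by simp
  finally show ?thesis .
qed

text \<open>Either \<open>D\<close> is at most \<tau> f^2 and the first term suffices, or f^2 is
  below D/\<tau> and the second does. With \<open>D\<close> the dimension this produces the order
  d^3.\<close>

lemma young_4_2:
  fixes f D \<tau> :: real
  assumes "0 < \<tau>" "0 \<le> D"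
  shows "D * f ^ 4 \<le> \<tau> * f ^ 6 + D ^ 3 / \<tau>\<^sup>2"
proof (cases "D \<le> \<tau> * f\<^sup>2")
  case True
  then have "D * f ^ 4 \<le> (\<tau> * f\<^sup>2) * f ^ 4" by (intro mult_right_mono) auto
  also have "\<dots> = \<tau> * f ^ 6" by (simp add: eval_nat_numeral)
  finally have "D * f ^ 4 \<le> \<tau> * f ^ 6" .
  moreover have "0 \<le> D ^ 3 / \<tau>\<^sup>2" using assms by simp
  ultimately show ?thesis by linarith
next
  case False
  then have "f\<^sup>2 \<le> D / \<tau>" using assms by (simp add: field_simps)
  then have "D * (f\<^sup>2)\<^sup>2 \<le> D * (D / \<tau>)\<^sup>2"
    using assms by (intro mult_left_mono power_mono) auto
  then have "D * f ^ 4 \<le> D ^ 3 / \<tau>\<^sup>2"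
    by (simp add: power_divide power2_eq_square power3_eq_cube power4_eq_xxxx mult.assoc)
  moreover have "0 \<le> \<tau> * f ^ 6" using assms by simp
  ultimately show ?thesis by linarith
qed

lemma add_sq_le: "(x + y)\<^sup>2 \<le> 2 * (x\<^sup>2 + y\<^sup>2)" for x y :: real
  using sum_squares_bound[of x y] by (simp add: power2_sum)

lemma add_pow6_le:
  fixes a b :: real
  assumes "0 \<le> a" "0 \<le> b"
  shows "(a + b) ^ 6 \<le> 32 * (a ^ 6 + b ^ 6)"
proof -
  have "(a + b) ^ 6 = ((a + b)\<^sup>2) ^ 3" by (simp flip: power_mult)
  also have "\<dots> \<le> (2 * (a\<^sup>2 + b\<^sup>2)) ^ 3"
    by (intro power_mono add_sq_le) auto
  also have "\<dots> = 8 * (a\<^sup>2 + b\<^sup>2) ^ 3" by (simp only: power_mult_distrib) simp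
  also have "(a\<^sup>2 + b\<^sup>2) ^ 3 \<le> 4 * (a ^ 6 + b ^ 6)"
  proof -
    have "0 \<le> 3 * ((a\<^sup>2 + b\<^sup>2) * (a\<^sup>2 - b\<^sup>2)\<^sup>2)" by simp
    then show ?thesis by (simp add: eval_nat_numeral algebra_simps)
  qed
  finally show ?thesis by simp
qed

subsection \<open>The constants\<close>

text \<open>The first entry of the minimum preserves half of the friction once the cross terms are
  paid in |v|^2; the second makes the quadratic part of the energy positive definite.\<close>

lemma alpha_const:
  assumes "\<gamma> > 0" "r > 0" "c0 > 0"
  shows alpha_const_pos: "0 < alpha_const \<gamma> r c0"
    and alpha_const_friction: "alpha_const \<gamma> r c0 * (2 * \<gamma>\<^sup>2 / r + 19 / 12) \<le> \<gamma> / 2"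
    and alpha_const_sq: "(alpha_const \<gamma> r c0)\<^sup>2 \<le> c0 / 2"
proof -
  let ?\<alpha> = "alpha_const \<gamma> r c0"
  have q: "0 < 2 * \<gamma>\<^sup>2 / r + 19 / 12"
    using assms by (intro add_nonneg_pos) auto
  show pos: "0 < ?\<alpha>"
    unfolding alpha_const_def using assms q by simp
  have "?\<alpha> \<le> \<gamma> / 2 * inverse (2 * \<gamma>\<^sup>2 / r + 19 / 12)"
    unfolding alpha_const_def by simp
  from mult_right_mono[OF this less_imp_le[OF q]]
  have "?\<alpha> * (2 * \<gamma>\<^sup>2 / r + 19 / 12) \<le>
      \<gamma> / 2 * (inverse (2 * \<gamma>\<^sup>2 / r + 19 / 12) * (2 * \<gamma>\<^sup>2 / r + 19 / 12))"
    by (simp only: mult.assoc)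
  also have "\<dots> = \<gamma> / 2"
    using q by (subst left_inverse) auto
  finally show "?\<alpha> * (2 * \<gamma>\<^sup>2 / r + 19 / 12) \<le> \<gamma> / 2" .
  have "?\<alpha> \<le> sqrt (c0 / 2)"
    unfolding alpha_const_def by simp
  then have "?\<alpha>\<^sup>2 \<le> (sqrt (c0 / 2))\<^sup>2"
    using pos by (intro power_mono) auto
  then show "?\<alpha>\<^sup>2 \<le> c0 / 2"
    using assms by simp
qed

lemma theta_const:
  assumes "\<gamma> > 0" "r > 0" "c0 > 0" "c1 > 0"
  shows theta_const_pos: "0 < theta_const \<gamma> r c0 c1"
    and theta_const_le: "theta_const \<gamma> r c0 c1 \<le> \<gamma> / 2"
    and theta_const_c1: "theta_const \<gamma> r c0 c1 * c1 \<le> alpha_const \<gamma> r c0 * r / 10"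
proof -
  let ?\<alpha> = "alpha_const \<gamma> r c0"
  have \<alpha>: "0 < ?\<alpha>" using assms by (simp add: alpha_const_pos)
  show "0 < theta_const \<gamma> r c0 c1"
    unfolding theta_const_def using assms \<alpha> by simp
  show "theta_const \<gamma> r c0 c1 \<le> \<gamma> / 2"
    unfolding theta_const_def by simp
  have "theta_const \<gamma> r c0 c1 \<le> ?\<alpha> * r / (10 * c1)"
    unfolding theta_const_def using min.cobounded1[of "?\<alpha> * r / (5 * c1)" \<gamma>] by (simp add: mult.commute)
  from mult_right_mono[OF this less_imp_le[OF assms(4)]]
  show "theta_const \<gamma> r c0 c1 * c1 \<le> ?\<alpha> * r / 10"
    using assms by simp
qed

text \<open>A smaller growth constant gives a larger rate. Hence a contraction proved with min c1 L
  implies the one with c1, and the value at L is a lower bound for the rate independent of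
  c1.\<close>

lemma theta_const_antimono:
  assumes "\<gamma> > 0" "r > 0" "c0 > 0" "0 < c1" "c1 \<le> c1'"
  shows "theta_const \<gamma> r c0 c1' \<le> theta_const \<gamma> r c0 c1"
proof -
  have "alpha_const \<gamma> r c0 * r / (5 * c1') \<le> alpha_const \<gamma> r c0 * r / (5 * c1)"
    using assms alpha_const_pos[of \<gamma> r c0] by (intro divide_left_mono) auto
  then show ?thesis unfolding theta_const_def by auto
qed

text \<open>The last bound is not an entry of the minimum. For c0 \<le> 2 the third entry gives it,
  since 4/176 is below 1/20; for c0 > 2 also c1 > 2, and \<theta> c1 \<le> \<alpha> r/10 turns (1 +
  \<alpha>) lam \<le> \<theta> into the claim.\<close>

lemma lambda0_le:
  assumes "\<gamma> > 0" "r > 0" "c0 > 0" "c0 \<le> c1" "N \<ge> 1"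
    and lam: "lam > 0" "lam \<le> lambda0 \<gamma> r c0 c1 N"
  shows "lam \<le> r / 3" and "lam \<le> 2 * alpha_const \<gamma> r c0 / 3"
    and "lam \<le> alpha_const \<gamma> r c0 * r * c0\<^sup>2 / 176"
    and "lam \<le> theta_const \<gamma> r c0 c1"
    and "(1 + alpha_const \<gamma> r c0) * lam \<le> alpha_const \<gamma> r c0 * r / 20"
proof -
  define \<alpha> where "\<alpha> = alpha_const \<gamma> r c0"
  define \<theta> where "\<theta> = theta_const \<gamma> r c0 c1"
  have c1: "c1 > 0" using assms by linarith
  have \<alpha>: "0 < \<alpha>" unfolding \<alpha>_def using assms by (simp add: alpha_const_pos)
  have \<theta>: "0 < \<theta>" "\<theta> * c1 \<le> \<alpha> * r / 10"
    unfolding \<alpha>_def \<theta>_def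
    by (rule theta_const_pos[OF assms(1-3) c1]) (rule theta_const_c1[OF assms(1-3) c1])
  have le: "lam \<le> r / 3" "lam \<le> 2 * \<alpha> / 3" "lam \<le> r * \<alpha> * c0\<^sup>2 / (176 * (1 + \<alpha>) ^ 3)"
    "lam \<le> 2 * \<theta> / (1 + \<alpha>) * inverse (16 / (c0 ^ 3 * real N) + 2)"
    using lam(2) unfolding lambda0_def Let_def \<alpha>_def \<theta>_def by auto
  show "lam \<le> r / 3" "lam \<le> 2 * alpha_const \<gamma> r c0 / 3"
    using le by (auto simp: \<alpha>_def)
  have p1: "1 \<le> (1 + \<alpha>) ^ 2" using \<alpha> by (intro one_le_power) auto
  have "(1 + \<alpha>) * lam \<le> (1 + \<alpha>) * (r * \<alpha> * c0\<^sup>2 / (176 * (1 + \<alpha>) ^ 3))"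
    using le(3) \<alpha> by (intro mult_left_mono) auto
  also have "\<dots> = r * \<alpha> * c0\<^sup>2 / 176 / (1 + \<alpha>)\<^sup>2"
    using \<alpha> by (simp add: power2_eq_square power3_eq_cube)
  also have "\<dots> \<le> r * \<alpha> * c0\<^sup>2 / 176 / 1"
    using p1 \<alpha> assms by (intro divide_left_mono) auto
  finally have a: "(1 + \<alpha>) * lam \<le> \<alpha> * r * c0\<^sup>2 / 176" by (simp add: mult.commute)
  \<comment> \<open>As the summand with \<open>N\<close> is nonnegative, the fourth entry is at most
    \<theta>/(1 + \<alpha>) for every \<open>N\<close>.\<close>
  have "inverse (16 / (c0 ^ 3 * real N) + 2) \<le> inverse 2"
    using assms by (intro le_imp_inverse_le) auto
  then have "2 * \<theta> / (1 + \<alpha>) * inverse (16 / (c0 ^ 3 * real N) + 2) \<le> 2 * \<theta> / (1 + \<alpha>) * inverse 2"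
    using \<theta> \<alpha> by (intro mult_left_mono) auto
  also have "\<dots> = \<theta> / (1 + \<alpha>)" using \<alpha> by (simp add: field_simps)
  finally have "lam \<le> \<theta> / (1 + \<alpha>)" using le(4) by linarith
  then have b: "(1 + \<alpha>) * lam \<le> \<theta>" using \<alpha> by (simp add: field_simps)
  have l: "lam \<le> (1 + \<alpha>) * lam" using \<alpha> lam by (simp add: algebra_simps)
  show "lam \<le> alpha_const \<gamma> r c0 * r * c0\<^sup>2 / 176" "lam \<le> theta_const \<gamma> r c0 c1"
    using l a b by (auto simp: \<alpha>_def \<theta>_def)
  show "(1 + alpha_const \<gamma> r c0) * lam \<le> alpha_const \<gamma> r c0 * r / 20"
  proof (cases "c0 \<le> 2")
    case True
    then have "c0\<^sup>2 \<le> 2\<^sup>2" using assms by (intro power_mono) auto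
    then have "\<alpha> * r * c0\<^sup>2 \<le> \<alpha> * r * 4" using \<alpha> assms by (intro mult_left_mono) auto
    moreover have "0 < \<alpha> * r" using \<alpha> assms by simp
    ultimately show ?thesis using a unfolding \<alpha>_def[symmetric] by linarith
  next
    case False
    then have "\<theta> * 2 \<le> \<theta> * c1" using \<theta> assms by (intro mult_left_mono) auto
    then show ?thesis using b \<theta> unfolding \<alpha>_def[symmetric] by linarith
  qed
qed

subsection \<open>Drift of the one-particle energy\<close>

text \<open>\<open>lam_alpha\<close> and \<open>lam_r\<close> absorb the interaction proportional to
  |x|, \<open>lam_c0\<close> and \<open>lam_theta\<close> the mean field term after Young's
  inequality. Here c1 enters through c0 \<le> c1 and the rate, so the locale can be instantiated
  with a smaller growth constant.\<close>

locale drift_constants =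
  fixes \<gamma> r c0 c1 lam :: real
  assumes \<gamma>: "\<gamma> > 0" and r: "r > 0" and c0: "c0 > 0" and c1: "c0 \<le> c1" and lam: "lam > 0"
    and lam_alpha: "lam \<le> 2 * alpha_const \<gamma> r c0 / 3"
    and lam_r: "(1 + alpha_const \<gamma> r c0) * lam \<le> alpha_const \<gamma> r c0 * r / 20"
    and lam_c0: "lam \<le> alpha_const \<gamma> r c0 * r * c0\<^sup>2 / 176"
    and lam_theta: "lam \<le> theta_const \<gamma> r c0 c1"
begin

abbreviation "\<alpha> \<equiv> alpha_const \<gamma> r c0"
abbreviation "\<theta> \<equiv> theta_const \<gamma> r c0 c1"

lemma c1_pos: "c1 > 0"
  using c0 c1 by linarith

lemmas \<alpha>_pos = alpha_const_pos[OF \<gamma> r c0]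
lemmas \<alpha>_sq = alpha_const_sq[OF \<gamma> r c0]
lemmas \<theta>_pos = theta_const_pos[OF \<gamma> r c0 c1_pos]

text \<open>The mixed term is at least -\<alpha>^2 |x|^2 - |v|^2/4, and \<alpha>^2 \<le> c0/2: it
  consumes at most half of the confinement and half of the kinetic energy.\<close>

lemma energy_lower:
  fixes x v :: "'a::real_inner"
  assumes "Vx \<ge> d * R0 + c0 * (norm x)\<^sup>2"
  shows "d * R0 + c0 / 2 * (norm x)\<^sup>2 + (norm v)\<^sup>2 / 4 \<le> Vx + (norm v)\<^sup>2 / 2 + \<alpha> * (x \<bullet> v)"
proof -
  have "- (x \<bullet> v) \<le> norm x * norm v"
    using Cauchy_Schwarz_ineq2[of x v] by linarith
  then have "\<alpha> * (- (x \<bullet> v)) \<le> \<alpha> * (norm x * norm v)"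
    using \<alpha>_pos by (intro mult_left_mono) auto
  moreover have "0 \<le> (\<alpha> * norm x - norm v / 2)\<^sup>2"
    by simp
  then have "\<alpha> * (norm x * norm v) \<le> \<alpha>\<^sup>2 * (norm x)\<^sup>2 + (norm v)\<^sup>2 / 4"
    by (simp add: power2_eq_square algebra_simps)
  moreover have "\<alpha>\<^sup>2 * (norm x)\<^sup>2 \<le> c0 / 2 * (norm x)\<^sup>2"
    using \<alpha>_sq by (intro mult_right_mono) auto
  ultimately show ?thesis using assms by (simp add: algebra_simps)
qed

text \<open>The square of the left side is at most 5 (|v|^2/4 + \<alpha>^2 |x|^2), hence at most 5
  f^2; 9/4 is a rational bound for the square root of 5.\<close>

lemma speed_le:
  fixes x v :: "'a::real_inner"
  assumes f: "0 \<le> f" "c0 / 2 * (norm x)\<^sup>2 + (norm v)\<^sup>2 / 4 \<le> f\<^sup>2"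
  shows "norm v + \<alpha> * norm x \<le> 9 / 4 * f"
proof (rule power2_le_imp_le)
  have "\<alpha>\<^sup>2 * (norm x)\<^sup>2 \<le> c0 / 2 * (norm x)\<^sup>2"
    using \<alpha>_sq by (intro mult_right_mono) auto
  moreover have "0 \<le> (norm v / 2 - 2 * (\<alpha> * norm x))\<^sup>2"
    by simp
  then have "(norm v + \<alpha> * norm x)\<^sup>2 \<le> 5 * ((norm v)\<^sup>2 / 4 + \<alpha>\<^sup>2 * (norm x)\<^sup>2)"
    by (simp add: power2_eq_square algebra_simps)
  moreover note f(2)
  ultimately have "(norm v + \<alpha> * norm x)\<^sup>2 \<le> 5 * f\<^sup>2"
    by (smt (verit))
  also have "\<dots> \<le> 81 / 16 * f\<^sup>2" by (intro mult_right_mono) auto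
  finally show "(norm v + \<alpha> * norm x)\<^sup>2 \<le> (9 / 4 * f)\<^sup>2"
    by (simp add: power_mult_distrib power_divide)
qed (use f in simp)

text \<open>The confinement -\<alpha> r |x|^2 from \<open>t2\<close> is spent as follows: 1/8 of it
  on the friction cross term \<open>t1\<close>, 1/20 on the interaction \<open>t3\<close>, 8/25 on
  \<open>t6\<close>, and 2/5 stays in the conclusion, in total less than 1. In |v|^2 the choice of
  \<alpha> leaves -\<gamma>/2, which \<open>t6\<close> exchanges for the energy.\<close>

lemma energy_drift:
  fixes x v p :: "'a::real_inner"
  assumes Vx: "Vx \<ge> d * R0 + c0 * (norm x)\<^sup>2" "Vx \<le> d * R1 + c1 * (norm x)\<^sup>2"
    and p: "- (x \<bullet> p) \<le> - r * (norm x)\<^sup>2 + K * d"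
    and pos: "0 \<le> m" "0 \<le> M" "0 \<le> d" "0 \<le> K" "0 \<le> R0" "0 \<le> R1"
    and f: "0 \<le> f" "f\<^sup>2 = Vx + (norm v)\<^sup>2 / 2 + \<alpha> * (x \<bullet> v)"
  shows "- (\<gamma> - \<alpha>) * (norm v)\<^sup>2 - \<alpha> * \<gamma> * (x \<bullet> v) - \<alpha> * (x \<bullet> p)
      + (norm v + \<alpha> * norm x) * (M * sqrt d + lam * norm x + lam * m)
    \<le> - (3 / 2) * \<theta> * f\<^sup>2 - 2 / 5 * (\<alpha> * r) * (norm x)\<^sup>2 + 9 / 4 * lam * m * f
      + (\<alpha> * K + 2 * \<theta> * R1 + 13 * M\<^sup>2 / \<theta>) * d"
proof -
  define X where "X = norm x"
  define W where "W = norm v"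
  have XW: "0 \<le> X" "0 \<le> W" by (simp_all add: X_def W_def)
  have \<alpha>r: "0 < \<alpha> * r" using \<alpha>_pos r by simp
  have xv: "\<bar>x \<bullet> v\<bar> \<le> X * W"
    unfolding X_def W_def by (rule Cauchy_Schwarz_ineq2)
  have speed: "W + \<alpha> * X \<le> 9 / 4 * f"
    unfolding X_def W_def
  proof (rule speed_le)
    have "0 \<le> d * R0" using pos by simp
    then show "c0 / 2 * (norm x)\<^sup>2 + (norm v)\<^sup>2 / 4 \<le> f\<^sup>2"
      using energy_lower[OF Vx(1), of v] f by linarith
  qed (use f in simp)
  have fric: "\<alpha> + 2 * \<alpha> * \<gamma>\<^sup>2 / r + 7 / 12 * \<alpha> \<le> \<gamma> / 2"
    using alpha_const_friction[OF \<gamma> r c0] by (simp add: algebra_simps)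
  have t1: "- (\<alpha> * \<gamma> * (x \<bullet> v)) \<le> \<alpha> * r / 8 * X\<^sup>2 + 2 * \<alpha> * \<gamma>\<^sup>2 / r * W\<^sup>2"
  proof -
    have "- (\<alpha> * \<gamma> * (x \<bullet> v)) = \<alpha> * \<gamma> * (- (x \<bullet> v))" by simp
    also have "\<dots> \<le> \<alpha> * \<gamma> * (X * W)"
      using xv \<alpha>_pos \<gamma> by (intro mult_left_mono) auto
    also have "\<dots> \<le> \<alpha> * r / 8 * X\<^sup>2 + 2 * \<alpha> * \<gamma>\<^sup>2 / r * W\<^sup>2"
    proof -
      have "0 \<le> \<alpha> * r / 8 * (X - 4 * \<gamma> / r * W)\<^sup>2" using \<alpha>r by simp
      also have "\<dots> = \<alpha> * r / 8 * X\<^sup>2 + 2 * \<alpha> * \<gamma>\<^sup>2 / r * W\<^sup>2 - \<alpha> * \<gamma> * (X * W)"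
        using r by (simp add: power2_eq_square field_simps)
      finally show ?thesis by simp
    qed
    finally show ?thesis .
  qed
  have t2: "- (\<alpha> * (x \<bullet> p)) \<le> - (\<alpha> * r) * X\<^sup>2 + \<alpha> * K * d"
    using mult_left_mono[OF p, of \<alpha>] \<alpha>_pos by (simp add: X_def algebra_simps)
  have t3: "(W + \<alpha> * X) * (lam * X) \<le> \<alpha> * r / 20 * X\<^sup>2 + \<alpha> / 3 * W\<^sup>2"
  proof -
    have "lam * (W * X) \<le> lam * ((W\<^sup>2 + X\<^sup>2) / 2)"
      using sum_squares_bound[of W X] lam by (intro mult_left_mono) auto
    moreover have "lam * W\<^sup>2 \<le> 2 * \<alpha> / 3 * W\<^sup>2"
      using lam_alpha by (intro mult_right_mono) auto
    moreover have "(1 + \<alpha>) * lam * X\<^sup>2 \<le> \<alpha> * r / 20 * X\<^sup>2"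
      using lam_r by (intro mult_right_mono) auto
    moreover have "0 \<le> lam * X\<^sup>2" using lam by simp
    ultimately show ?thesis
      by (simp add: power2_eq_square algebra_simps add_divide_distrib)
  qed
  have t4: "(W + \<alpha> * X) * (lam * m) \<le> 9 / 4 * lam * m * f"
    using mult_right_mono[OF speed, of "lam * m"] lam pos by (simp add: algebra_simps)
  \<comment> \<open>A tenth of \<theta> f^2 pays for the constant part of the interaction;
    completing the square gives 405/32, which is below 13.\<close>
  have t5: "(W + \<alpha> * X) * (M * sqrt d) \<le> \<theta> / 10 * f\<^sup>2 + 13 * M\<^sup>2 / \<theta> * d"
  proof -
    have "(W + \<alpha> * X) * (M * sqrt d) \<le> 9 / 4 * f * (M * sqrt d)"
      using speed pos by (intro mult_right_mono) auto
    also have "\<dots> \<le> \<theta> / 10 * f\<^sup>2 + 405 / 32 * (M * sqrt d)\<^sup>2 / \<theta>"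
    proof -
      have "0 \<le> \<theta> / 10 * (f - 45 / 4 * q / \<theta>)\<^sup>2" for q using \<theta>_pos by simp
      also have "\<theta> / 10 * (f - 45 / 4 * q / \<theta>)\<^sup>2 = \<theta> / 10 * f\<^sup>2 + 405 / 32 * q\<^sup>2 / \<theta> - 9 / 4 * f * q" for q
        using \<theta>_pos by (simp add: power2_eq_square field_simps)
      finally show ?thesis by simp
    qed
    also have "405 / 32 * (M * sqrt d)\<^sup>2 / \<theta> \<le> 13 * (M * sqrt d)\<^sup>2 / \<theta>"
      using \<theta>_pos by (intro divide_right_mono mult_right_mono) auto
    also have "(M * sqrt d)\<^sup>2 = M\<^sup>2 * d" using pos by (simp add: power_mult_distrib)
    finally show ?thesis by simp
  qed
  \<comment> \<open>Converts the negative quadratic terms into energy: 8/5 = 3/2 + 1/10, the 3/2 of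
    the conclusion and the tenth used by \<open>t5\<close>. The entries of the minimum in \<theta>
    pay for |x|^2 and |v|^2 respectively.\<close>
  have t6: "8 / 5 * \<theta> * f\<^sup>2 \<le> 2 * \<theta> * R1 * d + 8 / 25 * (\<alpha> * r) * X\<^sup>2 + \<gamma> / 2 * W\<^sup>2"
  proof -
    have "\<alpha> * (x \<bullet> v) \<le> \<alpha> * (X * W)"
      using xv \<alpha>_pos by (intro mult_left_mono) auto
    also have "\<dots> \<le> 2 * \<alpha>\<^sup>2 * X\<^sup>2 + W\<^sup>2 / 8"
    proof -
      have "0 \<le> 2 * (\<alpha> * X - W / 4)\<^sup>2" by simp
      then show ?thesis by (simp add: power2_eq_square algebra_simps)
    qed
    also have "2 * \<alpha>\<^sup>2 * X\<^sup>2 \<le> c1 * X\<^sup>2"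
      using \<alpha>_sq c1 by (intro mult_right_mono) auto
    finally have "f\<^sup>2 \<le> d * R1 + 2 * c1 * X\<^sup>2 + 5 / 8 * W\<^sup>2"
      using f Vx by (simp add: X_def W_def)
    then have "8 / 5 * \<theta> * f\<^sup>2 \<le> 8 / 5 * \<theta> * (d * R1 + 2 * c1 * X\<^sup>2 + 5 / 8 * W\<^sup>2)"
      using \<theta>_pos by (intro mult_left_mono) auto
    also have "\<dots> = 8 / 5 * (\<theta> * R1 * d) + 16 / 5 * (\<theta> * c1 * X\<^sup>2) + \<theta> * W\<^sup>2"
      by (simp add: algebra_simps)
    also have "\<theta> * c1 * X\<^sup>2 \<le> \<alpha> * r / 10 * X\<^sup>2"
      using theta_const_c1[OF \<gamma> r c0 c1_pos] by (intro mult_right_mono) auto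
    also have "\<theta> * W\<^sup>2 \<le> \<gamma> / 2 * W\<^sup>2"
      using theta_const_le[OF \<gamma> r c0 c1_pos] by (intro mult_right_mono) auto
    also have "8 / 5 * (\<theta> * R1 * d) \<le> 2 * (\<theta> * R1 * d)"
      using \<theta>_pos pos by (intro mult_right_mono) auto
    finally show ?thesis by (simp add: algebra_simps)
  qed
  have t7: "(- (\<gamma> - \<alpha>) + 2 * \<alpha> * \<gamma>\<^sup>2 / r + \<alpha> / 3) * W\<^sup>2 \<le> - (\<gamma> / 2) * W\<^sup>2"
    using fric \<alpha>_pos by (intro mult_right_mono) auto
  have "0 \<le> \<alpha> * r * X\<^sup>2" using \<alpha>r by simp
  then show ?thesis
    using t1 t2 t3 t4 t5 t6 t7 unfolding X_def[symmetric] W_def[symmetric]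
    by (simp add: algebra_simps)
qed

text \<open>Since X^4 \<le> 4 f^4 / c0^2, the surviving confinement dominates \<alpha> r c0^2 X^6 /
  10. Young's inequality turns the mean field term into 15/16 lam f^6 + 12 lam X^6 in the sum over
  the particles: 12/176 is below 1/10, and 3 (3/2 - 15/16) = 27/16.\<close>

lemma sum_drift_le:
  fixes f X D :: "nat \<Rightarrow> real"
  assumes N: "N \<ge> 1" and f: "\<And>i. i < N \<Longrightarrow> 0 \<le> f i" and X: "\<And>i. i < N \<Longrightarrow> 0 \<le> X i"
    and fX: "\<And>i. i < N \<Longrightarrow> c0 / 2 * (X i)\<^sup>2 \<le> (f i)\<^sup>2"
    and D: "\<And>i. i < N \<Longrightarrow> D i \<le> - (3 / 2) * \<theta> * (f i)\<^sup>2 - 2 / 5 * (\<alpha> * r) * (X i)\<^sup>2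
      + 9 / 4 * lam * ((\<Sum>j<N. X j) / N) * f i + k"
  shows "3 * (\<Sum>i<N. f i ^ 4 * D i) \<le> - (27 / 16) * \<theta> * (\<Sum>i<N. f i ^ 6) + 3 * k * (\<Sum>i<N. f i ^ 4)"
proof -
  let ?m = "(\<Sum>j<N. X j) / N"
  have \<alpha>r: "0 < \<alpha> * r" using \<alpha>_pos r by simp
  have "f i ^ 4 * D i \<le> - (3 / 2) * \<theta> * f i ^ 6 - \<alpha> * r * c0\<^sup>2 / 10 * X i ^ 6
      + 9 / 4 * lam * (f i ^ 5 * ?m) + k * f i ^ 4" if i: "i < N" for i
  proof -
    have "f i ^ 4 * D i \<le> f i ^ 4 * (- (3 / 2) * \<theta> * (f i)\<^sup>2 - 2 / 5 * (\<alpha> * r) * (X i)\<^sup>2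
      + 9 / 4 * lam * ?m * f i + k)"
      using D[OF i] by (intro mult_left_mono) auto
    also have "\<dots> = - (3 / 2) * \<theta> * f i ^ 6 - 2 / 5 * (\<alpha> * r) * (f i ^ 4 * (X i)\<^sup>2)
      + 9 / 4 * lam * (f i ^ 5 * ?m) + k * f i ^ 4"
      by (simp add: eval_nat_numeral algebra_simps)
    finally have "f i ^ 4 * D i \<le> \<dots>" .
    moreover have "2 / 5 * (\<alpha> * r) * (f i ^ 4 * (X i)\<^sup>2) \<ge> \<alpha> * r * c0\<^sup>2 / 10 * X i ^ 6"
    proof -
      have "(c0 / 2 * (X i)\<^sup>2)\<^sup>2 \<le> ((f i)\<^sup>2)\<^sup>2"
        using fX[OF i] c0 by (intro power_mono) auto
      then have "2 / 5 * (\<alpha> * r) * ((c0 / 2 * (X i)\<^sup>2)\<^sup>2 * (X i)\<^sup>2) \<le>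
          2 / 5 * (\<alpha> * r) * (((f i)\<^sup>2)\<^sup>2 * (X i)\<^sup>2)"
        using \<alpha>r by (intro mult_left_mono mult_right_mono) auto
      then show ?thesis
        by (simp add: eval_nat_numeral algebra_simps)
    qed
    ultimately show ?thesis by linarith
  qed
  then have "(\<Sum>i<N. f i ^ 4 * D i) \<le> (\<Sum>i<N. - (3 / 2) * \<theta> * f i ^ 6
      - \<alpha> * r * c0\<^sup>2 / 10 * X i ^ 6 + 9 / 4 * lam * (f i ^ 5 * ?m) + k * f i ^ 4)"
    by (intro sum_mono) auto
  also have "\<dots> = - (3 / 2) * \<theta> * (\<Sum>i<N. f i ^ 6) - \<alpha> * r * c0\<^sup>2 / 10 * (\<Sum>i<N. X i ^ 6)
      + 9 / 4 * lam * (\<Sum>i<N. f i ^ 5 * ?m) + k * (\<Sum>i<N. f i ^ 4)"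
    by (simp only: sum.distrib sum_subtractf sum_distrib_left)
  also have "9 / 4 * lam * (\<Sum>i<N. f i ^ 5 * ?m) \<le>
      9 / 4 * lam * (5 / 12 * (\<Sum>i<N. f i ^ 6) + 16 / 3 * (\<Sum>i<N. X i ^ 6))"
    using sum_pow5_mean_le[OF N f X] lam by (intro mult_left_mono) auto
  finally have "(\<Sum>i<N. f i ^ 4 * D i) \<le> - (3 / 2) * \<theta> * (\<Sum>i<N. f i ^ 6)
      - \<alpha> * r * c0\<^sup>2 / 10 * (\<Sum>i<N. X i ^ 6)
      + 15 / 16 * (lam * (\<Sum>i<N. f i ^ 6)) + 12 * (lam * (\<Sum>i<N. X i ^ 6)) + k * (\<Sum>i<N. f i ^ 4)"
    by (simp add: algebra_simps)
  moreover have "lam * (\<Sum>i<N. f i ^ 6) \<le> \<theta> * (\<Sum>i<N. f i ^ 6)"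
    using lam_theta by (intro mult_right_mono sum_nonneg) auto
  moreover have "lam * (\<Sum>i<N. X i ^ 6) \<le> \<alpha> * r * c0\<^sup>2 / 176 * (\<Sum>i<N. X i ^ 6)"
    using lam_c0 by (intro mult_right_mono sum_nonneg) auto
  moreover have "0 \<le> \<alpha> * r * c0\<^sup>2 * (\<Sum>i<N. X i ^ 6)"
    using \<alpha>_pos r by (intro mult_nonneg_nonneg sum_nonneg) auto
  ultimately show ?thesis
    by (simp add: algebra_simps)
qed

end

subsection \<open>One step of the particle chain\<close>

abbreviation avg :: "nat \<Rightarrow> (nat \<Rightarrow> real) \<Rightarrow> real"
  where "avg N g \<equiv> (\<Sum>j<N. g j) / real N"

lemma avg_mono: "(\<And>j. j < N \<Longrightarrow> g j \<le> k j) \<Longrightarrow> avg N g \<le> avg N k"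
  by (intro divide_right_mono sum_mono) auto

lemma avg_nonneg: "(\<And>j. j < N \<Longrightarrow> 0 \<le> g j) \<Longrightarrow> 0 \<le> avg N g"
  by (intro divide_nonneg_nonneg sum_nonneg) auto

lemma avg_add: "avg N (\<lambda>j. g j + k j) = avg N g + avg N k"
  by (simp add: sum.distrib add_divide_distrib)

lemma avg_cmult: "avg N (\<lambda>j. c * g j) = c * avg N g"
  by (simp flip: sum_distrib_left)

lemma avg_const: "N \<ge> 1 \<Longrightarrow> avg N (\<lambda>_. c) = c"
  by simp

lemma avg_power_le:
  "N \<ge> 1 \<Longrightarrow> (\<And>j. j < N \<Longrightarrow> 0 \<le> g j) \<Longrightarrow> avg N g ^ n \<le> avg N (\<lambda>j. g j ^ n)"
  using power_mean_le[of "{..<N}" g n] by (auto simp: lessThan_empty_iff)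

lemma sum_avg: "N \<ge> 1 \<Longrightarrow> (\<Sum>i<N. avg N g) = (\<Sum>i<N. g i)"
  by simp

text \<open>The mean value inequality is applied to \<open>V\<close> minus its linear part at
  \<open>y\<close>, whose gradient is at most L |z - y| on the segment. It gives the coefficient
  \<open>L\<close>, without the factor 1/2 of Taylor's formula.\<close>

lemma quadratic_upper_bound:
  assumes gV: "\<And>u. u \<in> Rd d \<Longrightarrow> has_grad d V (gV u) u"
    and lipschitz: "\<And>y z. y \<in> Rd d \<Longrightarrow> z \<in> Rd d \<Longrightarrow> norm (gV z - gV y) \<le> L * norm (z - y)"
    and L: "0 \<le> L" and y: "y \<in> Rd d" and z: "z \<in> Rd d"
  shows "V z \<le> V y + gV y \<bullet> (z - y) + L * (norm (z - y))\<^sup>2"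
proof -
  have "norm ((V z - gV y \<bullet> z) - (V y - gV y \<bullet> y)) \<le> L * (norm (z - y))\<^sup>2"
  proof (rule mean_value_Rd[OF y z, where f' = "\<lambda>u w. gV u \<bullet> w - gV y \<bullet> w"])
    fix u assume "u \<in> Rd d"
    then show "((\<lambda>z. V z - gV y \<bullet> z) has_derivative (\<lambda>w. gV u \<bullet> w - gV y \<bullet> w)) (at u within Rd d)"
      using gV[of u] by (auto simp: has_grad_def intro!: derivative_intros)
  next
    fix t :: real assume t: "t \<in> {0..1}"
    let ?u = "y + t *\<^sub>R (z - y)"
    have "norm (t *\<^sub>R (z - y)) \<le> norm (z - y)"
      using t by (simp add: mult_left_le_one_le)
    then have "L * norm (t *\<^sub>R (z - y)) \<le> L * norm (z - y)"
      using L by (intro mult_left_mono) auto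
    then have "norm (gV ?u - gV y) \<le> L * norm (z - y)"
      using lipschitz[of y ?u] y z by simp
    then have "\<bar>(gV ?u - gV y) \<bullet> (z - y)\<bar> \<le> L * norm (z - y) * norm (z - y)"
      by (rule abs_inner_le) simp
    then show "norm (gV ?u \<bullet> (z - y) - gV y \<bullet> (z - y)) \<le> L * (norm (z - y))\<^sup>2"
      by (simp add: inner_diff_left power2_eq_square mult.assoc)
  qed
  then show ?thesis by (simp add: inner_diff_right)
qed

lemma gradient_lipschitz:
  assumes C2: "C2_on d V gV HV" and L: "\<And>y. y \<in> Rd d \<Longrightarrow> opnorm d (HV y) \<le> L"
    and y: "y \<in> Rd d" and z: "z \<in> Rd d"
  shows "norm (gV z - gV y) \<le> L * norm (z - y)"
proof (rule mean_value_Rd[OF y z, where f' = HV])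
  show der: "(gV has_derivative HV u) (at u within Rd d)" if "u \<in> Rd d" for u
    using C2 that by (auto simp: C2_on_def)
  fix t :: real assume "t \<in> {0..1}"
  let ?u = "y + t *\<^sub>R (z - y)"
  have u: "?u \<in> Rd d" using y z by simp
  have "norm (HV ?u (z - y)) \<le> opnorm d (HV ?u) * norm (z - y)"
    by (rule norm_le_opnorm[OF has_derivative_bounded_linear[OF der[OF u]]]) (use y z in simp)
  also have "\<dots> \<le> L * norm (z - y)"
    using L[OF u] by (intro mult_right_mono) auto
  finally show "norm (HV ?u (z - y)) \<le> L * norm (z - y)" .
qed

text \<open>One step from a fixed state. The single constant \<open>B\<close> dominates all others,
  so errors become powers of \<open>B\<close>; its last two conditions let the energy dominate
  \<open>d\<close> and |x|^2 up to the factor B^2.\<close>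

locale particle_step =
  mean_field_potential d "M * sqrt (real d)" lam V gV F F1 DF1 + drift_constants \<gamma> r c0 c1 lam
  for d :: nat and M lam :: real and V :: "fseq \<Rightarrow> real" and gV :: "fseq \<Rightarrow> fseq"
    and F F1 :: "fseq measure \<Rightarrow> real" and DF1 :: "fseq measure \<Rightarrow> fseq \<Rightarrow> fseq"
    and \<gamma> r c0 c1 :: real +
  fixes L K R0 R1 B h :: real and N :: nat and G :: "(nat \<Rightarrow> fseq) \<Rightarrow> nat \<Rightarrow> fseq"
    and x v :: "nat \<Rightarrow> fseq"
  assumes M: "M > 0" and L: "L > 0" and K: "K > 0" and R0: "R0 > 0" and R1: "R1 > 0"
    and d: "d \<ge> 1" and N: "N \<ge> 1" and h: "0 < h" "h \<le> 1" "\<gamma> * h \<le> 1"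
    and gV_0: "gV 0 = 0"
    and gV_lipschitz: "\<And>y z. y \<in> Rd d \<Longrightarrow> z \<in> Rd d \<Longrightarrow> norm (gV z - gV y) \<le> L * norm (z - y)"
    and gV_inward: "\<And>y. y \<in> Rd d \<Longrightarrow> - (y \<bullet> gV y) \<le> - r * (norm y)\<^sup>2 + K * real d"
    and V_upper: "\<And>y. y \<in> Rd d \<Longrightarrow> V y \<le> real d * R1 + c1 * (norm y)\<^sup>2"
    and V_lower: "\<And>y. y \<in> Rd d \<Longrightarrow> V y \<ge> real d * R0 + c0 * (norm y)\<^sup>2"
    and G: "is_grad_potN d F N G"
    and xR: "\<And>i. i < N \<Longrightarrow> x i \<in> Rd d" and vR: "\<And>i. i < N \<Longrightarrow> v i \<in> Rd d"
    and B: "2 \<le> B" "L \<le> B" "M \<le> B" "lam \<le> B" "\<gamma> \<le> B" "\<alpha> \<le> B" "1 \<le> B\<^sup>2 * R0" "2 \<le> B\<^sup>2 * c0"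
begin

text \<open>In terms of the square root \<open>f i\<close> of the energy of particle \<open>i\<close> all error terms are polynomials;
  adding the mean, \<open>U i\<close> controls the mean field as well.\<close>

definition f :: "nat \<Rightarrow> real"
  where "f i = sqrt (lyap1 V \<alpha> (x i) (v i))"

lemma energy_ge:
  assumes "y \<in> Rd d"
  shows "real d * R0 + c0 / 2 * (norm y)\<^sup>2 + (norm u)\<^sup>2 / 4 \<le> lyap1 V \<alpha> y u"
  unfolding lyap1_def by (rule energy_lower[OF V_lower[OF assms]])

lemma lyap1_nonneg: "y \<in> Rd d \<Longrightarrow> 0 \<le> lyap1 V \<alpha> y u"
proof -
  assume "y \<in> Rd d"
  moreover have "0 \<le> real d * R0 + c0 / 2 * (norm y)\<^sup>2 + (norm u)\<^sup>2 / 4"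
    using R0 c0 by simp
  ultimately show ?thesis using energy_ge[of y u] by linarith
qed

lemma f_sq: "i < N \<Longrightarrow> (f i)\<^sup>2 = lyap1 V \<alpha> (x i) (v i)"
  unfolding f_def using lyap1_nonneg[OF xR] by simp

lemma f_nonneg: "i < N \<Longrightarrow> 0 \<le> f i"
  unfolding f_def using lyap1_nonneg[OF xR] by simp

text \<open>Because \<open>V\<close> is at least R0 d, the energy controls even the dimension. The
  conditions on B^2 R0, on B^2 c0 and \<open>2 \<le> B\<close> serve the bounds on
  \<open>sqrt d\<close>, |x| and |v| in turn.\<close>

lemma f_ge:
  assumes i: "i < N"
  shows "sqrt (real d) \<le> B * f i" "norm (x i) \<le> B * f i" "norm (v i) \<le> B * f i"
    and "c0 / 2 * (norm (x i))\<^sup>2 \<le> (f i)\<^sup>2"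
proof -
  have *: "real d * R0 + c0 / 2 * (norm (x i))\<^sup>2 + (norm (v i))\<^sup>2 / 4 \<le> (f i)\<^sup>2"
    using energy_ge[OF xR[OF i], of "v i"] by (simp add: f_sq[OF i])
  have nn: "0 \<le> real d * R0" "0 \<le> c0 / 2 * (norm (x i))\<^sup>2" "0 \<le> (norm (v i))\<^sup>2 / 4"
    using R0 c0 by auto
  have Bf: "0 \<le> B * f i" using B f_nonneg[OF i] by simp
  have le: "real d * R0 \<le> (f i)\<^sup>2" "c0 / 2 * (norm (x i))\<^sup>2 \<le> (f i)\<^sup>2"
    "(norm (v i))\<^sup>2 \<le> 4 * (f i)\<^sup>2"
    using * nn by linarith+
  show "c0 / 2 * (norm (x i))\<^sup>2 \<le> (f i)\<^sup>2" by (rule le(2))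
  have sq: "a \<le> (B * f i)\<^sup>2" if "a * 1 \<le> a * (B\<^sup>2 * q)" "a * q \<le> (f i)\<^sup>2" for a q :: real
  proof -
    have "a * (B\<^sup>2 * q) = B\<^sup>2 * (a * q)" by simp
    also have "\<dots> \<le> B\<^sup>2 * (f i)\<^sup>2" using that(2) by (rule mult_left_mono) simp
    finally show ?thesis using that(1) by (simp only: power_mult_distrib mult_1_right)
  qed
  have "real d \<le> (B * f i)\<^sup>2"
    by (rule sq[where q = R0]) (rule mult_left_mono[OF B(7)], simp, rule le(1))
  then show "sqrt (real d) \<le> B * f i"
    using Bf by (intro real_le_lsqrt)
  have "1 \<le> B\<^sup>2 * (c0 / 2)" using B(8) by simp
  then have "(norm (x i))\<^sup>2 \<le> (B * f i)\<^sup>2"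
    by (intro sq[where q = "c0 / 2"] mult_left_mono) (use le(2) in \<open>simp_all add: mult.commute\<close>)
  then show "norm (x i) \<le> B * f i"
    using Bf by (rule power2_le_imp_le)
  have "2\<^sup>2 \<le> B\<^sup>2" using B(1) by (rule power_mono) simp
  then have "1 \<le> B\<^sup>2 * (1 / 4)" by simp
  then have "(norm (v i))\<^sup>2 \<le> (B * f i)\<^sup>2"
    by (intro sq[where q = "1 / 4"] mult_left_mono) (use le(3) in simp_all)
  then show "norm (v i) \<le> B * f i"
    using Bf by (rule power2_le_imp_le)
qed

definition U :: "nat \<Rightarrow> real"
  where "U i = f i + avg N f"

lemma f_le_U: "i < N \<Longrightarrow> f i \<le> U i"
  unfolding U_def using avg_nonneg[of N f] f_nonneg by simp

text \<open>By the power mean inequality the average in \<open>U\<close> costs no more than another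
  copy of the sum, so the constant 64 = 2 * 32 is free of \<open>N\<close>.\<close>

lemma sum_U_pow6: "(\<Sum>i<N. U i ^ 6) \<le> 64 * (\<Sum>i<N. f i ^ 6)"
proof -
  have "(\<Sum>i<N. U i ^ 6) \<le> (\<Sum>i<N. 32 * (f i ^ 6 + avg N (\<lambda>j. f j ^ 6)))"
  proof (rule sum_mono)
    fix i assume "i \<in> {..<N}"
    then have "U i ^ 6 \<le> 32 * (f i ^ 6 + avg N f ^ 6)"
      unfolding U_def using f_nonneg by (intro add_pow6_le avg_nonneg) auto
    also have "\<dots> \<le> 32 * (f i ^ 6 + avg N (\<lambda>j. f j ^ 6))"
      using avg_power_le[OF N, of f 6] f_nonneg by simp
    finally show "U i ^ 6 \<le> 32 * (f i ^ 6 + avg N (\<lambda>j. f j ^ 6))" .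
  qed
  also have "\<dots> = 64 * (\<Sum>i<N. f i ^ 6)"
    using sum_avg[OF N, of "\<lambda>j. f j ^ 6"]
    by (simp only: sum_distrib_left[symmetric] sum.distrib) simp
  finally show ?thesis .
qed

text \<open>The coefficient of \<open>h\<close> in the energy balance, with the unknown interaction
  force replaced by its bound; it is therefore free of the noise.\<close>

definition D :: "nat \<Rightarrow> real"
  where "D i = - (\<gamma> - \<alpha>) * (norm (v i))\<^sup>2 - \<alpha> * \<gamma> * (x i \<bullet> v i) - \<alpha> * (x i \<bullet> gV (x i))
    + (norm (v i) + \<alpha> * norm (x i)) *
      (M * sqrt (real d) + lam * norm (x i) + lam * avg N (\<lambda>j. norm (x j)))"

definition noise_coeff :: "nat \<Rightarrow> fseq"
  where "noise_coeff i = ((1 - \<gamma> * h) * (1 + 2 * \<alpha> * h)) *\<^sub>R v i + \<alpha> *\<^sub>R x i"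

text \<open>900 B^6 = 100 B^4 (3 B)^2: the error constant of \<open>verlet_energy\<close>, with
  \<open>S i\<close> replaced by \<open>3 * B * U i\<close>.\<close>

abbreviation "A \<equiv> 900 * B ^ 6"

lemma gV_norm: "y \<in> Rd d \<Longrightarrow> norm (gV y) \<le> L * norm y"
  using gV_lipschitz[of 0 y] gV_0 by simp

lemma GR: "(\<And>j. j < N \<Longrightarrow> z j \<in> Rd d) \<Longrightarrow> i < N \<Longrightarrow> G z i \<in> Rd d"
  using G by (auto simp: is_grad_potN_def has_grad_def)

text \<open>The state size \<open>s\<close> required by \<open>verlet_energy\<close>. The means over
  all particles belong to it because the interaction sees the mean position, which moves with the
  mean velocity.\<close>

definition S :: "nat \<Rightarrow> real"
  where "S i = sqrt (real d) + norm (x i) + norm (v i)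
    + (avg N (\<lambda>j. norm (x j)) + avg N (\<lambda>j. norm (v j)))"

lemma avg_norm_nonneg: "0 \<le> avg N (\<lambda>j. norm (w j :: fseq))"
  by (rule avg_nonneg) simp

lemma S_ge: "sqrt (real d) + norm (x i) + avg N (\<lambda>j. norm (x j)) \<le> S i"
  "norm (x i) \<le> S i" "norm (v i) \<le> S i" "0 \<le> S i" "avg N (\<lambda>j. norm (v j)) \<le> S i"
  "avg N (\<lambda>j. norm (x j)) \<le> S i" "sqrt (real d) \<le> S i"
  using avg_norm_nonneg[of x] avg_norm_nonneg[of v] norm_ge_zero[of "x i"] norm_ge_zero[of "v i"]
    real_sqrt_ge_zero[of "real d"] unfolding S_def by linarith+

lemma S_le: "i < N \<Longrightarrow> S i \<le> 3 * B * U i"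
proof -
  assume i: "i < N"
  have x: "avg N (\<lambda>j. norm (x j)) \<le> B * avg N f" and v: "avg N (\<lambda>j. norm (v j)) \<le> B * avg N f"
    unfolding avg_cmult[symmetric] by (rule avg_mono; use f_ge in simp)+
  have "0 \<le> B * avg N f" using B f_nonneg by (intro mult_nonneg_nonneg avg_nonneg) auto
  then have "S i \<le> 3 * (B * f i) + 3 * (B * avg N f)"
    unfolding S_def using f_ge[OF i] x v by linarith
  then show ?thesis by (simp add: U_def algebra_simps)
qed

lemma force_le:
  assumes i: "i < N"
  defines "\<beta> \<equiv> M * sqrt (real d) + lam * norm (x i) + lam * avg N (\<lambda>j. norm (x j))"
  shows "norm (G x i - gV (x i)) \<le> \<beta>" "\<beta> \<le> B * S i" "norm (G x i) \<le> 2 * B * S i"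
    "norm (G x i) \<le> B * sqrt (real d) + 2 * B * norm (x i) + B * avg N (\<lambda>j. norm (x j))"
proof -
  show 1: "norm (G x i - gV (x i)) \<le> \<beta>"
    unfolding \<beta>_def by (rule force_bound[OF N xR i G])
  have 2: "\<beta> \<le> B * sqrt (real d) + B * norm (x i) + B * avg N (\<lambda>j. norm (x j))"
    unfolding \<beta>_def using B avg_norm_nonneg[of x] by (intro add_mono mult_right_mono) auto
  have 3: "\<dots> \<le> B * S i"
    using mult_left_mono[OF S_ge(1)[of i], of B] B by (simp add: algebra_simps)
  show "\<beta> \<le> B * S i" using 2 3 by linarith
  have 4: "norm (gV (x i)) \<le> B * norm (x i)"
    using gV_norm[OF xR[OF i]] mult_right_mono[OF B(2), of "norm (x i)"] by simp
  have 5: "norm (G x i) \<le> norm (G x i - gV (x i)) + norm (gV (x i))"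
    using norm_triangle_ineq[of "G x i - gV (x i)" "gV (x i)"] by simp
  show "norm (G x i) \<le> B * sqrt (real d) + 2 * B * norm (x i) + B * avg N (\<lambda>j. norm (x j))"
    using 1 2 4 5 by linarith
  have "B * norm (x i) \<le> B * S i"
    using S_ge(2) B by (intro mult_left_mono) auto
  then show "norm (G x i) \<le> 2 * B * S i"
    using 1 2 3 4 5 by linarith
qed

text \<open>Instance of \<open>verlet_energy\<close> for particle \<open>i\<close> with state size
  \<open>S i\<close>. What has to be prepared is the interaction after the step: through the mean it
  depends on the displacements of all particles, which is why \<open>e\<close> contains the mean
  noise.\<close>

lemma one_step_energy:
  fixes \<xi> :: "nat \<Rightarrow> fseq"
  assumes \<xi>: "\<And>j. j < N \<Longrightarrow> \<xi> j \<in> Rd d" and i: "i < N"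
  defines "w \<equiv> \<lambda>j. (1 - \<gamma> * h) *\<^sub>R v j + \<xi> j"
  defines "y \<equiv> \<lambda>j. x j + h *\<^sub>R w j - (h\<^sup>2 / 2) *\<^sub>R G x j"
  defines "u \<equiv> \<lambda>j. w j - (h / 2) *\<^sub>R (G x j + G y j)"
  defines "e \<equiv> norm (\<xi> i) + avg N (\<lambda>j. norm (\<xi> j))"
  shows "lyap1 V \<alpha> (y i) (u i) \<le>
    (f i)\<^sup>2 + noise_coeff i \<bullet> \<xi> i + h * D i + A * (h\<^sup>2 * (U i)\<^sup>2 + e\<^sup>2)"
    and "0 \<le> lyap1 V \<alpha> (y i) (u i)"
    and "\<bar>noise_coeff i \<bullet> \<xi> i\<bar> \<le> A * U i * e"
    and "\<bar>D i\<bar> \<le> A * (U i)\<^sup>2"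
proof -
  let ?mx = "avg N (\<lambda>j. norm (x j))"
  define \<beta> where "\<beta> = M * sqrt (real d) + lam * norm (x i) + lam * ?mx"
  note fl = force_le[OF i, folded \<beta>_def]
  have B1: "1 \<le> B" using B by linarith
  have B6: "B ^ 6 = B ^ 4 * B\<^sup>2" by (simp flip: power_add)
  have Bpow: "B ^ m \<le> B ^ n" if "m \<le> n" for m n using that B1 by (rule power_increasing)
  have BA: "100 * B ^ 4 \<le> A" "12 * B\<^sup>2 \<le> A" "45 * B ^ 4 \<le> A"
    using Bpow[of 4 6] Bpow[of 2 6] zero_le_power[of B 6] B1 by linarith+
  have U0: "0 \<le> U i" using f_nonneg[OF i] f_le_U[OF i] by linarith
  have wR: "w j \<in> Rd d" if "j < N" for j using that \<xi> vR by (simp add: w_def)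
  have yR: "y j \<in> Rd d" if "j < N" for j using that xR wR by (simp add: y_def GR)
  have e: "norm (\<xi> i) \<le> e" "avg N (\<lambda>j. norm (\<xi> j)) \<le> e" "0 \<le> e"
    using avg_norm_nonneg[of \<xi>] by (auto simp: e_def)
  show "0 \<le> lyap1 V \<alpha> (y i) (u i)" by (rule lyap1_nonneg[OF yR[OF i]])
  have \<Delta>: "norm (y j - x j) \<le> h * (norm (v j) + norm (\<xi> j)) + h / 2 * norm (G x j)" if j: "j < N" for j
  proof -
    have "y j - x j = h *\<^sub>R w j - (h\<^sup>2 / 2) *\<^sub>R G x j" by (simp add: y_def)
    then have "norm (y j - x j) \<le> h * norm (w j) + h\<^sup>2 / 2 * norm (G x j)"
      using norm_triangle_ineq4[of "h *\<^sub>R w j" "(h\<^sup>2 / 2) *\<^sub>R G x j"] h by simp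
    also have "h * norm (w j) \<le> h * (norm (v j) + norm (\<xi> j))"
    proof (rule mult_left_mono)
      have "norm ((1 - \<gamma> * h) *\<^sub>R v j) \<le> norm (v j)"
        using h \<gamma> by (simp add: mult_left_le_one_le)
      then show "norm (w j) \<le> norm (v j) + norm (\<xi> j)"
        unfolding w_def using norm_triangle_ineq[of "(1 - \<gamma> * h) *\<^sub>R v j" "\<xi> j"] by linarith
    qed (use h in simp)
    also have "h\<^sup>2 / 2 * norm (G x j) \<le> h / 2 * norm (G x j)"
      using h by (intro mult_right_mono divide_right_mono) (auto simp: power2_eq_square mult_left_le)
    finally show ?thesis by simp
  qed
  have "1 * (h * (S i + e)) \<le> B * (h * (S i + e))"
    using B1 h S_ge(4)[of i] e(3) by (intro mult_right_mono) auto
  moreover have "B * h * S i \<le> B * h * (S i + e)"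
    using B1 h e(3) by (intro mult_left_mono) auto
  ultimately have hSe: "h * (S i + e) \<le> B * h * (S i + e)" "B * h * S i \<le> B * h * (S i + e)"
    by (simp_all only: mult.assoc mult_1_left)
  have \<Delta>i: "norm (y i - x i) \<le> 2 * B * h * (S i + e)"
  proof -
    have "h * (norm (v i) + norm (\<xi> i)) \<le> h * (S i + e)"
      using S_ge[of i] e h by (intro mult_left_mono add_mono) auto
    moreover have "h / 2 * norm (G x i) \<le> h / 2 * (2 * B * S i)"
      using fl(3) h by (intro mult_left_mono) auto
    ultimately show ?thesis using \<Delta>[OF i] hSe by (simp add: algebra_simps)
  qed
  \<comment> \<open>For another particle \<open>j\<close>, |x j| need not be below
    \<open>S i\<close>, but its average over \<open>j\<close> is; so the displacements are averaged
    first and estimated afterwards.\<close>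
  have \<Delta>avg: "avg N (\<lambda>j. norm (y j - x j)) \<le> 5 / 2 * B * h * (S i + e)"
  proof -
    have "avg N (\<lambda>j. norm (y j - x j)) \<le> avg N (\<lambda>j. h * (norm (v j) + norm (\<xi> j))
        + h / 2 * (B * sqrt (real d) + 2 * B * norm (x j) + B * ?mx))"
    proof (rule avg_mono)
      fix j assume j: "j < N"
      have "h / 2 * norm (G x j) \<le> h / 2 * (B * sqrt (real d) + 2 * B * norm (x j) + B * ?mx)"
        using force_le(4)[OF j] h by (intro mult_left_mono) auto
      then show "norm (y j - x j) \<le> h * (norm (v j) + norm (\<xi> j))
          + h / 2 * (B * sqrt (real d) + 2 * B * norm (x j) + B * ?mx)"
        using \<Delta>[OF j] by linarith
    qed
    also have "\<dots> = h * (avg N (\<lambda>j. norm (v j)) + avg N (\<lambda>j. norm (\<xi> j)))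
        + h / 2 * (B * sqrt (real d) + 2 * B * ?mx + B * ?mx)"
      using N by (simp only: avg_add avg_cmult avg_const)
    also have "\<dots> \<le> h * (S i + e) + h / 2 * (B * S i + 2 * B * S i)"
    proof (rule add_mono[OF mult_left_mono mult_left_mono])
      show "avg N (\<lambda>j. norm (v j)) + avg N (\<lambda>j. norm (\<xi> j)) \<le> S i + e"
        using e S_ge(5)[of i] by linarith
      have "B * (sqrt (real d) + ?mx) \<le> B * S i"
        using S_ge[of i] B1 norm_ge_zero[of "x i"] by (intro mult_left_mono) linarith+
      moreover have "2 * B * ?mx \<le> 2 * B * S i"
        using S_ge[of i] B1 by (intro mult_left_mono) auto
      ultimately show "B * sqrt (real d) + 2 * B * ?mx + B * ?mx \<le> B * S i + 2 * B * S i"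
        unfolding distrib_left by linarith
    qed (use h in auto)
    also have "\<dots> \<le> 5 / 2 * B * h * (S i + e)"
      using hSe by (simp add: algebra_simps)
    finally show ?thesis .
  qed
  have b': "norm (G y i - gV (y i)) \<le> \<beta> + 5 * B\<^sup>2 * h * (S i + e)"
  proof -
    have tri: "norm (y j) \<le> norm (x j) + norm (y j - x j)" for j
      using norm_triangle_ineq[of "x j" "y j - x j"] by simp
    have "avg N (\<lambda>j. norm (y j)) \<le> ?mx + avg N (\<lambda>j. norm (y j - x j))"
      unfolding avg_add[symmetric] by (rule avg_mono) (rule tri)
    then have "lam * (norm (y i) + avg N (\<lambda>j. norm (y j)))
        \<le> lam * ((norm (x i) + norm (y i - x i)) + (?mx + avg N (\<lambda>j. norm (y j - x j))))"
      using lam tri by (intro mult_left_mono add_mono) auto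
    moreover have "lam * (norm (y i - x i) + avg N (\<lambda>j. norm (y j - x j))) \<le>
        B * (2 * B * h * (S i + e) + 5 / 2 * B * h * (S i + e))"
      using lam B \<Delta>i \<Delta>avg avg_norm_nonneg[of "\<lambda>j. y j - x j"] B1
      by (intro mult_mono add_mono) auto
    moreover have "B * (2 * B * h * (S i + e) + 5 / 2 * B * h * (S i + e)) = 9 / 2 * (B\<^sup>2 * h * (S i + e))"
      by (simp add: power2_eq_square field_simps)
    moreover have "0 \<le> B\<^sup>2 * h * (S i + e)" using h e S_ge(4)[of i] by simp
    moreover have "norm (G y i - gV (y i)) \<le> M * sqrt (real d) + lam * norm (y i) + lam * avg N (\<lambda>j. norm (y j))"
      by (rule force_bound[OF N yR i G])
    ultimately show ?thesis
      unfolding \<beta>_def by (simp add: algebra_simps)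
  qed
  have "lyap1 V \<alpha> (y i) (u i) \<le> (f i)\<^sup>2
      + ((1 - \<gamma> * h) * (1 + 2 * \<alpha> * h)) * (v i \<bullet> \<xi> i) + \<alpha> * (x i \<bullet> \<xi> i) + h * D i
      + 100 * B ^ 4 * (h\<^sup>2 * (S i)\<^sup>2 + e\<^sup>2)"
  proof -
    have y: "y i = x i + h *\<^sub>R ((1 - \<gamma> * h) *\<^sub>R v i + \<xi> i) - (h\<^sup>2 / 2) *\<^sub>R (gV (x i) + (G x i - gV (x i)))"
      by (simp add: y_def w_def)
    have u: "u i = ((1 - \<gamma> * h) *\<^sub>R v i + \<xi> i)
        - (h / 2) *\<^sub>R (gV (x i) + (G x i - gV (x i)) + (gV (y i) + (G y i - gV (y i))))"
      by (simp add: u_def w_def)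
    note ve = verlet_energy[where h = h and B = B and \<gamma> = \<gamma> and \<alpha> = \<alpha> and L = L and Va = "V (x i)"
        and Vb = "V (y i)" and x = "x i" and v = "v i" and \<xi> = "\<xi> i" and p = "gV (x i)"
        and b = "G x i - gV (x i)" and p' = "gV (y i)" and b' = "G y i - gV (y i)"
        and \<beta> = \<beta> and s = "S i" and e = e, folded y, folded u]
    have "V (y i) + (norm (u i))\<^sup>2 / 2 + \<alpha> * (y i \<bullet> u i) \<le>
      V (x i) + (norm (v i))\<^sup>2 / 2 + \<alpha> * (x i \<bullet> v i)
      + ((1 - \<gamma> * h) * (1 + 2 * \<alpha> * h)) * (v i \<bullet> \<xi> i) + \<alpha> * (x i \<bullet> \<xi> i)
      + h * (- (\<gamma> - \<alpha>) * (norm (v i))\<^sup>2 - \<alpha> * \<gamma> * (x i \<bullet> v i) - \<alpha> * (x i \<bullet> gV (x i))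
        + (norm (v i) + \<alpha> * norm (x i)) * \<beta>)
      + 100 * B ^ 4 * (h\<^sup>2 * (S i)\<^sup>2 + e\<^sup>2)"
      by (rule ve[OF h(1,2) B1 \<gamma> B(5) h(3) \<alpha>_pos B(6) less_imp_le[OF L] B(2)
        quadratic_upper_bound[OF gV gV_lipschitz less_imp_le[OF L] xR[OF i] yR[OF i]] gV_norm[OF xR[OF i]] gV_lipschitz[OF xR[OF i] yR[OF i]]
        fl(1,2) b' S_ge(2,3) e(1)])
    then show ?thesis
      unfolding D_def \<beta>_def[symmetric] f_sq[OF i] lyap1_def by simp
  qed
  also have "100 * B ^ 4 * (h\<^sup>2 * (S i)\<^sup>2 + e\<^sup>2) \<le> A * (h\<^sup>2 * (U i)\<^sup>2 + e\<^sup>2)"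
  proof -
    have "(S i)\<^sup>2 \<le> (3 * B * U i)\<^sup>2"
      using S_le[OF i] S_ge(4) by (intro power_mono) auto
    then have "100 * B ^ 4 * (h\<^sup>2 * (S i)\<^sup>2) \<le> 100 * B ^ 4 * (h\<^sup>2 * (3 * B * U i)\<^sup>2)"
      by (intro mult_left_mono) auto
    also have "\<dots> = A * (h\<^sup>2 * (U i)\<^sup>2)"
      unfolding B6 by (simp add: power_mult_distrib)
    finally have "100 * B ^ 4 * (h\<^sup>2 * (S i)\<^sup>2) \<le> A * (h\<^sup>2 * (U i)\<^sup>2)" .
    moreover have "100 * B ^ 4 * e\<^sup>2 \<le> A * e\<^sup>2"
      using BA by (intro mult_right_mono) auto
    ultimately show ?thesis unfolding distrib_left by (rule add_mono)
  qed
  finally show "lyap1 V \<alpha> (y i) (u i) \<le>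
      (f i)\<^sup>2 + noise_coeff i \<bullet> \<xi> i + h * D i + A * (h\<^sup>2 * (U i)\<^sup>2 + e\<^sup>2)"
    by (simp add: noise_coeff_def inner_add_left)
  show "\<bar>noise_coeff i \<bullet> \<xi> i\<bar> \<le> A * U i * e"
  proof -
    have c: "\<bar>(1 - \<gamma> * h) * (1 + 2 * \<alpha> * h)\<bar> \<le> 1 * (1 + 2 * B * 1)"
    proof -
      have "\<alpha> * h \<le> B * 1" using h \<alpha>_pos B by (intro mult_mono) auto
      moreover have "0 \<le> \<alpha> * h" "0 \<le> \<gamma> * h" using h \<alpha>_pos \<gamma> by simp_all
      ultimately show ?thesis
        unfolding abs_mult using h B1 by (intro mult_mono) auto
    qed
    have "norm (noise_coeff i) \<le> \<bar>(1 - \<gamma> * h) * (1 + 2 * \<alpha> * h)\<bar> * norm (v i) + \<alpha> * norm (x i)"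
      unfolding noise_coeff_def
      using norm_triangle_ineq[of "((1 - \<gamma> * h) * (1 + 2 * \<alpha> * h)) *\<^sub>R v i" "\<alpha> *\<^sub>R x i"] \<alpha>_pos by simp
    also have "\<dots> \<le> 1 * (1 + 2 * B * 1) * S i + B * S i"
      using c S_ge[of i] B \<alpha>_pos by (intro add_mono mult_mono) auto
    also have "\<dots> \<le> 4 * B * S i"
      using mult_right_mono[OF B1 S_ge(4)[of i]] by (simp add: algebra_simps)
    also have "\<dots> \<le> 4 * B * (3 * B * U i)"
      using S_le[OF i] B1 by (intro mult_left_mono) auto
    also have "\<dots> = 12 * B\<^sup>2 * U i" by (simp add: power2_eq_square)
    also have "\<dots> \<le> A * U i"
      using BA U0 by (intro mult_right_mono) auto
    finally show ?thesis by (rule abs_inner_le[OF _ e(1)])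
  qed
  show "\<bar>D i\<bar> \<le> A * (U i)\<^sup>2"
  proof -
    have a: "\<bar>(\<gamma> - \<alpha>) * (norm (v i))\<^sup>2\<bar> \<le> B * (S i)\<^sup>2"
      unfolding abs_mult using B \<gamma> \<alpha>_pos S_ge[of i] by (intro mult_mono) (auto intro!: power_mono)
    have b: "\<bar>\<alpha> * \<gamma> * (x i \<bullet> v i)\<bar> \<le> B * B * (S i * S i)"
      unfolding abs_mult using B \<gamma> \<alpha>_pos S_ge[of i] by (intro mult_mono abs_inner_le) auto
    have "norm (gV (x i)) \<le> B * S i"
      using gV_norm[OF xR[OF i]] mult_mono[OF B(2) S_ge(2)[of i]] B1 by simp
    then have c: "\<bar>\<alpha> * (x i \<bullet> gV (x i))\<bar> \<le> B * (S i * (B * S i))"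
      unfolding abs_mult using B \<alpha>_pos S_ge[of i] by (intro mult_mono abs_inner_le) auto
    have "0 \<le> \<beta>" using fl(1) norm_ge_zero[of "G x i - gV (x i)"] by linarith
    then have "\<bar>(norm (v i) + \<alpha> * norm (x i)) * \<beta>\<bar> = (norm (v i) + \<alpha> * norm (x i)) * \<beta>"
      using \<alpha>_pos by simp
    also have "\<dots> \<le> (S i + B * S i) * (B * S i)"
      using fl S_ge[of i] B \<alpha>_pos \<open>0 \<le> \<beta>\<close> by (intro mult_mono add_mono) auto
    finally have "\<bar>D i\<bar> \<le> B * (S i)\<^sup>2 + B * B * (S i * S i) + B * (S i * (B * S i)) + (S i + B * S i) * (B * S i)"
      unfolding D_def \<beta>_def[symmetric] using a b c by linarith
    also have "\<dots> = 2 * B * (S i)\<^sup>2 + 3 * B\<^sup>2 * (S i)\<^sup>2" by (simp add: power2_eq_square algebra_simps)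
    also have "\<dots> \<le> 5 * B\<^sup>2 * (S i)\<^sup>2"
      using mult_right_mono[OF Bpow[of 1 2], of "(S i)\<^sup>2"] by simp
    also have "\<dots> \<le> 5 * B\<^sup>2 * (3 * B * U i)\<^sup>2"
      using S_le[OF i] S_ge(4) by (intro mult_left_mono power_mono) auto
    also have "\<dots> = 45 * B ^ 4 * (U i)\<^sup>2"
      by (simp add: power_mult_distrib power4_eq_xxxx power2_eq_square)
    also have "\<dots> \<le> A * (U i)\<^sup>2"
      using BA by (intro mult_right_mono) auto
    finally show ?thesis .
  qed
qed

end

subsection \<open>Expectation of the Lyapunov function\<close>

text \<open>Has the shape of the majorant below: \<open>t\<close> is the linear noise,
  \<open>a\<close> and \<open>b\<close> are the own and mean second powers, \<open>c\<close> and
  \<open>e\<close> the own and mean sixth powers. Linearity is thus used once, with the random terms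
  as variables.\<close>

lemma (in prob_space) affine_combination:
  fixes t a b c e :: "'a \<Rightarrow> real"
  assumes "integrable M t" "integrable M a" "integrable M c" "integrable M b" "integrable M e"
  shows integrable_affine_combination:
      "integrable M (\<lambda>\<omega>. k0 + k1 * t \<omega> + k2 * (k3 + k4 * (2 * (a \<omega> + b \<omega>)) + 32 * (c \<omega> + e \<omega>)))"
    and expectation_affine_combination:
      "expectation (\<lambda>\<omega>. k0 + k1 * t \<omega> + k2 * (k3 + k4 * (2 * (a \<omega> + b \<omega>)) + 32 * (c \<omega> + e \<omega>))) =
        k0 + k1 * expectation t + k2 * (k3 + k4 * (2 * (expectation a + expectation b))
          + 32 * (expectation c + expectation e))"
  using assms by (simp_all add: prob_space)

section \<open>The majorant of the new energies and its Gaussian expectation\<close>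

context particle_step
begin

definition \<sigma> :: real
  where "\<sigma> = sqrt (1 - (1 - \<gamma> * h)\<^sup>2)"

definition \<xi> :: "(nat \<times> nat \<Rightarrow> real) \<Rightarrow> nat \<Rightarrow> fseq"
  where "\<xi> \<omega> i = \<sigma> *\<^sub>R gauss_vec d \<omega> i"

definition \<kappa> :: real
  where "\<kappa> = 60 * A ^ 3"

definition P :: "nat \<Rightarrow> real"
  where "P i = (f i)\<^sup>2 + h * D i + A * h\<^sup>2 * (U i)\<^sup>2"

text \<open>The right side of \<open>cube_le\<close> with the powers of the combined noise
  \<open>e\<close> replaced by powers of the individual noises. It is affine in quantities whose
  Gaussian moments are known.\<close>

definition majorant :: "nat \<Rightarrow> (nat \<times> nat \<Rightarrow> real) \<Rightarrow> real"
  where "majorant i \<omega> = f i ^ 6 + 3 * f i ^ 4 * (h * D i) + 3 * (P i)\<^sup>2 * (noise_coeff i \<bullet> \<xi> \<omega> i)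
    + \<kappa> * (h\<^sup>2 * U i ^ 6
      + U i ^ 4 * (2 * ((norm (\<xi> \<omega> i))\<^sup>2 + avg N (\<lambda>j. (norm (\<xi> \<omega> j))\<^sup>2)))
      + 32 * (norm (\<xi> \<omega> i) ^ 6 + avg N (\<lambda>j. norm (\<xi> \<omega> j) ^ 6)))"

lemma B_ge_1: "1 \<le> B"
  using B by linarith

lemma A_ge_1: "1 \<le> A"
  using one_le_power[OF B_ge_1, of 6] by linarith

lemma \<kappa>_pos: "0 < \<kappa>"
proof -
  have "0 < A ^ 3" by (rule zero_less_power) (use A_ge_1 in linarith)
  then show ?thesis unfolding \<kappa>_def by linarith
qed

text \<open>\<sigma>^2 = 2 \<gamma> h - (\<gamma> h)^2 is of order \<open>h\<close>. The sixth
  power, of order h^3, is weakened to order \<open>h\<close>, the order allowed for the final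
  error.\<close>

lemma \<sigma>: "0 \<le> \<sigma>" "\<sigma>\<^sup>2 \<le> 2 * B * h" "\<sigma> ^ 6 \<le> 8 * B ^ 3 * h"
proof -
  have "0 \<le> \<gamma> * h" using \<gamma> h by simp
  then have "(1 - \<gamma> * h)\<^sup>2 \<le> 1" using h by (intro power_le_one) auto
  then have sq: "\<sigma>\<^sup>2 = 1 - (1 - \<gamma> * h)\<^sup>2" and nn: "0 \<le> \<sigma>"
    by (simp_all add: \<sigma>_def)
  have "1 - (1 - \<gamma> * h)\<^sup>2 = 2 * (\<gamma> * h) - (\<gamma> * h)\<^sup>2"
    by (simp add: power2_eq_square algebra_simps)
  moreover have "\<gamma> * h \<le> B * h" using B h by (intro mult_right_mono) auto
  moreover have "0 \<le> (\<gamma> * h)\<^sup>2" by simp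
  ultimately show 2: "\<sigma>\<^sup>2 \<le> 2 * B * h" unfolding sq by linarith
  show "0 \<le> \<sigma>" by (rule nn)
  have "\<sigma> ^ 6 = (\<sigma>\<^sup>2) ^ 3" by (simp flip: power_mult)
  also have "\<dots> \<le> (2 * B * h) ^ 3" using 2 by (intro power_mono) auto
  also have "\<dots> = 8 * B ^ 3 * h ^ 3" by (simp add: power_mult_distrib)
  also have "\<dots> \<le> 8 * B ^ 3 * h"
    using power_decreasing[of 1 3 h] h B_ge_1 by (intro mult_left_mono) auto
  finally show "\<sigma> ^ 6 \<le> 8 * B ^ 3 * h" .
qed

lemma norm_\<xi>: "norm (\<xi> \<omega> i) = \<sigma> * norm (gauss_vec d \<omega> i)"
  using \<sigma>(1) by (simp add: \<xi>_def)

lemma lyap_le_majorant: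
  "lyap N V \<alpha> (verlet h G (refresh d (1 - \<gamma> * h) (x, v) \<omega>)) \<le> (\<Sum>i<N. majorant i \<omega>)" (is ?le)
  "0 \<le> lyap N V \<alpha> (verlet h G (refresh d (1 - \<gamma> * h) (x, v) \<omega>))" (is ?nonneg)
proof -
  define w where "w = (\<lambda>j. (1 - \<gamma> * h) *\<^sub>R v j + \<xi> \<omega> j)"
  define y where "y = (\<lambda>j. x j + h *\<^sub>R w j - (h\<^sup>2 / 2) *\<^sub>R G x j)"
  define u where "u = (\<lambda>j. w j - (h / 2) *\<^sub>R (G x j + G y j))"
  have eq: "lyap N V \<alpha> (verlet h G (refresh d (1 - \<gamma> * h) (x, v) \<omega>)) = (\<Sum>i<N. lyap1 V \<alpha> (y i) (u i) ^ 3)"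
    unfolding verlet_refresh lyap_def u_def y_def w_def \<xi>_def \<sigma>_def by simp
  have \<xi>R: "\<xi> \<omega> j \<in> Rd d" for j by (simp add: \<xi>_def)
  have nn: "0 \<le> lyap1 V \<alpha> (y i) (u i)" if "i < N" for i
    using one_step_energy(2)[of "\<xi> \<omega>", OF \<xi>R that] by (simp add: w_def y_def u_def)
  show ?nonneg unfolding eq by (intro sum_nonneg zero_le_power) (use nn in auto)
  have "lyap1 V \<alpha> (y i) (u i) ^ 3 \<le> majorant i \<omega>" if i: "i < N" for i
  proof -
    define e where "e = norm (\<xi> \<omega> i) + avg N (\<lambda>j. norm (\<xi> \<omega> j))"
    have step: "lyap1 V \<alpha> (y i) (u i) \<le>
        (f i)\<^sup>2 + noise_coeff i \<bullet> \<xi> \<omega> i + h * D i + A * (h\<^sup>2 * (U i)\<^sup>2 + e\<^sup>2)"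
      "\<bar>noise_coeff i \<bullet> \<xi> \<omega> i\<bar> \<le> A * U i * e" "\<bar>D i\<bar> \<le> A * (U i)\<^sup>2"
      unfolding y_def u_def w_def e_def by (rule one_step_energy[OF \<xi>R i])+
    have e0: "0 \<le> e" unfolding e_def using avg_norm_nonneg[of "\<xi> \<omega>"] by simp
    have "lyap1 V \<alpha> (y i) (u i) ^ 3 \<le> f i ^ 6 + 3 * f i ^ 4 * (h * D i)
        + 3 * (P i)\<^sup>2 * (noise_coeff i \<bullet> \<xi> \<omega> i) + \<kappa> * (h\<^sup>2 * U i ^ 6 + U i ^ 4 * e\<^sup>2 + e ^ 6)"
      unfolding P_def \<kappa>_def
      by (rule cube_le[OF A_ge_1 h(1,2) f_nonneg[OF i] f_le_U[OF i] e0 step(3,2) nn[OF i] step(1)])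
    also have "\<dots> \<le> majorant i \<omega>"
    proof -
      have e2: "e\<^sup>2 \<le> 2 * ((norm (\<xi> \<omega> i))\<^sup>2 + avg N (\<lambda>j. (norm (\<xi> \<omega> j))\<^sup>2))"
      proof -
        have s1: "e\<^sup>2 \<le> 2 * ((norm (\<xi> \<omega> i))\<^sup>2 + (avg N (\<lambda>j. norm (\<xi> \<omega> j)))\<^sup>2)"
          unfolding e_def by (rule add_sq_le)
        have s2: "(avg N (\<lambda>j. norm (\<xi> \<omega> j)))\<^sup>2 \<le> avg N (\<lambda>j. (norm (\<xi> \<omega> j))\<^sup>2)"
          using avg_power_le[OF N, of "\<lambda>j. norm (\<xi> \<omega> j)" 2] by simp
        show ?thesis
          by (rule order_trans[OF s1 mult_left_mono[OF add_left_mono[OF s2]]]) simp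
      qed
      have e6: "e ^ 6 \<le> 32 * (norm (\<xi> \<omega> i) ^ 6 + avg N (\<lambda>j. norm (\<xi> \<omega> j) ^ 6))"
      proof -
        have s1: "e ^ 6 \<le> 32 * (norm (\<xi> \<omega> i) ^ 6 + avg N (\<lambda>j. norm (\<xi> \<omega> j)) ^ 6)"
          unfolding e_def by (rule add_pow6_le[OF norm_ge_zero avg_norm_nonneg])
        have s2: "avg N (\<lambda>j. norm (\<xi> \<omega> j)) ^ 6 \<le> avg N (\<lambda>j. norm (\<xi> \<omega> j) ^ 6)"
          using avg_power_le[OF N, of "\<lambda>j. norm (\<xi> \<omega> j)" 6] by simp
        show ?thesis
          by (rule order_trans[OF s1 mult_left_mono[OF add_left_mono[OF s2]]]) simp
      qed
      have "\<kappa> * (h\<^sup>2 * U i ^ 6 + U i ^ 4 * e\<^sup>2 + e ^ 6) \<le> \<kappa> * (h\<^sup>2 * U i ^ 6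
          + U i ^ 4 * (2 * ((norm (\<xi> \<omega> i))\<^sup>2 + avg N (\<lambda>j. (norm (\<xi> \<omega> j))\<^sup>2)))
          + 32 * (norm (\<xi> \<omega> i) ^ 6 + avg N (\<lambda>j. norm (\<xi> \<omega> j) ^ 6)))"
        by (rule mult_left_mono[OF _ less_imp_le[OF \<kappa>_pos]],
            rule add_mono[OF add_mono[OF order_refl mult_left_mono[OF e2]] e6]) simp
      then show ?thesis unfolding majorant_def by (rule add_left_mono)
    qed
    finally show ?thesis .
  qed
  then show ?le unfolding eq by (intro sum_mono) auto
qed

lemma
  assumes i: "i < N"
  shows integrable_majorant: "integrable (gauss d N) (majorant i)"
    and integral_majorant_le: "(\<integral>\<omega>. majorant i \<omega> \<partial>gauss d N) \<le>
      f i ^ 6 + 3 * h * (f i ^ 4 * D i) + \<kappa> * h\<^sup>2 * U i ^ 6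
      + 8 * \<kappa> * B * h * (real d * U i ^ 4) + 7680 * \<kappa> * B ^ 3 * h * real d ^ 3"
proof -
  interpret prob_space "gauss d N" by (rule prob_space_gauss)
  have i1: "integrable (gauss d N) (\<lambda>\<omega>. noise_coeff i \<bullet> \<xi> \<omega> i)"
    and e1: "(\<integral>\<omega>. noise_coeff i \<bullet> \<xi> \<omega> i \<partial>gauss d N) = 0"
    unfolding \<xi>_def using i by (simp_all add: integrable_gauss_vec_inner integral_gauss_vec_inner)
  have i2: "integrable (gauss d N) (\<lambda>\<omega>. (norm (\<xi> \<omega> j))\<^sup>2)"
    and e2: "(\<integral>\<omega>. (norm (\<xi> \<omega> j))\<^sup>2 \<partial>gauss d N) = \<sigma>\<^sup>2 * real d" if "j < N" for j
    unfolding norm_\<xi> power_mult_distrib using that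
    by (simp_all add: integrable_gauss_vec_2 integral_gauss_vec_2)
  have i6: "integrable (gauss d N) (\<lambda>\<omega>. norm (\<xi> \<omega> j) ^ 6)"
    and e6: "(\<integral>\<omega>. norm (\<xi> \<omega> j) ^ 6 \<partial>gauss d N) \<le> \<sigma> ^ 6 * (15 * real d ^ 3)" if "j < N" for j
    unfolding norm_\<xi> power_mult_distrib using that
    by (simp_all add: integrable_gauss_vec_6 integral_gauss_vec_6 mult_left_mono)
  have ia2: "integrable (gauss d N) (\<lambda>\<omega>. avg N (\<lambda>j. (norm (\<xi> \<omega> j))\<^sup>2))"
    and ia6: "integrable (gauss d N) (\<lambda>\<omega>. avg N (\<lambda>j. norm (\<xi> \<omega> j) ^ 6))"
    using i2 i6 by (auto intro!: Bochner_Integration.integrable_sum integrable_divide_zero)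
  have ea2: "(\<integral>\<omega>. avg N (\<lambda>j. (norm (\<xi> \<omega> j))\<^sup>2) \<partial>gauss d N) = \<sigma>\<^sup>2 * real d"
  proof -
    have "(\<integral>\<omega>. avg N (\<lambda>j. (norm (\<xi> \<omega> j))\<^sup>2) \<partial>gauss d N) = avg N (\<lambda>j. \<sigma>\<^sup>2 * real d)"
      using i2 e2 by (simp add: Bochner_Integration.integral_sum)
    then show ?thesis using N by simp
  qed
  have ea6: "(\<integral>\<omega>. avg N (\<lambda>j. norm (\<xi> \<omega> j) ^ 6) \<partial>gauss d N) \<le> \<sigma> ^ 6 * (15 * real d ^ 3)"
  proof -
    have "(\<integral>\<omega>. avg N (\<lambda>j. norm (\<xi> \<omega> j) ^ 6) \<partial>gauss d N) = avg N (\<lambda>j. \<integral>\<omega>. norm (\<xi> \<omega> j) ^ 6 \<partial>gauss d N)"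
      using i6 by (simp add: Bochner_Integration.integral_sum)
    also have "\<dots> \<le> avg N (\<lambda>j. \<sigma> ^ 6 * (15 * real d ^ 3))"
      by (rule avg_mono) (rule e6)
    finally show ?thesis using N by simp
  qed
  note int = i1 i2[OF i] i6[OF i] ia2 ia6
  show "integrable (gauss d N) (majorant i)"
    unfolding majorant_def[abs_def] by (rule integrable_affine_combination[OF int])
  have "(\<integral>\<omega>. majorant i \<omega> \<partial>gauss d N) = f i ^ 6 + 3 * f i ^ 4 * (h * D i)
      + \<kappa> * (h\<^sup>2 * U i ^ 6 + U i ^ 4 * (2 * (\<sigma>\<^sup>2 * real d + \<sigma>\<^sup>2 * real d))
      + 32 * ((\<integral>\<omega>. norm (\<xi> \<omega> i) ^ 6 \<partial>gauss d N) + (\<integral>\<omega>. avg N (\<lambda>j. norm (\<xi> \<omega> j) ^ 6) \<partial>gauss d N)))"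
    unfolding majorant_def expectation_affine_combination[OF int] e1 e2[OF i] ea2 by simp
  also have "\<dots> \<le> f i ^ 6 + 3 * f i ^ 4 * (h * D i)
      + \<kappa> * (h\<^sup>2 * U i ^ 6 + U i ^ 4 * (2 * (2 * B * h * real d + 2 * B * h * real d))
      + 32 * (8 * B ^ 3 * h * (15 * real d ^ 3) + 8 * B ^ 3 * h * (15 * real d ^ 3)))"
  proof -
    have s2: "\<sigma>\<^sup>2 * real d \<le> 2 * B * h * real d"
      using \<sigma>(2) by (intro mult_right_mono) auto
    have s6: "\<sigma> ^ 6 * (15 * real d ^ 3) \<le> 8 * B ^ 3 * h * (15 * real d ^ 3)"
      using \<sigma>(3) by (intro mult_right_mono) auto
    have "U i ^ 4 * (2 * (\<sigma>\<^sup>2 * real d + \<sigma>\<^sup>2 * real d)) \<le> U i ^ 4 * (2 * (2 * B * h * real d + 2 * B * h * real d))"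
      by (intro mult_left_mono add_mono s2) auto
    moreover have "32 * ((\<integral>\<omega>. norm (\<xi> \<omega> i) ^ 6 \<partial>gauss d N) + (\<integral>\<omega>. avg N (\<lambda>j. norm (\<xi> \<omega> j) ^ 6) \<partial>gauss d N))
      \<le> 32 * (8 * B ^ 3 * h * (15 * real d ^ 3) + 8 * B ^ 3 * h * (15 * real d ^ 3))"
      by (intro mult_left_mono add_mono order_trans[OF e6[OF i] s6] order_trans[OF ea6 s6]) simp
    ultimately show ?thesis
      by (intro add_left_mono mult_left_mono[OF _ less_imp_le[OF \<kappa>_pos]]) linarith
  qed
  \<comment> \<open>The constants are 8 = 2 (2 + 2) from the second moments and 7680 = 32 * 2 * 8 *
    15 from the sixth.\<close>
  also have "\<dots> = f i ^ 6 + 3 * h * (f i ^ 4 * D i) + \<kappa> * h\<^sup>2 * U i ^ 6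
      + 8 * \<kappa> * B * h * (real d * U i ^ 4) + 7680 * \<kappa> * B ^ 3 * h * real d ^ 3"
    by (simp add: algebra_simps)
  finally show "(\<integral>\<omega>. majorant i \<omega> \<partial>gauss d N) \<le>
      f i ^ 6 + 3 * h * (f i ^ 4 * D i) + \<kappa> * h\<^sup>2 * U i ^ 6
      + 8 * \<kappa> * B * h * (real d * U i ^ 4) + 7680 * \<kappa> * B ^ 3 * h * real d ^ 3" .
qed

text \<open>The Lyapunov function after the step is measurable and lies between 0 and an integrable
  majorant. Integrability matters since the Bochner integral in \<open>damping\<close> would
  otherwise take the default value 0.\<close>

lemma integrable_lyap:
  "integrable (gauss d N) (\<lambda>\<omega>. lyap N V \<alpha> (verlet h G (refresh d (1 - \<gamma> * h) (x, v) \<omega>)))"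
proof (rule Bochner_Integration.integrable_bound)
  show "integrable (gauss d N) (\<lambda>\<omega>. \<Sum>i<N. majorant i \<omega>)"
    by (intro Bochner_Integration.integrable_sum integrable_majorant) auto
  show "AE \<omega> in gauss d N. norm (lyap N V \<alpha> (verlet h G (refresh d (1 - \<gamma> * h) (x, v) \<omega>)))
      \<le> norm (\<Sum>i<N. majorant i \<omega>)"
  proof (rule AE_I2)
    fix \<omega>
    show "norm (lyap N V \<alpha> (verlet h G (refresh d (1 - \<gamma> * h) (x, v) \<omega>))) \<le> norm (\<Sum>i<N. majorant i \<omega>)"
      using lyap_le_majorant[of \<omega>] unfolding real_norm_def by linarith
  qed
qed (rule lyap_measurable[OF N G xR vR])

lemma lyap_eq: "lyap N V \<alpha> (x, v) = (\<Sum>i<N. f i ^ 6)"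
proof -
  have "f i ^ 6 = lyap1 V \<alpha> (x i) (v i) ^ 3" if "i < N" for i
    unfolding f_sq[OF that, symmetric] by (simp flip: power_mult)
  then show ?thesis by (simp add: lyap_def)
qed

lemma sum_drift:
  "3 * (\<Sum>i<N. f i ^ 4 * D i) \<le> - (27 / 16) * \<theta> * (\<Sum>i<N. f i ^ 6)
    + 3 * ((\<alpha> * K + 2 * \<theta> * R1 + 13 * M\<^sup>2 / \<theta>) * real d) * (\<Sum>i<N. f i ^ 4)"
proof (rule sum_drift_le[OF N f_nonneg, where X = "\<lambda>i. norm (x i)"])
  fix i assume i: "i < N"
  show "D i \<le> - (3 / 2) * \<theta> * (f i)\<^sup>2 - 2 / 5 * (\<alpha> * r) * (norm (x i))\<^sup>2
      + 9 / 4 * lam * avg N (\<lambda>j. norm (x j)) * f i + (\<alpha> * K + 2 * \<theta> * R1 + 13 * M\<^sup>2 / \<theta>) * real d"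
    unfolding D_def
    by (rule energy_drift[OF V_lower[OF xR[OF i]] V_upper[OF xR[OF i]] gV_inward[OF xR[OF i]]
        avg_norm_nonneg less_imp_le[OF M] of_nat_0_le_iff less_imp_le[OF K] less_imp_le[OF R0]
        less_imp_le[OF R1] f_nonneg[OF i]])
      (simp add: f_sq[OF i] lyap1_def)
qed (use f_ge in auto)

lemma sum_young_4_2:
  fixes g :: "nat \<Rightarrow> real"
  assumes "0 < \<tau>"
  shows "real d * (\<Sum>i<N. g i ^ 4) \<le> \<tau> * (\<Sum>i<N. g i ^ 6) + real N * (real d ^ 3 / \<tau>\<^sup>2)"
proof -
  have "(\<Sum>i<N. real d * g i ^ 4) \<le> (\<Sum>i<N. \<tau> * g i ^ 6 + real d ^ 3 / \<tau>\<^sup>2)"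
    using assms by (intro sum_mono young_4_2) auto
  then show ?thesis by (simp add: sum.distrib sum_distrib_left)
qed

text \<open>\<theta>' is a lower bound for the rate from which \<tau>, the step size bound and the
  error constant are built; this keeps them independent of c1. The gap between 27/16 \<theta> and
  \<theta> pays for the Young losses and for the terms of order h^2.\<close>

lemma transition_le:
  fixes \<theta>' :: real
  defines "k \<equiv> B * K + B * R1 + 13 * M\<^sup>2 / \<theta>'"
  defines "\<tau> \<equiv> \<theta>' / (8 * (3 * k + 512 * \<kappa> * B))"
  assumes \<theta>': "0 < \<theta>'" "\<theta>' \<le> \<theta>" and h_small: "h \<le> \<theta>' / (512 * \<kappa>)"
  shows "transition d N \<gamma> h G (lyap N V \<alpha>) (x, v) \<le> (1 - \<theta> * h) * lyap N V \<alpha> (x, v)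
    + ((3 * k + 8 * \<kappa> * B) / \<tau>\<^sup>2 + 7680 * \<kappa> * B ^ 3) * real N * h * real d ^ 3"
proof -
  let ?S = "\<Sum>i<N. f i ^ 6"
  define n where "n = real N * real d ^ 3"
  have S0: "0 \<le> ?S" by (intro sum_nonneg) auto
  have k0: "0 < k" unfolding k_def using B_ge_1 K R1 \<theta>' by (intro add_pos_nonneg add_pos_pos) auto
  have q0: "0 < 3 * k + 512 * \<kappa> * B" using k0 \<kappa>_pos B_ge_1 by (intro add_pos_pos mult_pos_pos) auto
  have \<tau>0: "0 < \<tau>" unfolding \<tau>_def using \<theta>' q0 by simp
  \<comment> \<open>Losses of the two uses of Young's inequality per unit of \<tau>: 3 k from the
    drift, and 512 \<kappa> B = 8 \<kappa> B * 64 from the noise term in \<open>U\<close>. The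
    choice of \<tau> makes them \<theta>'/8 together.\<close>
  have q\<tau>: "(3 * k + 512 * \<kappa> * B) * \<tau> = \<theta>' / 8"
    unfolding \<tau>_def using q0 by (simp add: field_simps)
  have h\<kappa>: "64 * (\<kappa> * h) \<le> \<theta>' / 8"
    using h_small \<kappa>_pos by (simp add: field_simps)
  have k_ge: "\<alpha> * K + 2 * \<theta> * R1 + 13 * M\<^sup>2 / \<theta> \<le> k"
  proof -
    have "\<alpha> * K \<le> B * K" using B K by (intro mult_right_mono) auto
    moreover have "2 * \<theta> * R1 \<le> B * R1"
      using theta_const_le[OF \<gamma> r c0 c1_pos] B R1 by (intro mult_right_mono) auto
    moreover have "13 * M\<^sup>2 / \<theta> \<le> 13 * M\<^sup>2 / \<theta>'"
      using \<theta>' by (intro divide_left_mono) auto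
    ultimately show ?thesis unfolding k_def by linarith
  qed
  have Y: "real d * (\<Sum>i<N. f i ^ 4) \<le> \<tau> * ?S + n / \<tau>\<^sup>2"
    using sum_young_4_2[OF \<tau>0, of f] by (simp add: n_def)
  have YU: "real d * (\<Sum>i<N. U i ^ 4) \<le> 64 * \<tau> * ?S + n / \<tau>\<^sup>2"
    using sum_young_4_2[OF \<tau>0, of U] mult_left_mono[OF sum_U_pow6 less_imp_le[OF \<tau>0]]
    by (simp add: n_def)
  have "transition d N \<gamma> h G (lyap N V \<alpha>) (x, v) \<le> (\<integral>\<omega>. (\<Sum>i<N. majorant i \<omega>) \<partial>gauss d N)"
    unfolding transition_def damping_def o_def
    by (intro integral_mono integrable_lyap lyap_le_majorant Bochner_Integration.integrable_sum
        integrable_majorant) auto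
  also have "\<dots> = (\<Sum>i<N. \<integral>\<omega>. majorant i \<omega> \<partial>gauss d N)"
    by (intro Bochner_Integration.integral_sum integrable_majorant) auto
  also have "\<dots> \<le> (\<Sum>i<N. f i ^ 6 + 3 * h * (f i ^ 4 * D i) + \<kappa> * h\<^sup>2 * U i ^ 6
      + 8 * \<kappa> * B * h * (real d * U i ^ 4) + 7680 * \<kappa> * B ^ 3 * h * real d ^ 3)"
    by (intro sum_mono integral_majorant_le) auto
  also have "\<dots> = ?S + h * (3 * (\<Sum>i<N. f i ^ 4 * D i)) + \<kappa> * h\<^sup>2 * (\<Sum>i<N. U i ^ 6)
      + 8 * \<kappa> * B * h * (real d * (\<Sum>i<N. U i ^ 4)) + 7680 * \<kappa> * B ^ 3 * h * n"
    by (simp add: sum.distrib sum_distrib_left n_def mult.assoc mult.left_commute)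
  finally have main: "transition d N \<gamma> h G (lyap N V \<alpha>) (x, v) \<le> \<dots>" .
  have b1: "h * (3 * (\<Sum>i<N. f i ^ 4 * D i)) \<le> h * (- (27 / 16) * \<theta> * ?S + 3 * k * (\<tau> * ?S + n / \<tau>\<^sup>2))"
  proof (rule mult_left_mono)
    have "3 * ((\<alpha> * K + 2 * \<theta> * R1 + 13 * M\<^sup>2 / \<theta>) * real d) * (\<Sum>i<N. f i ^ 4)
        = 3 * ((\<alpha> * K + 2 * \<theta> * R1 + 13 * M\<^sup>2 / \<theta>) * (real d * (\<Sum>i<N. f i ^ 4)))"
      by (simp only: mult.assoc)
    also have "\<dots> \<le> 3 * (k * (\<tau> * ?S + n / \<tau>\<^sup>2))"
      using k_ge k0 Y by (intro mult_left_mono mult_mono mult_nonneg_nonneg sum_nonneg) auto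
    finally show "3 * (\<Sum>i<N. f i ^ 4 * D i) \<le> - (27 / 16) * \<theta> * ?S + 3 * k * (\<tau> * ?S + n / \<tau>\<^sup>2)"
      using sum_drift by linarith
  qed (use h in simp)
  have b2: "\<kappa> * h\<^sup>2 * (\<Sum>i<N. U i ^ 6) \<le> h * (\<theta>' / 8 * ?S)"
  proof -
    have "\<kappa> * h\<^sup>2 * (\<Sum>i<N. U i ^ 6) \<le> \<kappa> * h\<^sup>2 * (64 * ?S)"
      using \<kappa>_pos by (intro mult_left_mono sum_U_pow6) auto
    also have "\<dots> = h * (64 * (\<kappa> * h) * ?S)" by (simp add: power2_eq_square)
    also have "\<dots> \<le> h * (\<theta>' / 8 * ?S)"
      using h\<kappa> S0 h by (intro mult_left_mono mult_right_mono) auto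
    finally show ?thesis .
  qed
  have b3: "8 * \<kappa> * B * h * (real d * (\<Sum>i<N. U i ^ 4)) \<le> 8 * \<kappa> * B * h * (64 * \<tau> * ?S + n / \<tau>\<^sup>2)"
    using YU \<kappa>_pos B_ge_1 h by (intro mult_left_mono) auto
  have "transition d N \<gamma> h G (lyap N V \<alpha>) (x, v) \<le> ?S
      + h * (- (27 / 16) * \<theta> * ?S + 3 * k * (\<tau> * ?S + n / \<tau>\<^sup>2)) + h * (\<theta>' / 8 * ?S)
      + 8 * \<kappa> * B * h * (64 * \<tau> * ?S + n / \<tau>\<^sup>2) + 7680 * \<kappa> * B ^ 3 * h * n"
    using main b1 b2 b3 by linarith
  also have "\<dots> = ?S + h * ?S * ((3 * k + 512 * \<kappa> * B) * \<tau> + \<theta>' / 8 - 27 / 16 * \<theta>)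
      + ((3 * k + 8 * \<kappa> * B) / \<tau>\<^sup>2 + 7680 * \<kappa> * B ^ 3) * h * n"
    by (simp add: algebra_simps add_divide_distrib)
  \<comment> \<open>The losses \<theta>'/8 + \<theta>'/8 are at most \<theta>/4, below the available
    11/16 \<theta>.\<close>
  also have "h * ?S * ((3 * k + 512 * \<kappa> * B) * \<tau> + \<theta>' / 8 - 27 / 16 * \<theta>) \<le> h * ?S * (- \<theta>)"
    unfolding q\<tau> using \<theta>' \<theta>_pos h S0 by (intro mult_left_mono) auto
  finally show ?thesis
    unfolding lyap_eq n_def by (simp add: algebra_simps)
qed

end

section \<open>Choice of the constants and the drift inequality\<close>

lemma quadratic_coefficient_le:
  assumes "d \<ge> 1" "\<And>y. y \<in> Rd d \<Longrightarrow> a + b * (norm y)\<^sup>2 \<le> a' + b' * (norm y)\<^sup>2"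
  shows "b \<le> b'"
proof (rule ccontr)
  assume "\<not> b \<le> b'"
  then have b: "0 < b - b'" by simp
  \<comment> \<open>The radius at which the excess (b - b') s^2 equals |a' - a| + 1 and so outweighs
    the difference of the constant terms; \<open>d \<ge> 1\<close> provides a unit vector.\<close>
  define s where "s = sqrt ((\<bar>a' - a\<bar> + 1) / (b - b'))"
  have "unit_vec 0 \<in> Rd d" using assms(1) by (intro unit_vec_Rd) auto
  then have y: "s *\<^sub>R unit_vec 0 \<in> Rd d" by simp
  have "(norm (unit_vec 0))\<^sup>2 = 1"
    using norm_Rd[OF unit_vec_Rd[of 0 1]] by simp
  then have "(norm (s *\<^sub>R unit_vec 0))\<^sup>2 = s\<^sup>2"
    by (simp add: power_mult_distrib)
  also have "\<dots> = (\<bar>a' - a\<bar> + 1) / (b - b')"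
    unfolding s_def using b by simp
  finally have "(b - b') * (norm (s *\<^sub>R unit_vec 0))\<^sup>2 = \<bar>a' - a\<bar> + 1"
    using b by simp
  then show False
    using assms(2)[OF y] by (simp add: left_diff_distrib)
qed

text \<open>\<open>h0\<close> and \<open>C\<close> are chosen before the dimension,
  \<open>lam\<close>, \<open>c1\<close>, the functional, \<open>h\<close> and \<open>N\<close>,
  which expresses their independence of these. The gradient enters as any \<open>G\<close> that is a
  gradient of the potential, and integrability is asserted along with the inequality because the
  integral of a non-integrable function is 0 by convention.\<close>

theorem proposition8:
  fixes M L c0 R0 R1 r K \<gamma> :: real
  assumes "M > 0" "L > 0" "c0 > 0" "R0 > 0" "R1 > 0" "r > 0" "K > 0" "\<gamma> > 0"
  shows "\<exists>h0>0. \<exists>C>0.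
    \<forall>(d::nat) (lam::real) (c1::real) (V::fseq \<Rightarrow> real) (gV::fseq \<Rightarrow> fseq) (HV::fseq \<Rightarrow> fseq \<Rightarrow> fseq)
      (F::fseq measure \<Rightarrow> real) (F1::fseq measure \<Rightarrow> real) (DF1::fseq measure \<Rightarrow> fseq \<Rightarrow> fseq).
      d \<ge> 1 \<and> lam > 0 \<and> c1 > 0 \<and>
      (\<forall>\<mu>\<in>P2 d. F \<mu> = (\<integral>x. V x \<partial>\<mu>) + F1 \<mu>) \<and>
      C2_on d V gV HV \<and> gV 0 = 0 \<and>
      intrinsic_derivative d F1 DF1 \<and>
      (\<forall>\<mu>\<in>P2 d. \<forall>y\<in>Rd d.
         norm (DF1 \<mu> y) \<le> M * sqrt (real d) + lam * norm y + lam * (\<integral>x. norm x \<partial>\<mu>)) \<and>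
      (\<forall>y\<in>Rd d. opnorm d (HV y) \<le> L \<and>
         - (y \<bullet> gV y) \<le> - r * (norm y)\<^sup>2 + K * real d \<and>
         real d * R1 + c1 * (norm y)\<^sup>2 \<ge> V y \<and> V y \<ge> real d * R0 + c0 * (norm y)\<^sup>2)
      \<longrightarrow>
      (\<forall>(h::real) (N::nat) (G::(nat \<Rightarrow> fseq) \<Rightarrow> nat \<Rightarrow> fseq) (z::state).
         0 < h \<and> h < 1 / \<gamma> \<and> h \<le> h0 \<and>
         N \<ge> 1 \<and> lam \<le> lambda0 \<gamma> r c0 c1 N \<and>
         is_grad_potN d F N G \<and> (\<forall>i<N. fst z i \<in> Rd d \<and> snd z i \<in> Rd d)
         \<longrightarrow>
         integrable (gauss d N)
           (\<lambda>\<omega>. lyap N V (alpha_const \<gamma> r c0) (verlet h G (refresh d (1 - \<gamma> * h) z \<omega>))) \<and>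
         transition d N \<gamma> h G (lyap N V (alpha_const \<gamma> r c0)) z
           \<le> (1 - theta_const \<gamma> r c0 c1 * h) * lyap N V (alpha_const \<gamma> r c0) z
             + C * real N * h * real d ^ 3)"
proof -
  let ?\<alpha> = "alpha_const \<gamma> r c0"
  \<comment> \<open>Each summand secures one of the bounds required of \<open>B\<close>;
    \<open>r\<close> is present because lam \<le> r/3.\<close>
  define B where "B = 2 + L + M + r + \<gamma> + ?\<alpha> + 1 / R0 + 2 / c0"
  \<comment> \<open>\<open>L\<close> replaces c1: since min c1 L \<le> L, this is at most the rate
    used below, and it depends on none of the quantities quantified later.\<close>
  define \<theta> where "\<theta> = theta_const \<gamma> r c0 L"
  define q where "q = 60 * (900 * B ^ 6) ^ 3"
  define k where "k = B * K + B * R1 + 13 * M\<^sup>2 / \<theta>"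
  define \<tau> where "\<tau> = \<theta> / (8 * (3 * k + 512 * q * B))"
  define h0 where "h0 = min 1 (\<theta> / (512 * q))"
  define C where "C = (3 * k + 8 * q * B) / \<tau>\<^sup>2 + 7680 * q * B ^ 3"
  have \<alpha>: "0 < ?\<alpha>" using assms by (simp add: alpha_const_pos)
  have pos: "0 < 1 / R0" "0 < 2 / c0" using assms by auto
  have B: "2 \<le> B" "L \<le> B" "M \<le> B" "r \<le> B" "\<gamma> \<le> B" "?\<alpha> \<le> B" "1 / R0 \<le> B" "2 / c0 \<le> B"
    unfolding B_def using assms \<alpha> pos by linarith+
  have BB: "B \<le> B\<^sup>2" using B(1) by (simp add: power2_eq_square)
  have BR0: "1 \<le> B\<^sup>2 * R0"
    using mult_right_mono[OF order_trans[OF B(7) BB], of R0] assms by simp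
  have Bc0: "2 \<le> B\<^sup>2 * c0"
    using mult_right_mono[OF order_trans[OF B(8) BB], of c0] assms by simp
  have \<theta>: "0 < \<theta>" unfolding \<theta>_def using assms by (simp add: theta_const_pos)
  have q: "0 < q" unfolding q_def using B(1) by simp
  have k: "0 < k" unfolding k_def using B(1) assms \<theta> by (intro add_pos_nonneg add_pos_pos) auto
  have \<tau>: "0 < \<tau>" unfolding \<tau>_def using \<theta> k q B(1)
    by (intro divide_pos_pos mult_pos_pos add_pos_pos) auto
  have h0: "0 < h0" unfolding h0_def using \<theta> q by simp
  have C: "0 < C" unfolding C_def using k q \<tau> B(1)
    by (intro add_pos_pos divide_pos_pos mult_pos_pos) auto
  have main: "integrable (gauss d N) (\<lambda>\<omega>. lyap N V ?\<alpha> (verlet h G (refresh d (1 - \<gamma> * h) z \<omega>))) \<and>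
      transition d N \<gamma> h G (lyap N V ?\<alpha>) z \<le>
        (1 - theta_const \<gamma> r c0 c1 * h) * lyap N V ?\<alpha> z + C * real N * h * real d ^ 3"
    if d: "d \<ge> 1" and lam: "lam > 0" and c1: "c1 > 0"
      and F: "\<forall>\<mu>\<in>P2 d. F \<mu> = (\<integral>x. V x \<partial>\<mu>) + F1 \<mu>"
      and C2: "C2_on d V gV HV" and gV0: "gV 0 = 0"
      and DF1: "intrinsic_derivative d F1 DF1"
      and bound: "\<forall>\<mu>\<in>P2 d. \<forall>y\<in>Rd d.
        norm (DF1 \<mu> y) \<le> M * sqrt (real d) + lam * norm y + lam * (\<integral>x. norm x \<partial>\<mu>)"
      and V: "\<forall>y\<in>Rd d. opnorm d (HV y) \<le> L \<and> - (y \<bullet> gV y) \<le> - r * (norm y)\<^sup>2 + K * real d \<and>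
        real d * R1 + c1 * (norm y)\<^sup>2 \<ge> V y \<and> V y \<ge> real d * R0 + c0 * (norm y)\<^sup>2"
      and h: "0 < h" "h < 1 / \<gamma>" "h \<le> h0" and N: "N \<ge> 1" and lam0: "lam \<le> lambda0 \<gamma> r c0 c1 N"
      and G: "is_grad_potN d F N G" and z: "\<forall>i<N. fst z i \<in> Rd d \<and> snd z i \<in> Rd d"
    for d N :: nat and lam c1 h :: real and V F F1 gV HV DF1 G and z :: state
  proof -
    obtain x v where zxv: "z = (x, v)" by (cases z)
    have grad: "has_grad d V (gV y) y" if "y \<in> Rd d" for y
      using C2 that by (auto simp: C2_on_def)
    have lip: "norm (gV w - gV y) \<le> L * norm (w - y)" if "y \<in> Rd d" "w \<in> Rd d" for y w
      by (rule gradient_lipschitz[OF C2 _ that]) (use V in auto)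
    \<comment> \<open>Quadratic bound at the origin, where the gradient vanishes and V(0) \<le> d
      R1.\<close>
    have V_L: "V y \<le> real d * R1 + L * (norm y)\<^sup>2" if "y \<in> Rd d" for y
      using quadratic_upper_bound[OF grad lip _ Rd_zero that] assms gV0 V Rd_zero[of d] by fastforce
    have c0c1: "c0 \<le> c1"
      by (rule quadratic_coefficient_le[OF d, of "real d * R0" _ "real d * R1"]) (use V in force)
    \<comment> \<open>Together with \<open>c0c1\<close> this keeps c0 \<le> min c1 L, as
      \<open>drift_constants\<close> demands of its growth constant.\<close>
    have c0L: "c0 \<le> L"
      by (rule quadratic_coefficient_le[OF d, of "real d * R0" _ "real d * R1"]) (use V V_L in force)
    define c where "c = min c1 L"
    have c: "c0 \<le> c" "0 < c" "c \<le> c1" "c \<le> L"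
      unfolding c_def using c0c1 c0L c1 assms by auto
    have V_c: "V y \<le> real d * R1 + c * (norm y)\<^sup>2" if "y \<in> Rd d" for y
      unfolding c_def using V V_L[OF that] that by (cases "c1 \<le> L") auto
    note ll = lambda0_le[OF assms(8,6,3) c0c1 N lam lam0]
    have \<theta>c1: "theta_const \<gamma> r c0 c1 \<le> theta_const \<gamma> r c0 c"
      and \<theta>L: "\<theta> \<le> theta_const \<gamma> r c0 c"
      unfolding \<theta>_def using theta_const_antimono[OF assms(8,6,3) c(2)] c by auto
    have h_le: "h \<le> \<theta> / (512 * q)" using h by (simp add: h0_def)
    interpret particle_step d M lam V gV F F1 DF1 \<gamma> r c0 c L K R0 R1 B h N G x v
    proof
      show "h \<le> 1" using h by (simp add: h0_def)
      show "\<gamma> * h \<le> 1" using h assms by (simp add: field_simps)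
      show "lam \<le> B" using ll(1) assms B(4) by linarith
    qed (use assms d N h lam F grad DF1 bound lip V V_c c ll \<theta>c1 gV0 G z zxv B BR0 Bc0 in auto)
    have q_eq: "q = \<kappa>"
      by (simp only: q_def \<kappa>_def)
    have "transition d N \<gamma> h G (lyap N V ?\<alpha>) (x, v) \<le>
        (1 - theta_const \<gamma> r c0 c * h) * lyap N V ?\<alpha> (x, v) + C * real N * h * real d ^ 3"
      unfolding C_def \<tau>_def k_def q_eq
      by (rule transition_le) (use \<theta> \<theta>L h_le[unfolded q_eq] in auto)
    \<comment> \<open>Nonnegativity of the Lyapunov function allows the rate for min c1 L to be
      lowered to the rate for c1.\<close>
    moreover have "0 \<le> lyap N V ?\<alpha> (x, v)"
      unfolding lyap_eq by (intro sum_nonneg) auto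
    then have "(1 - theta_const \<gamma> r c0 c * h) * lyap N V ?\<alpha> (x, v) \<le>
        (1 - theta_const \<gamma> r c0 c1 * h) * lyap N V ?\<alpha> (x, v)"
      using \<theta>c1 h by (intro mult_right_mono diff_left_mono) auto
    ultimately show ?thesis
      unfolding zxv using integrable_lyap by auto
  qed
  show ?thesis
    by (rule exI[of _ h0], rule conjI[OF h0], rule exI[of _ C], rule conjI[OF C])
      (intro allI impI, elim conjE, rule main, assumption+)
qed

end
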